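(* Let $m,n\to\infty$ with $\frac{\ln n}{m-1}\to\tau\in[0,\infty]$. Then the following hold. (1) We have $R/n\to e^{\gamma-1+\tau}$, where $R:=\operatorname{Vol}(\mathcal{Q}_{m,n}\cap \mathcal{D}_{m,n})/\operatorname{Vol}(\mathcal{P}_{m,n}\cap \mathcal{D}_{m,n})$ and where the limit is interpreted as $+\infty$ when $\tau=\infty$. (2) If $(x,y)$ is uniformly distributed on $\mathcal{P}_{m,n}\cap \mathcal{D}_{m,n}$, then each $y_i$ converges in distribution to the uniform distribution on $[1-e^{-\tau},1]$. This limit is the point mass at $1$ when $\tau=\infty$, and it is the uniform distribution on $[0,1]$ when $\tau=0$. (3) If $(x,y)$ is uniformly distributed on $\mathcal{Q}_{m,n}\cap \mathcal{D}_{m,n}$, then each $y_i$ converges in distribution to the uniform distribution on $[0,1]$, for every $\tau$. In particular, the critical scaling is $m\sim\beta\ln n$, with $\tau=1/\beta$.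
   Context: Let $m\ge2$, $n\ge1$ be integers, $M=\{1,\dots,m\}$, $N=\{1,\dots,n\}$. The set $\mathcal{P}_{m,n}$ (strong relaxation) consists of all $(x,y)\in\mathbb{R}^{m\times n}\times\mathbb{R}^m$ with $0\le x_{ij}\le y_i$ for all $(i,j)\in M\times N$ and $y_i\le 1$ for all $i\in M$. The set $\mathcal{Q}_{m,n}$ (weak relaxation) consists of all $(x,y)\in\mathbb{R}^{m\times n}\times\mathbb{R}^m$ with $\sum_{j\in N}x_{ij}\le n y_i$ for all $i\in M$, $0\le x_{ij}\le 1$ for all $(i,j)\in M\times N$, and $y_i\le1$ for all $i\in M$. The demand constraints define $\mathcal{D}_{m,n}=\{(x,y)\in\mathbb{R}^{m\times n}\times\mathbb{R}^m:\ \sum_{i\in M}x_{ij}=1\ \ \forall j\in N\}$, an affine subspace of dimension $d=(m-1)n+m$. For $K\subset\mathcal{D}_{m,n}$, $\operatorname{Vol}(K)$ denotes the $d$-dimensional Lebesgue measure of the image of $K$ under the coordinate projection $\mathcal{D}_{m,n}\to\mathbb{R}^d$ that deletes the variables $x_{mj}$, $j\in N$ (an affine bijection); uniform distributions on subsets of $\mathcal{D}_{m,n}$ are with respect to $\operatorname{Vol}$. $\gamma$ is Euler's constant, $\ln$ is the natural logarithm, $a\sim b$ means $a/b\to1$, and $e^{-\infty}=0$. Limits are along any sequence of pairs $(m,n)$ as described. (By symmetry, the law of $y_i$ does not depend on $i\in M$.) *)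

theory Defs
  imports "HOL-Probability.Probability" "HOL-Library.Landau_Symbols"
begin

text \<open>
  A point \<open>(x, y)\<close> of \<open>\<real>\<^sup>m\<^sup>\<times>\<^sup>n \<times> \<real>\<^sup>m\<close> is a pair of extensional functions (see \<open>PiE\<close>), with
  \<open>x\<^sub>i\<^sub>j\<close> written as \<open>x (i, j)\<close>.
\<close>

type_synonym point = "(nat \<times> nat \<Rightarrow> real) \<times> (nat \<Rightarrow> real)"

definition points :: "nat \<Rightarrow> nat \<Rightarrow> point set" where
  "points m n = ({1..m} \<times> {1..n} \<rightarrow>\<^sub>E UNIV) \<times> ({1..m} \<rightarrow>\<^sub>E UNIV)"

definition strong_relaxation :: "nat \<Rightarrow> nat \<Rightarrow> point set" where
  "strong_relaxation m n = {(x, y) \<in> points m n.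
     (\<forall>i\<in>{1..m}. \<forall>j\<in>{1..n}. 0 \<le> x (i, j) \<and> x (i, j) \<le> y i) \<and> (\<forall>i\<in>{1..m}. y i \<le> 1)}"

definition weak_relaxation :: "nat \<Rightarrow> nat \<Rightarrow> point set" where
  "weak_relaxation m n = {(x, y) \<in> points m n.
     (\<forall>i\<in>{1..m}. (\<Sum>j\<in>{1..n}. x (i, j)) \<le> real n * y i) \<and>
     (\<forall>i\<in>{1..m}. \<forall>j\<in>{1..n}. 0 \<le> x (i, j) \<and> x (i, j) \<le> 1) \<and>
     (\<forall>i\<in>{1..m}. y i \<le> 1)}"

definition demand :: "nat \<Rightarrow> nat \<Rightarrow> point set" where
  "demand m n = {(x, y) \<in> points m n. \<forall>j\<in>{1..n}. (\<Sum>i\<in>{1..m}. x (i, j)) = 1}"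

definition proj :: "nat \<Rightarrow> nat \<Rightarrow> point \<Rightarrow> point" where
  "proj m n = (\<lambda>(x, y). (restrict x ({1..<m} \<times> {1..n}), y))"

text \<open>Lebesgue measure in the \<open>(m - 1) n + m\<close> coordinates that \<^const>\<open>proj\<close> keeps.\<close>

definition coord_lebesgue :: "nat \<Rightarrow> nat \<Rightarrow> point measure" where
  "coord_lebesgue m n =
     completion ((\<Pi>\<^sub>M p\<in>{1..<m} \<times> {1..n}. lborel) \<Otimes>\<^sub>M (\<Pi>\<^sub>M i\<in>{1..m}. lborel))"

definition vol_measure :: "nat \<Rightarrow> nat \<Rightarrow> point measure" where
  "vol_measure m n = measure_of (demand m n)
     {K. K \<subseteq> demand m n \<and> proj m n ` K \<in> sets (coord_lebesgue m n)}
     (\<lambda>K. emeasure (coord_lebesgue m n) (proj m n ` K))"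

definition Vol :: "nat \<Rightarrow> nat \<Rightarrow> point set \<Rightarrow> real" where
  "Vol m n K = measure (vol_measure m n) K"

definition uniform_law_y :: "nat \<Rightarrow> nat \<Rightarrow> point set \<Rightarrow> nat \<Rightarrow> real measure" where
  "uniform_law_y m n K i = distr (uniform_measure (vol_measure m n) K) borel (\<lambda>(x, y). y i)"

definition volume_ratio :: "nat \<Rightarrow> nat \<Rightarrow> real" where
  "volume_ratio m n = Vol m n (weak_relaxation m n \<inter> demand m n) /
                      Vol m n (strong_relaxation m n \<inter> demand m n)"

definition eexp :: "ereal \<Rightarrow> ereal" where
  "eexp t = (if t = \<infinity> then \<infinity> else if t = - \<infinity> then 0 else ereal (exp (real_of_ereal t)))"

text \<open>The uniform distribution on \<open>[a, b]\<close>, read as a point mass when \<open>a = b\<close>.\<close>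

definition uniform_Icc :: "real \<Rightarrow> real \<Rightarrow> real measure" where
  "uniform_Icc a b = (if a = b then return borel b else uniform_measure lborel {a..b})"

text \<open>
  The set function in \<^const>\<open>vol_measure\<close> is countably additive on a sigma-algebra, so
  \<^const>\<open>measure_of\<close> does not fall back to the zero measure.
\<close>

lemma space_coord_lebesgue:
  "space (coord_lebesgue m n) = ({1..<m} \<times> {1..n} \<rightarrow>\<^sub>E UNIV) \<times> ({1..m} \<rightarrow>\<^sub>E UNIV)"
  by (simp add: coord_lebesgue_def space_pair_measure space_PiM)

lemma bij_betw_proj:
  assumes "m \<ge> 1"
  shows "bij_betw (proj m n) (demand m n) (space (coord_lebesgue m n))"
proof -
  define g :: "point \<Rightarrow> point" where
    "g = (\<lambda>(x, y). (\<lambda>(i, j)\<in>{1..m} \<times> {1..n}.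
       if i = m then 1 - (\<Sum>k\<in>{1..<m}. x (k, j)) else x (i, j), y))"
  have m: "{1..m} = insert m {1..<m}" using assms by auto
  have split: "(\<Sum>i\<in>{1..m}. f i) = f m + (\<Sum>i\<in>{1..<m}. f i)" for f :: "nat \<Rightarrow> real"
    unfolding m by (subst sum.insert) auto
  show ?thesis
  proof (rule bij_betw_byWitness[where f' = g])
    show "\<forall>a\<in>demand m n. g (proj m n a) = a"
    proof (clarify)
      fix x y assume a: "(x, y) \<in> demand m n"
      have s: "x (m, j) = 1 - (\<Sum>k\<in>{1..<m}. x (k, j))" if "j \<in> {1..n}" for j
        using a that split[of "\<lambda>i. x (i, j)"] by (auto simp: demand_def)
      have "fst (g (proj m n (x, y))) p = x p" for p
      proof (cases "p \<in> {1..m} \<times> {1..n}")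
        case True
        then show ?thesis using s by (auto simp: g_def proj_def)
      next
        case False
        have "x \<in> extensional ({1..m} \<times> {1..n})"
          using a by (simp add: demand_def points_def PiE_def)
        then have "x p = undefined" using False by (rule extensional_arb)
        then show ?thesis using False by (auto simp: g_def proj_def)
      qed
      moreover have "snd (g (proj m n (x, y))) = y" by (simp add: g_def proj_def)
      ultimately show "g (proj m n (x, y)) = (x, y)" by (auto intro!: prod_eqI)
    qed
    show "\<forall>a\<in>space (coord_lebesgue m n). proj m n (g a) = a"
    proof (clarify)
      fix x y assume a: "(x, y) \<in> space (coord_lebesgue m n)"
      have "fst (proj m n (g (x, y))) p = x p" for p
      proof (cases "p \<in> {1..<m} \<times> {1..n}")
        case True
        then show ?thesis by (auto simp: g_def proj_def)
      next
        case False
        have "x \<in> extensional ({1..<m} \<times> {1..n})"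
          using a by (simp add: space_coord_lebesgue PiE_def)
        then have "x p = undefined" using False by (rule extensional_arb)
        then show ?thesis using False by (auto simp: g_def proj_def)
      qed
      moreover have "snd (proj m n (g (x, y))) = y" by (simp add: g_def proj_def)
      ultimately show "proj m n (g (x, y)) = (x, y)" by (auto intro!: prod_eqI)
    qed
    show "proj m n ` demand m n \<subseteq> space (coord_lebesgue m n)"
      unfolding space_coord_lebesgue
      by (rule image_subsetI) (simp add: demand_def points_def proj_def case_prod_beta PiE_def)
    show "g ` space (coord_lebesgue m n) \<subseteq> demand m n"
    proof (rule image_subsetI)
      fix p assume p: "p \<in> space (coord_lebesgue m n)"
      obtain x y where xy: "p = (x, y)" by (cases p)
      have a: "(x, y) \<in> space (coord_lebesgue m n)" using p xy by simp
      have "(\<Sum>i\<in>{1..m}. fst (g (x, y)) (i, j)) = 1" if "j \<in> {1..n}" for j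
      proof -
        have "(\<Sum>i\<in>{1..<m}. fst (g (x, y)) (i, j)) = (\<Sum>i\<in>{1..<m}. x (i, j))"
          using that by (intro sum.cong) (auto simp: g_def)
        moreover have "fst (g (x, y)) (m, j) = 1 - (\<Sum>i\<in>{1..<m}. x (i, j))"
          using that assms by (simp add: g_def)
        ultimately show ?thesis using split[of "\<lambda>i. fst (g (x, y)) (i, j)"] by linarith
      qed
      moreover have "g (x, y) \<in> points m n"
        using a unfolding g_def points_def space_coord_lebesgue by (simp add: PiE_def)
      ultimately show "g p \<in> demand m n"
        unfolding demand_def xy by (simp add: case_prod_beta)
    qed
  qed
qed

lemma
  assumes "m \<ge> 1"
  shows space_vol_measure: "space (vol_measure m n) = demand m n"
    and sets_vol_measure: "sets (vol_measure m n) =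
      {K. K \<subseteq> demand m n \<and> proj m n ` K \<in> sets (coord_lebesgue m n)}"
    and emeasure_vol_measure: "K \<in> sets (vol_measure m n) \<Longrightarrow>
      emeasure (vol_measure m n) K = emeasure (coord_lebesgue m n) (proj m n ` K)"
proof -
  let ?L = "coord_lebesgue m n" and ?D = "demand m n" and ?p = "proj m n"
  let ?S = "{K. K \<subseteq> ?D \<and> ?p ` K \<in> sets ?L}"
  have inj: "inj_on ?p ?D" and im: "?p ` ?D = space ?L"
    using bij_betw_proj[OF assms] by (auto simp: bij_betw_def)
  have sa: "sigma_algebra ?D ?S"
    unfolding sigma_algebra_iff2
  proof (intro conjI ballI allI impI)
    show "?S \<subseteq> Pow ?D" "{} \<in> ?S" by auto
  next
    fix K assume K: "K \<in> ?S"
    then have "?p ` (?D - K) = space ?L - ?p ` K"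
      using inj im by (simp add: inj_on_image_set_diff[OF inj])
    then show "?D - K \<in> ?S" using K by auto
  next
    fix A :: "nat \<Rightarrow> point set" assume "range A \<subseteq> ?S"
    then show "(\<Union>i. A i) \<in> ?S" by (auto simp: image_UN)
  qed
  show "space (vol_measure m n) = ?D"
    unfolding vol_measure_def by (rule space_measure_of) auto
  show sets: "sets (vol_measure m n) = ?S"
    unfolding vol_measure_def by (rule sigma_algebra.sets_measure_of_eq[OF sa])
  show "emeasure (vol_measure m n) K = emeasure ?L (?p ` K)" if "K \<in> sets (vol_measure m n)"
    unfolding vol_measure_def
  proof (rule emeasure_measure_of_sigma[OF sa])
    show "positive ?S (\<lambda>K. emeasure ?L (?p ` K))" by (simp add: positive_def)
    show "countably_additive ?S (\<lambda>K. emeasure ?L (?p ` K))"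
    proof (rule countably_additiveI)
      fix A :: "nat \<Rightarrow> point set"
      assume A: "range A \<subseteq> ?S" "disjoint_family A"
      have "disjoint_family (\<lambda>i. ?p ` A i)"
        unfolding disjoint_family_on_def
      proof (intro ballI impI)
        fix i j :: nat assume "i \<noteq> j"
        then have "A i \<inter> A j = {}" using A(2) by (auto simp: disjoint_family_on_def)
        moreover have "A i \<subseteq> ?D" "A j \<subseteq> ?D" using A(1) by auto
        ultimately show "?p ` A i \<inter> ?p ` A j = {}"
          using inj by (metis image_empty inj_on_image_Int)
      qed
      moreover have "range (\<lambda>i. ?p ` A i) \<subseteq> sets ?L" using A(1) by auto
      ultimately show "(\<Sum>i. emeasure ?L (?p ` A i)) = emeasure ?L (?p ` (\<Union>i. A i))"
        by (simp add: suminf_emeasure image_UN)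
    qed
    show "K \<in> ?S" using that sets by simp
  qed
qed

end

theory Submission
  imports Defs "HOL-Real_Asymp.Real_Asymp"
begin

text \<open>
  The columns of \<open>x\<close> range independently over the simplex. Write \<open>k = m - 1\<close>, let \<open>X\<close> be uniform on
  the simplex and let \<open>F(y) = P(X\<^sub>i \<le> y\<^sub>i for all i)\<close>. Up to the factor \<open>(1 / k!)\<^sup>n\<close>, the volume of
  the strong relaxation is the integral of \<open>F\<^sup>n\<close> over the unit cube, and \<open>y\<close> has density
  proportional to \<open>F\<^sup>n\<close>. Put \<open>w\<^sub>i = (1 - y\<^sub>i)\<^sup>k\<close> and \<open>s = w\<^sub>1 + \<dots> + w\<^sub>m\<close>. The union bound and the
  second moment method give \<open>1 - s \<le> F \<le> 1 / (1 + s)\<close>, because \<open>P(X\<^sub>i > y\<^sub>i) = w\<^sub>i\<close> and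
  \<open>P(X\<^sub>i > y\<^sub>i, X\<^sub>j > y\<^sub>j) \<le> w\<^sub>i w\<^sub>j\<close>. Hence \<open>F\<^sup>n\<close> lies, up to errors that are exponentially small in
  \<open>sqrt n\<close>, between products \<open>\<Prod>(1 - w\<^sub>i)\<^sup>N\<close> with \<open>N / n \<rightarrow> 1\<close>, whose integral is \<open>I\<^sup>m\<close> with
  \<open>I = \<integral>(1 - v\<^sup>k)\<^sup>N dv = \<Prod>\<^sub>j kj / (kj + 1) \<approx> exp (- H\<^sub>N / k)\<close>. The harmonic number \<open>H\<^sub>N\<close>
  produces Euler's constant: the volume is asymptotic to \<open>e\<^sup>-\<^sup>\<gamma> n\<^sup>-\<^sup>1\<^sup>-\<^sup>1\<^sup>/\<^sup>k\<close>. The same comparison of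
  kernels shows that \<open>(1 - y\<^sub>i) / I\<close> becomes uniform on \<open>[0, 1]\<close>, and \<open>I\<close> tends to \<open>e\<^sup>-\<^sup>\<tau>\<close>.

  For the weak relaxation, given \<open>x\<close>, the \<open>y\<^sub>i\<close> are independent and uniform on \<open>[s\<^sub>i, 1]\<close>, where the
  row averages \<open>s\<^sub>i\<close> sum to 1 and are uniformly small, so that \<open>\<Prod>(1 - s\<^sub>i) \<rightarrow> 1 / e\<close>.
\<close>


section \<open>The uniform distribution on the simplex\<close>

definition col_space :: "nat \<Rightarrow> (nat \<Rightarrow> real) measure" where
  "col_space m = Pi\<^sub>M {1..<m} (\<lambda>_. lborel)"

text \<open>A column of \<open>x\<close> is stored without its entry in row \<open>m\<close>, the
  one that \<open>proj\<close> deletes; the demand constraint restores that entry.\<close>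

definition lift :: "nat \<Rightarrow> (nat \<Rightarrow> real) \<Rightarrow> nat \<Rightarrow> real" where
  "lift m c l = (if l = m then 1 - (\<Sum>i\<in>{1..<m}. c i) else c l)"

definition col_simplex :: "nat \<Rightarrow> (nat \<Rightarrow> real) set" where
  "col_simplex m = {c \<in> space (col_space m). \<forall>l\<in>{1..m}. 0 \<le> lift m c l}"

definition col_dist :: "nat \<Rightarrow> (nat \<Rightarrow> real) measure" where
  "col_dist m = uniform_measure (col_space m) (col_simplex m)"

section \<open>Volumes of simplices and their translates\<close>

interpretation lborel_product: product_sigma_finite "\<lambda>_::'a. lborel :: real measure"
  by standard

lemma sigma_finite_col_space: "sigma_finite_measure (col_space m)"
  unfolding col_space_def by (rule lborel_product.sigma_finite) simp

lemma sum_lift: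
  assumes "m \<ge> 1"
  shows "(\<Sum>l\<in>{1..m}. lift m c l) = 1"
proof -
  have "{1..m} = insert m {1..<m}" using assms by auto
  moreover have "(\<Sum>l\<in>{1..<m}. lift m c l) = (\<Sum>l\<in>{1..<m}. c l)"
    by (intro sum.cong) (auto simp: lift_def)
  ultimately show ?thesis by (simp add: lift_def)
qed

lemma measurable_lift [measurable]:
  "l \<in> {1..m} \<Longrightarrow> (\<lambda>c. lift m c l) \<in> borel_measurable (col_space m)"
  unfolding lift_def col_space_def by (cases "l = m") (auto intro!: borel_measurable_sum)

lemma lift_ge_set_measurable:
  "{c \<in> space (col_space m). \<forall>l\<in>{1..m}. a l \<le> lift m c l} \<in> sets (col_space m)"
  by measurable

lemma col_simplex_measurable [measurable]: "col_simplex m \<in> sets (col_space m)"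
  unfolding col_simplex_def by (rule lift_ge_set_measurable)

text \<open>Boxes determine a product measure, and on a box the claim splits into the translation
  invariance of \<open>lborel\<close> in each coordinate.\<close>

lemma distr_PiM_lborel_translate:
  fixes a :: "'a \<Rightarrow> real"
  assumes "finite I"
  shows "distr (Pi\<^sub>M I (\<lambda>_. lborel)) (Pi\<^sub>M I (\<lambda>_. lborel)) (\<lambda>c. \<lambda>i\<in>I. a i + c i) = Pi\<^sub>M I (\<lambda>_. lborel)"
proof (rule lborel_product.PiM_eqI[OF assms])
  fix A :: "'a \<Rightarrow> real set" assume A: "\<And>i. i \<in> I \<Longrightarrow> A i \<in> sets lborel"
  let ?T = "\<lambda>c. \<lambda>i\<in>I. a i + c i"
  have T: "?T \<in> measurable (Pi\<^sub>M I (\<lambda>_. lborel)) (Pi\<^sub>M I (\<lambda>_. lborel))"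
    by (intro measurable_restrict) simp
  have P: "(\<lambda>x. a i + x) -` A i \<in> sets borel" if "i \<in> I" for i
    using measurable_sets[of "\<lambda>x. a i + x" borel borel "A i"] A[OF that] by simp
  have eq: "?T -` Pi\<^sub>E I A \<inter> space (Pi\<^sub>M I (\<lambda>_. lborel)) = Pi\<^sub>E I (\<lambda>i. (\<lambda>x. a i + x) -` A i)"
    by (auto simp: space_PiM PiE_iff)
  have "emeasure (distr (Pi\<^sub>M I (\<lambda>_. lborel)) (Pi\<^sub>M I (\<lambda>_. lborel)) ?T) (Pi\<^sub>E I A)
      = (\<Prod>i\<in>I. emeasure lborel ((\<lambda>x. a i + x) -` A i))"
    using A P assms
    by (subst emeasure_distr[OF T]) (auto simp: eq lborel_product.emeasure_PiM sets_PiM_I_finite)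
  also have "\<dots> = (\<Prod>i\<in>I. emeasure lborel (A i))"
  proof (rule prod.cong[OF refl])
    fix i assume "i \<in> I"
    then have "emeasure (distr lborel borel ((+) (a i))) (A i) = emeasure lborel ((\<lambda>x. a i + x) -` A i)"
      using A by (subst emeasure_distr) auto
    then show "emeasure lborel ((\<lambda>x. a i + x) -` A i) = emeasure lborel (A i)"
      by (simp add: lborel_distr_plus)
  qed
  finally show "emeasure (distr (Pi\<^sub>M I (\<lambda>_. lborel)) (Pi\<^sub>M I (\<lambda>_. lborel)) ?T) (Pi\<^sub>E I A) =
    (\<Prod>i\<in>I. emeasure lborel (A i))" .
qed simp

text \<open>Subtracting \<open>a\<close> from the kept coordinates turns the set into the corner
  simplex \<open>c \<ge> 0\<close>, \<open>sum c \<le> t\<close>, where \<open>t\<close> is 1 minus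
  the sum of all \<open>a l\<close>. For \<open>t < 0\<close> the set is empty, and the right side
  is 0 because the exponent \<open>m - 1\<close> is positive.\<close>

lemma emeasure_lift_ge:
  assumes "m \<ge> 2"
  shows "emeasure (col_space m) {c \<in> space (col_space m). \<forall>l\<in>{1..m}. a l \<le> lift m c l}
    = ennreal ((max 0 (1 - (\<Sum>l\<in>{1..m}. a l))) ^ (m - 1) / fact (m - 1))"
proof -
  let ?I = "{1..<m}" and ?L = "col_space m"
  define t where "t = 1 - (\<Sum>l\<in>{1..m}. a l)"
  let ?S = "{c. (\<forall>i\<in>?I. 0 \<le> c i) \<and> sum c ?I \<le> t} \<inter> space ?L"
  let ?T = "\<lambda>c. \<lambda>i\<in>?I. - a i + c i"
  have m: "{1..m} = insert m ?I" using assms by auto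
  have T: "?T \<in> measurable ?L ?L"
    unfolding col_space_def by (intro measurable_restrict) simp
  have S: "?S \<in> sets ?L"
  proof -
    have "?S = {c \<in> space ?L. (\<forall>i\<in>?I. 0 \<le> c i) \<and> sum c ?I \<le> t}" by auto
    then show ?thesis unfolding col_space_def by simp
  qed
  \<comment> \<open>The condition on row \<open>m\<close>, namely
    \<open>a m \<le> 1 - sum c\<close>, is the one that turns into the bound on the sum.\<close>
  have "{c \<in> space ?L. \<forall>l\<in>{1..m}. a l \<le> lift m c l} = ?T -` ?S \<inter> space ?L"
    unfolding m t_def
    by (auto simp: lift_def sum_subtractf algebra_simps col_space_def space_PiM)
  then have "emeasure ?L {c \<in> space ?L. \<forall>l\<in>{1..m}. a l \<le> lift m c l} = emeasure (distr ?L ?L ?T) ?S"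
    using emeasure_distr[OF T S] by simp
  also have "\<dots> = emeasure ?L ?S"
    unfolding col_space_def by (subst distr_PiM_lborel_translate) auto
  also have "\<dots> = ennreal ((max 0 t) ^ (m - 1) / fact (m - 1))"
  proof (cases "t \<ge> 0")
    case True
    then show ?thesis unfolding col_space_def by (subst emeasure_std_simplex_aux) auto
  next
    case False
    then have "?S = {}" using sum_nonneg[of ?I] by fastforce
    then show ?thesis using False assms by (simp add: max_def zero_power)
  qed
  finally show ?thesis unfolding t_def .
qed

lemma emeasure_col_simplex:
  assumes "m \<ge> 2"
  shows "emeasure (col_space m) (col_simplex m) = ennreal (1 / fact (m - 1))"
  using emeasure_lift_ge[OF assms, of "\<lambda>_. 0"] by (simp add: col_simplex_def)

lemma prob_space_col_dist:
  assumes "m \<ge> 2"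
  shows "prob_space (col_dist m)"
  unfolding col_dist_def
  by (rule prob_space_uniform_measure) (simp_all add: emeasure_col_simplex assms)

lemma sets_col_dist [simp, measurable_cong]: "sets (col_dist m) = sets (col_space m)"
  by (simp add: col_dist_def)

lemma space_col_dist [simp]: "space (col_dist m) = space (col_space m)"
  by (simp add: col_dist_def)

text \<open>The simplex has volume \<open>1 / fact (m - 1)\<close>, so conditioning on it rescales
  by that factor. Finiteness comes first: only then can the quotient in
  \<open>uniform_measure\<close> be inverted in the reals.\<close>

lemma emeasure_col_space_eq:
  assumes "m \<ge> 2" and "A \<in> sets (col_space m)" and "A \<subseteq> col_simplex m"
  shows "emeasure (col_space m) A = ennreal (measure (col_dist m) A / fact (m - 1))"
proof -
  interpret prob_space "col_dist m" by (rule prob_space_col_dist[OF assms(1)])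
  have "emeasure (col_space m) A \<le> ennreal (1 / fact (m - 1))"
    using emeasure_mono[OF assms(3) col_simplex_measurable] emeasure_col_simplex[OF assms(1)] by simp
  then obtain r where r: "emeasure (col_space m) A = ennreal r" "r \<ge> 0"
    by (cases "emeasure (col_space m) A") (auto simp: top_unique)
  have "ennreal (measure (col_dist m) A) = ennreal r / ennreal (1 / fact (m - 1))"
    unfolding emeasure_eq_measure[symmetric] unfolding col_dist_def using assms r
    by (simp add: emeasure_col_simplex Int_absorb1)
  then have "measure (col_dist m) A = r * fact (m - 1)"
    using r by (simp add: divide_ennreal)
  then show ?thesis using r by simp
qed

lemma prob_lift_ge:
  assumes "m \<ge> 2" and "\<And>l. l \<in> {1..m} \<Longrightarrow> 0 \<le> a l"
  shows "measure (col_dist m) {c \<in> space (col_space m). \<forall>l\<in>{1..m}. a l \<le> lift m c l}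
    = (max 0 (1 - (\<Sum>l\<in>{1..m}. a l))) ^ (m - 1)"
proof -
  let ?A = "{c \<in> space (col_space m). \<forall>l\<in>{1..m}. a l \<le> lift m c l}"
  have "?A \<subseteq> col_simplex m" using assms(2) by (force simp: col_simplex_def)
  then have "ennreal (measure (col_dist m) ?A / fact (m - 1)) =
      ennreal ((max 0 (1 - (\<Sum>l\<in>{1..m}. a l))) ^ (m - 1) / fact (m - 1))"
    using emeasure_col_space_eq[OF assms(1) lift_ge_set_measurable] emeasure_lift_ge[OF assms(1), of a]
    by simp
  then show ?thesis by (subst (asm) ennreal_inj) auto
qed

text \<open>Let \<open>N\<close> count the events that occur. It has mean \<open>s\<close> and
  second moment at most \<open>s^2 + s\<close>, so Cauchy-Schwarz gives probability at least
  \<open>s^2 / (s^2 + s)\<close> for \<open>N > 0\<close>. Testing with a quadratic in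
  \<open>N\<close> gives the same bound without dividing by \<open>s\<close>.\<close>

lemma (in prob_space) prob_UN_ge:
  assumes "finite I" and E: "\<And>i. i \<in> I \<Longrightarrow> E i \<in> events"
    and w: "\<And>i. i \<in> I \<Longrightarrow> prob (E i) = w i"
    and pair: "\<And>i j. i \<in> I \<Longrightarrow> j \<in> I \<Longrightarrow> i \<noteq> j \<Longrightarrow> prob (E i \<inter> E j) \<le> w i * w j"
  shows "(\<Sum>i\<in>I. w i) / (1 + (\<Sum>i\<in>I. w i)) \<le> prob (\<Union>i\<in>I. E i)"
proof -
  define s where "s = (\<Sum>i\<in>I. w i)"
  define N where "N = (\<lambda>x. \<Sum>i\<in>I. indicat_real (E i) x)"
  \<comment> \<open>\<open>2 a N - a\<^sup>2 N\<^sup>2 \<le> 1\<close> for every \<open>a\<close>, since \<open>(1 - a N)\<^sup>2 \<ge> 0\<close>; this \<open>a\<close> maximises the expectation.\<close>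
  define a where "a = 1 / (1 + s)"
  have w0: "0 \<le> w i" if "i \<in> I" for i using w[OF that] measure_nonneg[of M "E i"] by simp
  have s0: "0 \<le> s" unfolding s_def by (intro sum_nonneg w0)
  have N2: "N x ^ 2 = (\<Sum>i\<in>I. \<Sum>j\<in>I. indicat_real (E i \<inter> E j) x)" for x
    unfolding N_def power2_eq_square sum_product indicator_inter_arith by simp
  have ptw: "2 * a * N x - a\<^sup>2 * N x ^ 2 \<le> indicat_real (\<Union>i\<in>I. E i) x" for x
  proof (cases "x \<in> (\<Union>i\<in>I. E i)")
    case True
    have "0 \<le> (1 - a * N x)\<^sup>2" by simp
    then show ?thesis using True by (simp add: power2_eq_square algebra_simps)
  next
    case False
    then have "N x = 0" by (auto simp: N_def)
    then show ?thesis by simp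
  qed
  have int: "integrable M (indicat_real (E i))" "integrable M (indicat_real (E i \<inter> E j))"
    if "i \<in> I" "j \<in> I" for i j
    using E that by (auto intro!: integrable_real_indicator simp: less_top[symmetric])
  have intN: "integrable M N" "integrable M (\<lambda>x. N x ^ 2)"
    unfolding N2 unfolding N_def using int by (auto intro!: Bochner_Integration.integrable_sum)
  have EN: "expectation N = s"
    unfolding N_def s_def using E w int by (subst Bochner_Integration.integral_sum) auto
  have "expectation (\<lambda>x. N x ^ 2) = (\<Sum>i\<in>I. \<Sum>j\<in>I. prob (E i \<inter> E j))"
    unfolding N2 using E int
    by (subst Bochner_Integration.integral_sum | auto intro!: Bochner_Integration.integrable_sum sum.cong)+
  \<comment> \<open>The diagonal terms equal \<open>w i\<close>; the surplus
    \<open>w i * w i\<close> granted to them completes the double sum to \<open>s^2\<close>.\<close>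
  also have "\<dots> \<le> (\<Sum>i\<in>I. \<Sum>j\<in>I. w i * w j + (if i = j then w i else 0))"
  proof (intro sum_mono)
    fix i j assume ij: "i \<in> I" "j \<in> I"
    show "prob (E i \<inter> E j) \<le> w i * w j + (if i = j then w i else 0)"
      using pair[OF ij] w[OF ij(1)] w0[OF ij(1)] w0[OF ij(2)] by auto
  qed
  also have "\<dots> = s\<^sup>2 + s"
    using assms(1) by (simp add: sum.distrib s_def power2_eq_square sum_product)
  finally have EN2: "expectation (\<lambda>x. N x ^ 2) \<le> s\<^sup>2 + s" .
  have "s / (1 + s) = 2 * a * s - a\<^sup>2 * (s\<^sup>2 + s)"
  proof -
    have "a * (1 + s) = 1" using s0 by (simp add: a_def)
    then have "a\<^sup>2 * (s\<^sup>2 + s) = a * s" by (simp add: power2_eq_square) algebra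
    then show ?thesis by (simp add: a_def)
  qed
  also have "\<dots> \<le> 2 * a * s - a\<^sup>2 * expectation (\<lambda>x. N x ^ 2)"
    using EN2 by (simp add: mult_left_mono)
  also have "\<dots> = expectation (\<lambda>x. 2 * a * N x - a\<^sup>2 * N x ^ 2)"
    unfolding EN[symmetric] using intN by (subst Bochner_Integration.integral_diff) auto
  also have "\<dots> \<le> expectation (indicat_real (\<Union>i\<in>I. E i))"
    using intN E assms(1)
    by (intro integral_mono ptw) (auto simp: less_top[symmetric] intro!: sets.finite_UN)
  also have "\<dots> = prob (\<Union>i\<in>I. E i)"
    using E assms(1) sets.sets_into_space by (simp add: sets.finite_UN)
  finally show ?thesis unfolding s_def .
qed

section \<open>The distribution function \<open>F\<close> of a uniform point of the simplex\<close>

definition box_prob :: "nat \<Rightarrow> (nat \<Rightarrow> real) \<Rightarrow> real" where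
  "box_prob m u = measure (col_dist m) {c \<in> col_simplex m. \<forall>l\<in>{1..m}. lift m c l \<le> u l}"

lemma box_set_measurable [measurable]:
  "{c \<in> col_simplex m. \<forall>l\<in>{1..m}. lift m c l \<le> u l} \<in> sets (col_space m)"
  unfolding col_simplex_def by measurable

lemma exceed_set_measurable [measurable]:
  "l \<in> {1..m} \<Longrightarrow> {c \<in> col_simplex m. t < lift m c l} \<in> sets (col_space m)"
  unfolding col_simplex_def by measurable

lemma prob_col_simplex:
  assumes "m \<ge> 2"
  shows "measure (col_dist m) (col_simplex m) = 1"
  using prob_lift_ge[OF assms, of "\<lambda>_. 0"] by (simp add: col_simplex_def)

lemma prob_coord_ge:
  assumes "m \<ge> 2" "l \<in> {1..m}" "0 \<le> t"
  shows "measure (col_dist m) {c \<in> col_simplex m. t \<le> lift m c l} = (max 0 (1 - t)) ^ (m - 1)"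
proof -
  let ?a = "\<lambda>l'. if l' = l then t else 0"
  have "{c \<in> col_simplex m. t \<le> lift m c l} = {c \<in> space (col_space m). \<forall>l\<in>{1..m}. ?a l \<le> lift m c l}"
    using assms unfolding col_simplex_def by force
  then show ?thesis using prob_lift_ge[OF assms(1), of ?a] assms by (simp add: sum.delta)
qed

text \<open>The complement of a box is a union of strict exceedance events, so the strict version is
  wanted. Such an event lies between the closed ones at \<open>t + e\<close> and at
  \<open>t\<close>, whose probabilities agree as \<open>e\<close> decreases to 0.\<close>

lemma prob_coord_gt:
  assumes "m \<ge> 2" "l \<in> {1..m}" "0 \<le> t"
  shows "measure (col_dist m) {c \<in> col_simplex m. t < lift m c l} = (max 0 (1 - t)) ^ (m - 1)"
proof (rule antisym)
  interpret prob_space "col_dist m" by (rule prob_space_col_dist[OF assms(1)])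
  have meas: "{c \<in> col_simplex m. t \<le> lift m c l} \<in> sets (col_space m)" for t
    using assms unfolding col_simplex_def by measurable
  show "prob {c \<in> col_simplex m. t < lift m c l} \<le> (max 0 (1 - t)) ^ (m - 1)"
    unfolding prob_coord_ge[OF assms, symmetric]
    by (rule finite_measure_mono) (auto simp: meas)
  have lim: "((\<lambda>e. (max 0 (1 - (t + e))) ^ (m - 1)) \<longlongrightarrow> (max 0 (1 - (t + 0))) ^ (m - 1)) (at_right 0)"
    by (intro tendsto_intros)
  have "(max 0 (1 - (t + e))) ^ (m - 1) \<le> prob {c \<in> col_simplex m. t < lift m c l}" if "0 < e" for e
    using assms that unfolding prob_coord_ge[OF assms(1,2), of "t + e", symmetric, OF add_nonneg_nonneg[OF assms(3) less_imp_le[OF that]]]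
    by (intro finite_measure_mono) auto
  then have "\<forall>\<^sub>F e in at_right 0. (max 0 (1 - (t + e))) ^ (m - 1) \<le> prob {c \<in> col_simplex m. t < lift m c l}"
    by (auto simp: eventually_at_filter)
  from tendsto_upperbound[OF lim this] show "(max 0 (1 - t)) ^ (m - 1) \<le> prob {c \<in> col_simplex m. t < lift m c l}"
    by simp
qed

text \<open>Two thresholds leave a simplex of side \<open>1 - t - t'\<close>, and this is at most
  \<open>(1 - t) * (1 - t')\<close>: exceedances in different rows are negatively
  correlated.\<close>

lemma prob_coord_pair_le:
  assumes "m \<ge> 2" "l \<in> {1..m}" "l' \<in> {1..m}" "l \<noteq> l'" "t \<in> {0..1}" "t' \<in> {0..1}"
  shows "measure (col_dist m) ({c \<in> col_simplex m. t < lift m c l} \<inter> {c \<in> col_simplex m. t' < lift m c l'})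
    \<le> (1 - t) ^ (m - 1) * (1 - t') ^ (m - 1)"
proof -
  interpret prob_space "col_dist m" by (rule prob_space_col_dist[OF assms(1)])
  let ?a = "\<lambda>i. (if i = l then t else 0) + (if i = l' then t' else 0)"
  have "prob ({c \<in> col_simplex m. t < lift m c l} \<inter> {c \<in> col_simplex m. t' < lift m c l'})
    \<le> prob {c \<in> space (col_space m). \<forall>l\<in>{1..m}. ?a l \<le> lift m c l}"
    using assms lift_ge_set_measurable[of m ?a]
    by (intro finite_measure_mono) (auto simp: col_simplex_def)
  also have "\<dots> = (max 0 (1 - (t + t'))) ^ (m - 1)"
    using prob_lift_ge[OF assms(1), of ?a] assms by (simp add: sum.distrib sum.delta)
  also have "\<dots> \<le> ((1 - t) * (1 - t')) ^ (m - 1)"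
  proof (rule power_mono)
    have "0 \<le> (1 - t) * (1 - t')" "0 \<le> t * t'" using assms by auto
    then show "max 0 (1 - (t + t')) \<le> (1 - t) * (1 - t')" by (simp add: algebra_simps)
  qed simp
  finally show ?thesis by (simp add: power_mult_distrib)
qed

text \<open>Outside the box some coordinate exceeds its bound. The union bound over these
  \<open>m\<close> events gives the first estimate, \<open>prob_UN_ge\<close> the second.\<close>

lemma box_prob_bounds:
  assumes m: "m \<ge> 2" and u: "\<And>l. l \<in> {1..m} \<Longrightarrow> u l \<in> {0..1}"
  defines "s \<equiv> \<Sum>l\<in>{1..m}. (1 - u l) ^ (m - 1)"
  shows "1 - s \<le> box_prob m u" and "box_prob m u \<le> 1 / (1 + s)"
proof -
  interpret prob_space "col_dist m" by (rule prob_space_col_dist[OF m])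
  define E where "E l = {c \<in> col_simplex m. u l < lift m c l}" for l
  have E: "E l \<in> events" if "l \<in> {1..m}" for l using exceed_set_measurable[OF that] by (simp add: E_def)
  have PE: "prob (E l) = (1 - u l) ^ (m - 1)" if "l \<in> {1..m}" for l
    using prob_coord_gt[OF m that, of "u l"] u[OF that] by (simp add: E_def)
  have s0: "0 \<le> s" unfolding s_def using u by (intro sum_nonneg) auto
  have "{c \<in> col_simplex m. \<forall>l\<in>{1..m}. lift m c l \<le> u l} = col_simplex m - (\<Union>l\<in>{1..m}. E l)"
    by (auto simp: E_def not_less)
  then have F: "box_prob m u = 1 - prob (\<Union>l\<in>{1..m}. E l)"
    unfolding box_prob_def using E
    by (subst finite_measure_Diff[symmetric, of "col_simplex m", unfolded prob_col_simplex[OF m]])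
       (auto simp: E_def intro!: sets.finite_UN)
  have "prob (\<Union>l\<in>{1..m}. E l) \<le> s"
    unfolding s_def using E PE by (intro order_trans[OF finite_measure_subadditive_finite]) auto
  then show "1 - s \<le> box_prob m u" using F by simp
  have "s / (1 + s) \<le> prob (\<Union>l\<in>{1..m}. E l)"
    unfolding s_def
    by (rule prob_UN_ge) (use E PE prob_coord_pair_le[OF m] u in \<open>auto simp: E_def\<close>)
  then have "box_prob m u \<le> 1 - s / (1 + s)" using F by simp
  also have "\<dots> = 1 / (1 + s)" using s0 by (simp add: field_simps)
  finally show "box_prob m u \<le> 1 / (1 + s)" .
qed

section \<open>One-dimensional kernel integrals\<close>

text \<open>The Beta integral of \<open>(1 - v ^ k) ^ N\<close> over the unit interval, in the
  product form that its recursion in \<open>N\<close> yields and whose logarithm is close to a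
  harmonic sum.\<close>

definition kernel_int :: "nat \<Rightarrow> nat \<Rightarrow> real" where
  "kernel_int k N = (\<Prod>j=1..N. real (k * j) / real (k * j + 1))"

lemma kernel_int_pos: "k > 0 \<Longrightarrow> 0 < kernel_int k N"
  unfolding kernel_int_def by (intro prod_pos) (auto intro!: divide_pos_pos add_pos_nonneg)

lemma kernel_int_has_integral:
  assumes "k > 0"
  shows "((\<lambda>u. (1 - (1 - u) ^ k) ^ N) has_integral kernel_int k N) {0..1::real}"
proof (induction N)
  case 0
  then show ?case using has_integral_const_real[of "1::real" 0 1] by (simp add: kernel_int_def)
next
  case (Suc N)
  let ?f = "\<lambda>N u::real. (1 - (1 - u) ^ k) ^ N"
  \<comment> \<open>\<open>G\<close> vanishes at both ends, and its derivative is a combination of \<open>?f (Suc N)\<close> and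
    \<open>?f N\<close>: this is the recursion \<open>(1 + k (N + 1)) I\<^sub>N\<^sub>+\<^sub>1 = k (N + 1) I\<^sub>N\<close>.\<close>
  define G where "G = (\<lambda>u::real. - (1 - u) * ?f (Suc N) u)"
  have "(G has_real_derivative (1 + real (k * Suc N)) * ?f (Suc N) u - real (k * Suc N) * ?f N u) (at u)" for u
  proof -
    obtain k' where k: "k = Suc k'" using assms by (cases k) auto
    show ?thesis unfolding G_def k
      by (rule derivative_eq_intros refl)+ (simp add: algebra_simps)
  qed
  then have "(G has_vector_derivative (1 + real (k * Suc N)) * ?f (Suc N) u - real (k * Suc N) * ?f N u) (at u within {0..1})" for u
    using has_field_derivative_at_within has_real_derivative_iff_has_vector_derivative by blast
  then have 1: "((\<lambda>u. (1 + real (k * Suc N)) * ?f (Suc N) u - real (k * Suc N) * ?f N u) has_integral (G 1 - G 0)) {0..1}"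
    by (intro fundamental_theorem_of_calculus) auto
  have "((\<lambda>u. ((1 + real (k * Suc N)) * ?f (Suc N) u - real (k * Suc N) * ?f N u)
       + real (k * Suc N) * ?f N u) has_integral (G 1 - G 0) + real (k * Suc N) * kernel_int k N) {0..1}"
    by (intro has_integral_add 1 has_integral_mult_right Suc)
  then have "((\<lambda>u. (1 + real (k * Suc N)) * ?f (Suc N) u) has_integral real (k * Suc N) * kernel_int k N) {0..1}"
    by (simp add: G_def)
  from has_integral_mult_right[OF this, of "1 / (1 + real (k * Suc N))"]
  have "(?f (Suc N) has_integral (real (k * Suc N) / (1 + real (k * Suc N))) * kernel_int k N) {0..1}"
    by (simp add: add_nonneg_eq_0_iff del: power_Suc of_nat_Suc of_nat_mult)
  moreover have "(real (k * Suc N) / (1 + real (k * Suc N))) * kernel_int k N = kernel_int k (Suc N)"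
    unfolding kernel_int_def by (simp add: algebra_simps)
  ultimately show ?case by simp
qed

text \<open>With \<open>x = 1 / (k * j)\<close> the factors are \<open>exp (- ln (1 + x))\<close>,
  and \<open>x - x^2 \<le> ln (1 + x) \<le> x\<close>. The \<open>x\<close> add up to
  \<open>harm N / k\<close>, their squares to at most \<open>2 / k^2\<close>.\<close>

lemma kernel_int_bounds:
  assumes "k > 0"
  shows "exp (- harm N / real k) \<le> kernel_int k N"
    and "kernel_int k N \<le> exp (- harm N / real k + 2 / (real k)\<^sup>2)"
proof -
  have pos: "1 + 1 / (real k * real j) > 0" for j by (intro add_pos_nonneg) auto
  have fac: "real (k * j) / real (k * j + 1) = exp (- ln (1 + 1 / (real k * real j)))" if "j \<in> {1..N}" for j
    using that assms pos[of j] by (subst exp_minus, subst exp_ln) (auto simp: field_simps)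
  have K: "kernel_int k N = exp (- (\<Sum>j=1..N. ln (1 + 1 / (real k * real j))))"
    unfolding kernel_int_def by (simp only: sum_negf[symmetric] exp_sum finite_atLeastAtMost) (rule prod.cong[OF refl fac])
  have harm: "harm N / real k = (\<Sum>j=1..N. 1 / (real k * real j))"
    by (simp add: harm_def sum_divide_distrib inverse_eq_divide mult.commute)
  have "(\<Sum>j=1..N. ln (1 + 1 / (real k * real j))) \<le> harm N / real k"
    unfolding harm using pos by (intro sum_mono ln_add_one_self_le_self) auto
  then show "exp (- harm N / real k) \<le> kernel_int k N" unfolding K by simp
  \<comment> \<open>Telescoping with \<open>1 / (N + 1)^2 \<le> 1 / N - 1 / (N + 1)\<close>; the
    term \<open>- 1 / N\<close> makes the induction close, and only the bound 2 is used
    afterwards.\<close>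
  have sq: "(\<Sum>j=1..N. 1 / real j ^ 2) \<le> 2 - 1 / real N" if "N \<ge> 1" for N
    using that
  proof (induction N rule: nat_induct_at_least)
    case (Suc N)
    have "1 / (real N + 1)\<^sup>2 \<le> 1 / (real N * (real N + 1))"
      using Suc.hyps by (intro divide_left_mono) (auto simp: power2_eq_square intro!: mult_right_mono)
    also have "\<dots> = 1 / real N - 1 / (real N + 1)"
      using Suc.hyps by (simp add: field_simps)
    finally show ?case using Suc.IH by (simp add: add.commute)
  qed simp
  have sq2: "(\<Sum>j=1..N. 1 / real j ^ 2) \<le> 2"
    using sq[of N] by (cases "N \<ge> 1") (auto intro: order_trans)
  have "harm N / real k - 2 / (real k)\<^sup>2 \<le> (\<Sum>j=1..N. 1 / (real k * real j) - (1 / (real k * real j))\<^sup>2)"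
  proof -
    have "(\<Sum>j=1..N. (1 / (real k * real j))\<^sup>2) = (\<Sum>j=1..N. 1 / real j ^ 2) / (real k)\<^sup>2"
      by (simp add: sum_divide_distrib power2_eq_square mult_ac)
    also have "\<dots> \<le> 2 / (real k)\<^sup>2" by (intro divide_right_mono sq2) auto
    finally show ?thesis by (simp add: sum_subtractf harm)
  qed
  also have "\<dots> \<le> (\<Sum>j=1..N. ln (1 + 1 / (real k * real j)))"
  proof (rule sum_mono)
    fix j assume "j \<in> {1..N}"
    then have "real k * real j \<ge> 1" using assms by (metis atLeastAtMost_iff less_one mult_mono' not_less of_nat_0_le_iff of_nat_1 of_nat_le_iff mult_1)
    then show "1 / (real k * real j) - (1 / (real k * real j))\<^sup>2 \<le> ln (1 + 1 / (real k * real j))"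
      by (intro ln_one_plus_pos_lower_bound) (auto simp: divide_simps)
  qed
  finally show "kernel_int k N \<le> exp (- harm N / real k + 2 / (real k)\<^sup>2)" unfolding K by simp
qed

lemma kernel_int_le_1:
  assumes "k > 0"
  shows "kernel_int k N \<le> 1"
  unfolding kernel_int_def using assms by (intro prod_le_1) (auto simp: divide_le_eq_1 add_pos_nonneg)

text \<open>The \<open>k\<close>-th power of the upper bound is
  \<open>exp (- harm N + 2 / k)\<close>, and \<open>harm N\<close> is at least \<open>ln N\<close>.
  So at distance \<open>kernel_int k N\<close> from 1 the quantity \<open>(1 - u) ^ k\<close> is of
  order at most \<open>1 / N\<close>, which locates where the kernel starts to fall.\<close>

lemma kernel_int_power_le:
  assumes "k > 0"
  shows "real N * kernel_int k N ^ k \<le> exp 2"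
proof (cases "N = 0")
  case False
  have "kernel_int k N ^ k \<le> exp (- harm N / real k + 2 / (real k)\<^sup>2) ^ k"
    using kernel_int_bounds(2)[OF assms] kernel_int_pos[OF assms] by (intro power_mono) (auto intro: less_imp_le)
  also have "\<dots> = exp (- harm N + 2 / real k)"
    using assms by (simp add: exp_of_nat_mult[symmetric] algebra_simps power2_eq_square)
  also have "\<dots> \<le> exp (2 - ln (real N))"
  proof -
    have "ln (real N) \<le> ln (real N + 1)" using False by simp
    then have "ln (real N) \<le> harm N" using ln_le_harm[of N] by simp
    moreover have "2 / real k \<le> 2" using assms by (simp add: divide_simps)
    ultimately show ?thesis by simp
  qed
  also have "\<dots> = exp 2 / real N" using False by (simp add: exp_diff)
  finally show ?thesis using False by (simp add: field_simps)
qed simp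

section \<open>Kernel mass on parts of the unit interval\<close>

definition kernel_meas :: "nat \<Rightarrow> nat \<Rightarrow> real set \<Rightarrow> real" where
  "kernel_meas k N B = (LINT u:{0..1} \<inter> B|lborel. (1 - (1 - u) ^ k) ^ N)"

lemma kernel_set_integrable:
  assumes "B \<in> sets borel"
  shows "set_integrable lborel ({0..1} \<inter> B) (\<lambda>u::real. (1 - (1 - u) ^ k) ^ N)"
proof -
  have "set_integrable lborel {0..1} (\<lambda>u::real. (1 - (1 - u) ^ k) ^ N)"
    by (intro borel_integrable_atLeastAtMost') (auto intro!: continuous_intros)
  then show ?thesis by (rule set_integrable_subset) (use assms in auto)
qed

lemma kernel_nonneg: "u \<in> {0..1} \<Longrightarrow> 0 \<le> (1 - (1 - u) ^ k) ^ N" for u :: real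
  by (simp add: power_le_one)

lemma kernel_le_1: "u \<in> {0..1} \<Longrightarrow> (1 - (1 - u) ^ k) ^ N \<le> 1" for u :: real
  by (simp add: power_le_one)

lemma nn_integral_kernel:
  assumes "B \<in> sets borel"
  shows "(\<integral>\<^sup>+u. indicator ({0..1} \<inter> B) u * ennreal ((1 - (1 - u) ^ k) ^ N) \<partial>lborel) = ennreal (kernel_meas k N B)"
proof -
  have "(\<integral>\<^sup>+u. indicator ({0..1} \<inter> B) u * ennreal ((1 - (1 - u) ^ k) ^ N) \<partial>lborel)
      = (\<integral>\<^sup>+u. ennreal (indicat_real ({0..1} \<inter> B) u *\<^sub>R (1 - (1 - u) ^ k) ^ N) \<partial>lborel)"
    by (intro nn_integral_cong) (simp add: indicator_def)
  also have "\<dots> = ennreal (kernel_meas k N B)"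
    unfolding kernel_meas_def set_lebesgue_integral_def
    using kernel_nonneg kernel_set_integrable[OF assms]
    by (intro nn_integral_eq_integral) (auto simp: set_integrable_def indicator_def)
  finally show ?thesis .
qed

lemma kernel_meas_UNIV:
  assumes "k > 0"
  shows "kernel_meas k N UNIV = kernel_int k N"
  unfolding kernel_meas_def using kernel_set_integrable[of UNIV k N] kernel_int_has_integral[OF assms, of N]
  by (simp add: set_borel_integral_eq_integral integral_unique)

lemma kernel_meas_split:
  "kernel_meas k N UNIV = kernel_meas k N {..t} + kernel_meas k N {t<..}"
proof -
  have "kernel_meas k N ({..t} \<union> {t<..}) = kernel_meas k N {..t} + kernel_meas k N {t<..}"
    unfolding kernel_meas_def Int_Un_distrib
    by (intro set_integral_Un kernel_set_integrable) auto
  moreover have "{..t} \<union> {t<..} = UNIV" by auto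
  ultimately show ?thesis by simp
qed

lemma kernel_meas_nonneg: "0 \<le> kernel_meas k N B"
  unfolding kernel_meas_def set_lebesgue_integral_def
  by (intro integral_nonneg_AE) (auto simp: indicator_def power_le_one)

lemma kernel_meas_greater_le: "kernel_meas k N {t<..} \<le> max 0 (1 - t)"
proof -
  have "kernel_meas k N {t<..} \<le> (LINT u:{0..1} \<inter> {t<..}|lborel. 1)"
    unfolding kernel_meas_def
    using kernel_set_integrable[of "{t<..}" k 0]
    by (intro set_integral_mono kernel_set_integrable kernel_le_1) auto
  also have "\<dots> = measure lborel ({0..1} \<inter> {t<..})" by (simp add: set_lebesgue_integral_def)
  also have "\<dots> \<le> measure lborel {1 - max 0 (1 - t)..1}"
    by (intro measure_mono_fmeasurable) (auto simp: fmeasurable_def)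
  finally show ?thesis by simp
qed

text \<open>On \<open>{1 - c<..1}\<close>, which lies inside \<open>{t<..}\<close>, Bernoulli's
  inequality bounds the kernel below by \<open>1 - N * c ^ k\<close>. For \<open>t \<ge> 1\<close>
  the assumptions force \<open>c = 0\<close> and the interval is empty.\<close>

lemma kernel_meas_greater_ge:
  assumes "0 \<le> c" "c \<le> 1" "c \<le> max 0 (1 - t)"
  shows "c * (1 - real N * c ^ k) \<le> kernel_meas k N {t<..}"
proof -
  have "c * (1 - real N * c ^ k) = (LINT u:{1 - c<..1}|lborel. 1 - real N * c ^ k)"
    using assms by (simp add: set_lebesgue_integral_def)
  also have "\<dots> \<le> (LINT u:{1 - c<..1}|lborel. (1 - (1 - u) ^ k) ^ N)"
  proof (rule set_integral_mono)
    show "set_integrable lborel {1 - c<..1} (\<lambda>u. 1 - real N * c ^ k)"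
      using assms by (auto simp: set_integrable_def intro!: integrable_mult_left integrable_real_indicator)
    show "set_integrable lborel {1 - c<..1} (\<lambda>u::real. (1 - (1 - u) ^ k) ^ N)"
      using kernel_set_integrable[of "{1 - c<..1}" k N] assms by (simp add: Int_absorb1 subset_eq)
    fix u assume u: "u \<in> {1 - c<..1}"
    have "1 - real N * c ^ k \<le> 1 - real N * (1 - u) ^ k"
      using u by (intro diff_left_mono mult_left_mono power_mono) auto
    also have "\<dots> \<le> (1 - (1 - u) ^ k) ^ N"
      using Bernoulli_inequality[of "- ((1 - u) ^ k)" N] u assms by (simp add: power_le_one)
    finally show "1 - real N * c ^ k \<le> (1 - (1 - u) ^ k) ^ N" .
  qed
  also have "\<dots> \<le> kernel_meas k N {t<..}"
    unfolding kernel_meas_def set_lebesgue_integral_def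
  proof (rule integral_mono)
    show "integrable lborel (\<lambda>u. indicat_real {1 - c<..1} u *\<^sub>R (1 - (1 - u) ^ k) ^ N)"
      using kernel_set_integrable[of "{1 - c<..1}" k N] assms by (simp add: Int_absorb1 subset_eq set_integrable_def)
    show "integrable lborel (\<lambda>u. indicat_real ({0..1} \<inter> {t<..}) u *\<^sub>R (1 - (1 - u) ^ k) ^ N)"
      using kernel_set_integrable[of "{t<..}" k N] by (simp add: set_integrable_def)
    show "indicat_real {1 - c<..1} u *\<^sub>R (1 - (1 - u) ^ k) ^ N \<le> indicat_real ({0..1} \<inter> {t<..}) u *\<^sub>R (1 - (1 - u) ^ k) ^ N" for u
      using assms kernel_nonneg[of u k N] by (auto simp: indicator_def)
  qed
  finally show ?thesis .
qed

section \<open>Volumes as iterated integrals\<close>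

abbreviation x_space :: "nat \<Rightarrow> nat \<Rightarrow> (nat \<times> nat \<Rightarrow> real) measure" where
  "x_space m n \<equiv> Pi\<^sub>M ({1..<m} \<times> {1..n}) (\<lambda>_. lborel)"

abbreviation y_space :: "nat \<Rightarrow> (nat \<Rightarrow> real) measure" where
  "y_space m \<equiv> Pi\<^sub>M {1..m} (\<lambda>_. lborel)"

section \<open>Splitting \<open>x\<close> into its columns\<close>

definition col :: "nat \<Rightarrow> (nat \<times> nat \<Rightarrow> real) \<Rightarrow> nat \<Rightarrow> nat \<Rightarrow> real" where
  "col m x j = (\<lambda>i\<in>{1..<m}. x (i, j))"

lemma measurable_col [measurable]:
  "j \<in> {1..n} \<Longrightarrow> (\<lambda>x. col m x j) \<in> measurable (x_space m n) (col_space m)"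
  unfolding col_def col_space_def by (intro measurable_restrict) auto

lemma col_in_space: "col m x j \<in> space (col_space m)"
  by (simp add: col_def col_space_def space_PiM)

lemma lift_col_proj:
  assumes "m \<ge> 1" "(x, y) \<in> demand m n" "l \<in> {1..m}" "j \<in> {1..n}"
  shows "lift m (col m (fst (proj m n (x, y))) j) l = x (l, j)"
proof -
  have "{1..m} = insert m {1..<m}" using assms by auto
  then have "x (m, j) = 1 - (\<Sum>i\<in>{1..<m}. x (i, j))"
    using assms unfolding demand_def by (auto simp: eq_diff_eq)
  then show ?thesis using assms by (auto simp: lift_def col_def proj_def)
qed

text \<open>\<open>P\<close> describes \<open>K\<close> in the kept coordinates, and
  \<open>proj\<close> is a bijection from \<open>demand\<close> onto them. Since the described set
  is product measurable, the completion in \<open>coord_lebesgue\<close> assigns it the plain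
  product measure.\<close>

lemma emeasure_vol:
  assumes "m \<ge> 1"
    and "\<And>x y. (x, y) \<in> demand m n \<Longrightarrow> (x, y) \<in> K \<longleftrightarrow> P (proj m n (x, y))"
    and meas: "{p \<in> space (x_space m n \<Otimes>\<^sub>M y_space m). P p} \<in> sets (x_space m n \<Otimes>\<^sub>M y_space m)"
  shows "K \<inter> demand m n \<in> sets (vol_measure m n)"
    and "emeasure (vol_measure m n) (K \<inter> demand m n)
      = emeasure (x_space m n \<Otimes>\<^sub>M y_space m) {p \<in> space (x_space m n \<Otimes>\<^sub>M y_space m). P p}"
proof -
  let ?A = "{p \<in> space (x_space m n \<Otimes>\<^sub>M y_space m). P p}"
  have im: "proj m n ` demand m n = space (x_space m n \<Otimes>\<^sub>M y_space m)"
    using bij_betw_proj[OF assms(1), of n]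
    by (simp add: bij_betw_def space_coord_lebesgue space_pair_measure space_PiM)
  have K: "proj m n ` (K \<inter> demand m n) = ?A"
    using assms(2) unfolding im[symmetric] by auto
  have A: "?A \<in> sets (coord_lebesgue m n)"
    unfolding coord_lebesgue_def by (intro sets_completionI_sets meas)
  show S: "K \<inter> demand m n \<in> sets (vol_measure m n)"
    using A by (simp add: sets_vol_measure[OF assms(1)] K)
  show "emeasure (vol_measure m n) (K \<inter> demand m n) = emeasure (x_space m n \<Otimes>\<^sub>M y_space m) ?A"
    unfolding emeasure_vol_measure[OF assms(1) S] K
    unfolding coord_lebesgue_def using meas by simp
qed

lemma measurable_columns:
  "(\<lambda>z. \<lambda>(i, j)\<in>{1..<m} \<times> {1..n}. z j i) \<in> measurable (Pi\<^sub>M {1..n} (\<lambda>_. col_space m)) (x_space m n)"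
  unfolding case_prod_beta'
proof (rule measurable_restrict)
  fix p assume p: "p \<in> {1..<m} \<times> {1..n}"
  have 1: "(\<lambda>z. z (snd p)) \<in> measurable (Pi\<^sub>M {1..n} (\<lambda>_. col_space m)) (col_space m)"
    using p by (intro measurable_component_singleton) auto
  have 2: "(\<lambda>c. c (fst p)) \<in> measurable (col_space m) lborel"
    unfolding col_space_def using p by (intro measurable_component_singleton) auto
  show "(\<lambda>z. z (snd p) (fst p)) \<in> measurable (Pi\<^sub>M {1..n} (\<lambda>_. col_space m)) lborel"
    by (rule measurable_compose[OF 1 2])
qed

text \<open>Both sides agree on boxes: a product over columns of products over rows is the product
  over all index pairs.\<close>

lemma distr_columns:
  "distr (Pi\<^sub>M {1..n} (\<lambda>_. col_space m)) (x_space m n) (\<lambda>z. \<lambda>(i, j)\<in>{1..<m} \<times> {1..n}. z j i) = x_space m n"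
proof (rule lborel_product.PiM_eqI)
  let ?Z = "Pi\<^sub>M {1..n} (\<lambda>_. col_space m)" and ?f = "\<lambda>z. \<lambda>(i, j)\<in>{1..<m} \<times> {1..n}. z j i"
  interpret Z: product_sigma_finite "\<lambda>_::nat. col_space m"
    using sigma_finite_col_space by (simp add: product_sigma_finite_def)
  note f = measurable_columns
  fix A :: "nat \<times> nat \<Rightarrow> real set"
  assume A: "\<And>i. i \<in> {1..<m} \<times> {1..n} \<Longrightarrow> A i \<in> sets lborel"
  have col: "Pi\<^sub>E {1..<m} (\<lambda>i. A (i, j)) \<in> sets (col_space m)" if "j \<in> {1..n}" for j
    unfolding col_space_def using A that by (intro sets_PiM_I_finite) auto
  have eq: "?f -` Pi\<^sub>E ({1..<m} \<times> {1..n}) A \<inter> space ?Z = Pi\<^sub>E {1..n} (\<lambda>j. Pi\<^sub>E {1..<m} (\<lambda>i. A (i, j)))"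
  proof -
    have "space (col_space m) = Pi\<^sub>E {1..<m} (\<lambda>_. UNIV)" by (simp add: col_space_def space_PiM)
    then have "z \<in> ?f -` Pi\<^sub>E ({1..<m} \<times> {1..n}) A \<inter> space ?Z \<longleftrightarrow>
        z \<in> extensional {1..n} \<and> (\<forall>j\<in>{1..n}. z j \<in> extensional {1..<m} \<and> (\<forall>i\<in>{1..<m}. z j i \<in> A (i, j)))" for z
      by (simp add: space_PiM PiE_iff) blast
    then show ?thesis by (intro set_eqI) (simp only: PiE_iff, blast)
  qed
  have "emeasure (distr ?Z (x_space m n) ?f) (Pi\<^sub>E ({1..<m} \<times> {1..n}) A)
      = emeasure ?Z (Pi\<^sub>E {1..n} (\<lambda>j. Pi\<^sub>E {1..<m} (\<lambda>i. A (i, j))))"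
  proof -
    have "Pi\<^sub>E ({1..<m} \<times> {1..n}) A \<in> sets (x_space m n)"
      by (intro sets_PiM_I_finite) (use A in auto)
    from emeasure_distr[OF f this] show ?thesis by (simp only: eq)
  qed
  also have "\<dots> = (\<Prod>j\<in>{1..n}. \<Prod>i\<in>{1..<m}. emeasure lborel (A (i, j)))"
    using A col
    by (subst Z.emeasure_PiM) (auto simp: col_space_def intro!: prod.cong lborel_product.emeasure_PiM)
  also have "\<dots> = (\<Prod>p\<in>{1..<m} \<times> {1..n}. emeasure lborel (A p))"
    by (subst prod.swap) (simp add: prod.cartesian_product)
  finally show "emeasure (distr ?Z (x_space m n) ?f) (Pi\<^sub>E ({1..<m} \<times> {1..n}) A)
      = (\<Prod>p\<in>{1..<m} \<times> {1..n}. emeasure lborel (A p))" .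
qed auto

lemma columns_set_measurable:
  assumes "\<And>j. j \<in> {1..n} \<Longrightarrow> S j \<in> sets (col_space m)"
  shows "{x \<in> space (x_space m n). \<forall>j\<in>{1..n}. col m x j \<in> S j} \<in> sets (x_space m n)"
proof -
  have "{x \<in> space (x_space m n). col m x j \<in> S j} \<in> sets (x_space m n)" if "j \<in> {1..n}" for j
    using measurable_sets[OF measurable_col[OF that] assms[OF that]]
    by (simp add: vimage_def Int_def conj_commute)
  then show ?thesis by (intro sets.sets_Collect_finite_All) auto
qed

text \<open>Reading \<open>x\<close> as the tuple of its columns turns the event into a box
  \<open>Pi\<^sub>E {1..n} S\<close>. This is the independence of the columns under Lebesgue
  measure.\<close>

lemma emeasure_columns:
  assumes S: "\<And>j. j \<in> {1..n} \<Longrightarrow> S j \<in> sets (col_space m)"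
  shows "emeasure (x_space m n) {x \<in> space (x_space m n). \<forall>j\<in>{1..n}. col m x j \<in> S j}
    = (\<Prod>j\<in>{1..n}. emeasure (col_space m) (S j))"
proof -
  let ?Z = "Pi\<^sub>M {1..n} (\<lambda>_. col_space m)" and ?f = "\<lambda>z. \<lambda>(i, j)\<in>{1..<m} \<times> {1..n}. z j i"
  let ?A = "{x \<in> space (x_space m n). \<forall>j\<in>{1..n}. col m x j \<in> S j}"
  interpret Z: product_sigma_finite "\<lambda>_::nat. col_space m"
    using sigma_finite_col_space by (simp add: product_sigma_finite_def)
  note f = measurable_columns
  have col: "col m (?f z) j = z j" if "z \<in> space ?Z" "j \<in> {1..n}" for z j
  proof -
    have "z j \<in> extensional {1..<m}"
      using that by (auto simp: space_PiM col_space_def PiE_iff)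
    then show ?thesis using that by (auto simp: col_def fun_eq_iff extensional_def)
  qed
  have "?f -` ?A \<inter> space ?Z = {z \<in> space ?Z. \<forall>j\<in>{1..n}. col m (?f z) j \<in> S j}"
    using measurable_space[OF f] by auto
  also have "\<dots> = {z \<in> space ?Z. \<forall>j\<in>{1..n}. z j \<in> S j}"
    using col by (intro Collect_cong conj_cong ball_cong refl) simp
  also have "\<dots> = Pi\<^sub>E {1..n} S"
  proof -
    have "c \<in> space (col_space m)" if "j \<in> {1..n}" "c \<in> S j" for j c
      using sets.sets_into_space[OF S[OF that(1)]] that(2) by blast
    then show ?thesis
      by (intro set_eqI) (simp only: space_PiM PiE_iff mem_Collect_eq, blast)
  qed
  finally have eq: "?f -` ?A \<inter> space ?Z = Pi\<^sub>E {1..n} S" .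
  have "emeasure (x_space m n) ?A = emeasure (distr ?Z (x_space m n) ?f) ?A"
    by (simp only: distr_columns)
  also have "\<dots> = emeasure ?Z (Pi\<^sub>E {1..n} S)"
    by (simp only: emeasure_distr[OF f columns_set_measurable[of n S m, OF S]] eq)
  also have "\<dots> = (\<Prod>j\<in>{1..n}. emeasure (col_space m) (S j))"
    using S by (subst Z.emeasure_PiM) auto
  finally show ?thesis .
qed

section \<open>Volumes of slabs by Fubini\<close>

lemma pair_sigma_finite_xy: "pair_sigma_finite (x_space m n) (y_space m)"
  by (intro pair_sigma_finite.intro lborel_product.sigma_finite) auto

text \<open>With \<open>B = UNIV\<close> the slab is the whole body; \<open>{..t}\<close> and
  \<open>{t<..}\<close> give the distribution function and the tail of \<open>y i\<close>.\<close>

definition strong_slab :: "nat \<Rightarrow> nat \<Rightarrow> nat \<Rightarrow> real set \<Rightarrow> point set" where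
  "strong_slab m n i B = strong_relaxation m n \<inter> demand m n \<inter> {(x, y). y i \<in> B}"

definition weak_slab :: "nat \<Rightarrow> nat \<Rightarrow> nat \<Rightarrow> real set \<Rightarrow> point set" where
  "weak_slab m n i B = weak_relaxation m n \<inter> demand m n \<inter> {(x, y). y i \<in> B}"

definition col_box :: "nat \<Rightarrow> (nat \<Rightarrow> real) \<Rightarrow> (nat \<Rightarrow> real) set" where
  "col_box m y = {c \<in> col_simplex m. \<forall>l\<in>{1..m}. lift m c l \<le> y l}"

lemma measurable_y [measurable]:
  "i \<in> {1..m} \<Longrightarrow> (\<lambda>y. y i) \<in> borel_measurable (y_space m)"
  by simp

lemma measurable_lift_col [measurable]:
  "\<lbrakk>l \<in> {1..m}; j \<in> {1..n}\<rbrakk> \<Longrightarrow> (\<lambda>x. lift m (col m x j) l) \<in> borel_measurable (x_space m n)"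
  using measurable_compose[OF measurable_col measurable_lift] .

lemma measurable_snd_y:
  "l \<in> {1..m} \<Longrightarrow> (\<lambda>p. snd p l) \<in> borel_measurable (x_space m n \<Otimes>\<^sub>M y_space m)"
  by (rule measurable_compose[OF measurable_snd measurable_y])

lemma measurable_fst_lift_col:
  "\<lbrakk>l \<in> {1..m}; j \<in> {1..n}\<rbrakk>
    \<Longrightarrow> (\<lambda>p. lift m (col m (fst p) j) l) \<in> borel_measurable (x_space m n \<Otimes>\<^sub>M y_space m)"
  by (rule measurable_compose[OF measurable_fst measurable_lift_col])

text \<open>Here \<open>y\<close> is integrated last: for fixed \<open>y\<close> in the cube the
  \<open>n\<close> columns range independently over \<open>col_box m y\<close>, each contributing
  the volume \<open>box_prob m y / fact (m - 1)\<close>.\<close>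

lemma strong_slab_measure:
  assumes m: "m \<ge> 2" and n: "n \<ge> 1" and i: "i \<in> {1..m}" and B: "B \<in> sets borel"
  shows "strong_slab m n i B \<in> sets (vol_measure m n)"
    and "emeasure (vol_measure m n) (strong_slab m n i B)
      = (\<integral>\<^sup>+y. indicator {y \<in> space (y_space m). (\<forall>l\<in>{1..m}. y l \<in> {0..1}) \<and> y i \<in> B} y
          * ennreal (box_prob m y / fact (m - 1)) ^ n \<partial>y_space m)"
proof -
  let ?XY = "x_space m n \<Otimes>\<^sub>M y_space m"
  let ?P = "\<lambda>p. (\<forall>j\<in>{1..n}. \<forall>l\<in>{1..m}. 0 \<le> lift m (col m (fst p) j) l \<and> lift m (col m (fst p) j) l \<le> snd p l)
     \<and> (\<forall>l\<in>{1..m}. snd p l \<le> 1) \<and> snd p i \<in> B"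
  interpret pair_sigma_finite "x_space m n" "y_space m" by (rule pair_sigma_finite_xy)
  have iff: "(x, y) \<in> strong_relaxation m n \<inter> {(x, y). y i \<in> B} \<longleftrightarrow> ?P (proj m n (x, y))"
    if d: "(x, y) \<in> demand m n" for x y
  proof -
    have "lift m (col m (fst (proj m n (x, y))) j) l = x (l, j)" if "l \<in> {1..m}" "j \<in> {1..n}" for l j
      using lift_col_proj[OF _ d that] m by simp
    moreover have "snd (proj m n (x, y)) = y" by (simp add: proj_def)
    moreover have "(x, y) \<in> points m n" using d by (auto simp: demand_def)
    ultimately show ?thesis by (auto simp: strong_relaxation_def)
  qed
  have meas: "{p \<in> space ?XY. ?P p} \<in> sets ?XY"
  proof -
    have B': "{p \<in> space ?XY. snd p i \<in> B} \<in> sets ?XY"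
      using measurable_sets[OF measurable_snd_y[OF i, of n] B]
      by (simp add: vimage_def Int_def conj_commute)
    note le = borel_measurable_le[OF borel_measurable_const measurable_fst_lift_col]
      borel_measurable_le[OF measurable_fst_lift_col measurable_snd_y] borel_measurable_le[OF measurable_snd_y borel_measurable_const]
    show ?thesis
      by (intro sets.sets_Collect_conj sets.sets_Collect_finite_All' le B') (use m n in auto)
  qed
  have slab: "strong_slab m n i B = (strong_relaxation m n \<inter> {(x, y). y i \<in> B}) \<inter> demand m n"
    by (auto simp: strong_slab_def)
  show "strong_slab m n i B \<in> sets (vol_measure m n)"
    unfolding slab using m by (intro emeasure_vol(1)[OF _ iff meas]) auto
  have "emeasure (vol_measure m n) (strong_slab m n i B) = emeasure ?XY {p \<in> space ?XY. ?P p}"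
    unfolding slab using m by (intro emeasure_vol(2)[OF _ iff meas]) auto
  also have "\<dots> = (\<integral>\<^sup>+y. emeasure (x_space m n) ((\<lambda>x. (x, y)) -` {p \<in> space ?XY. ?P p}) \<partial>y_space m)"
    by (rule emeasure_pair_measure_alt2[OF meas])
  also have "\<dots> = (\<integral>\<^sup>+y. indicator {y \<in> space (y_space m). (\<forall>l\<in>{1..m}. y l \<in> {0..1}) \<and> y i \<in> B} y
          * ennreal (box_prob m y / fact (m - 1)) ^ n \<partial>y_space m)"
  proof (rule nn_integral_cong)
    fix y assume y: "y \<in> space (y_space m)"
    have box: "col_box m y \<in> sets (col_space m)" unfolding col_box_def by measurable
    show "emeasure (x_space m n) ((\<lambda>x. (x, y)) -` {p \<in> space ?XY. ?P p})
      = indicator {y \<in> space (y_space m). (\<forall>l\<in>{1..m}. y l \<in> {0..1}) \<and> y i \<in> B} y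
          * ennreal (box_prob m y / fact (m - 1)) ^ n"
    proof (cases "(\<forall>l\<in>{1..m}. y l \<in> {0..1}) \<and> y i \<in> B")
      case True
      then have "(\<lambda>x. (x, y)) -` {p \<in> space ?XY. ?P p} =
          {x \<in> space (x_space m n). \<forall>j\<in>{1..n}. col m x j \<in> col_box m y}"
        using y by (auto simp: col_box_def space_pair_measure col_simplex_def col_in_space)
      then have "emeasure (x_space m n) ((\<lambda>x. (x, y)) -` {p \<in> space ?XY. ?P p})
          = emeasure (col_space m) (col_box m y) ^ n"
        using emeasure_columns[of n "\<lambda>_. col_box m y" m] box by simp
      also have "emeasure (col_space m) (col_box m y) = ennreal (box_prob m y / fact (m - 1))"
        unfolding box_prob_def col_box_def[symmetric]
        by (rule emeasure_col_space_eq[OF m box]) (auto simp: col_box_def)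
      finally show ?thesis using True y by simp
    next
      case False
      \<comment> \<open>\<open>?P\<close> does not state \<open>0 \<le> y l\<close>; it follows from
        the two bounds on the entries of column 1, which exists because
        \<open>n \<ge> 1\<close>.\<close>
      have "\<not> ?P (x, y)" for x
      proof
        assume P: "?P (x, y)"
        have "0 \<le> y l" if "l \<in> {1..m}" for l
        proof -
          have "1 \<in> {1..n}" using n by simp
          then have "0 \<le> lift m (col m x 1) l" "lift m (col m x 1) l \<le> y l" using P that by auto
          then show ?thesis by (rule order_trans)
        qed
        then show False using False P by auto
      qed
      then have e: "(\<lambda>x. (x, y)) -` {p \<in> space ?XY. ?P p} = {}" by blast
      show ?thesis unfolding e using False by simp
    qed
  qed
  finally show "emeasure (vol_measure m n) (strong_slab m n i B)
      = (\<integral>\<^sup>+y. indicator {y \<in> space (y_space m). (\<forall>l\<in>{1..m}. y l \<in> {0..1}) \<and> y i \<in> B} y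
          * ennreal (box_prob m y / fact (m - 1)) ^ n \<partial>y_space m)" .
qed

text \<open>The weak constraint on row \<open>l\<close> says that \<open>y l\<close> is at least
  this average, so it is the left end of the interval available to \<open>y l\<close>.\<close>

definition row_avg :: "nat \<Rightarrow> nat \<Rightarrow> (nat \<times> nat \<Rightarrow> real) \<Rightarrow> nat \<Rightarrow> real" where
  "row_avg m n x l = (\<Sum>j\<in>{1..n}. lift m (col m x j) l) / real n"

lemma measurable_row_avg [measurable]:
  "l \<in> {1..m} \<Longrightarrow> (\<lambda>x. row_avg m n x l) \<in> borel_measurable (x_space m n)"
  unfolding row_avg_def by measurable

lemma measurable_fst_row_avg:
  "l \<in> {1..m} \<Longrightarrow> (\<lambda>p. row_avg m n (fst p) l) \<in> borel_measurable (x_space m n \<Otimes>\<^sub>M y_space m)"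
  by (rule measurable_compose[OF measurable_fst measurable_row_avg])

text \<open>Here \<open>y\<close> is integrated first: for fixed \<open>x\<close> the
  \<open>y l\<close> range independently over \<open>{row_avg m n x l..1}\<close>, and only row
  \<open>i\<close> carries the condition \<open>B\<close>.\<close>

lemma weak_slab_measure:
  assumes m: "m \<ge> 2" and n: "n \<ge> 1" and i: "i \<in> {1..m}" and B: "B \<in> sets borel"
  shows "weak_slab m n i B \<in> sets (vol_measure m n)"
    and "emeasure (vol_measure m n) (weak_slab m n i B)
      = (\<integral>\<^sup>+x. indicator {x \<in> space (x_space m n). \<forall>j\<in>{1..n}. col m x j \<in> col_simplex m} x
          * (\<Prod>l\<in>{1..m}. emeasure lborel ({row_avg m n x l..1} \<inter> (if l = i then B else UNIV))) \<partial>x_space m n)"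
proof -
  let ?XY = "x_space m n \<Otimes>\<^sub>M y_space m"
  let ?P = "\<lambda>p. (\<forall>j\<in>{1..n}. \<forall>l\<in>{1..m}. 0 \<le> lift m (col m (fst p) j) l)
     \<and> (\<forall>l\<in>{1..m}. row_avg m n (fst p) l \<le> snd p l \<and> snd p l \<le> 1) \<and> snd p i \<in> B"
  interpret pair_sigma_finite "x_space m n" "y_space m" by (rule pair_sigma_finite_xy)
  \<comment> \<open>Nonnegative entries with column sum 1 are at most 1, which supplies the upper
    bound on the entries in the weak relaxation.\<close>
  have le1: "lift m c l \<le> 1" if "\<forall>l\<in>{1..m}. 0 \<le> lift m c l" "l \<in> {1..m}" for c l
    using member_le_sum[of l "{1..m}" "lift m c"] sum_lift[of m c] that m by auto
  have iff: "(x, y) \<in> weak_relaxation m n \<inter> {(x, y). y i \<in> B} \<longleftrightarrow> ?P (proj m n (x, y))"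
    if d: "(x, y) \<in> demand m n" for x y
  proof -
    have *: "lift m (col m (fst (proj m n (x, y))) j) l = x (l, j)" if "l \<in> {1..m}" "j \<in> {1..n}" for l j
      using lift_col_proj[OF _ d that] m by simp
    have "row_avg m n (fst (proj m n (x, y))) l \<le> t \<longleftrightarrow> (\<Sum>j\<in>{1..n}. x (l, j)) \<le> real n * t"
      if "l \<in> {1..m}" for l t
      using n that by (simp add: row_avg_def * pos_divide_le_eq mult.commute)
    moreover have "snd (proj m n (x, y)) = y" by (simp add: proj_def)
    moreover have "(x, y) \<in> points m n" using d by (auto simp: demand_def)
    moreover have "x (l, j) \<le> 1" if "l \<in> {1..m}" "j \<in> {1..n}" "\<forall>l\<in>{1..m}. \<forall>j\<in>{1..n}. 0 \<le> x (l, j)" for l j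
      using le1[of "col m (fst (proj m n (x, y))) j" l] that * by auto
    ultimately show ?thesis using * by (auto simp: weak_relaxation_def)
  qed
  have meas: "{p \<in> space ?XY. ?P p} \<in> sets ?XY"
  proof -
    have B': "{p \<in> space ?XY. snd p i \<in> B} \<in> sets ?XY"
      using measurable_sets[OF measurable_snd_y[OF i, of n] B]
      by (simp add: vimage_def Int_def conj_commute)
    note le = borel_measurable_le[OF borel_measurable_const measurable_fst_lift_col]
      borel_measurable_le[OF measurable_fst_row_avg measurable_snd_y] borel_measurable_le[OF measurable_snd_y borel_measurable_const]
    show ?thesis
      by (intro sets.sets_Collect_conj sets.sets_Collect_finite_All' le B') (use m n in auto)
  qed
  have slab: "weak_slab m n i B = (weak_relaxation m n \<inter> {(x, y). y i \<in> B}) \<inter> demand m n"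
    by (auto simp: weak_slab_def)
  show "weak_slab m n i B \<in> sets (vol_measure m n)"
    unfolding slab using m by (intro emeasure_vol(1)[OF _ iff meas]) auto
  have "emeasure (vol_measure m n) (weak_slab m n i B) = emeasure ?XY {p \<in> space ?XY. ?P p}"
    unfolding slab using m by (intro emeasure_vol(2)[OF _ iff meas]) auto
  also have "\<dots> = (\<integral>\<^sup>+x. emeasure (y_space m) (Pair x -` {p \<in> space ?XY. ?P p}) \<partial>x_space m n)"
    by (rule M2.emeasure_pair_measure_alt[OF meas])
  also have "\<dots> = (\<integral>\<^sup>+x. indicator {x \<in> space (x_space m n). \<forall>j\<in>{1..n}. col m x j \<in> col_simplex m} x
          * (\<Prod>l\<in>{1..m}. emeasure lborel ({row_avg m n x l..1} \<inter> (if l = i then B else UNIV))) \<partial>x_space m n)"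
  proof (rule nn_integral_cong)
    fix x assume x: "x \<in> space (x_space m n)"
    let ?C = "\<lambda>l. {row_avg m n x l..1} \<inter> (if l = i then B else UNIV)"
    show "emeasure (y_space m) (Pair x -` {p \<in> space ?XY. ?P p})
      = indicator {x \<in> space (x_space m n). \<forall>j\<in>{1..n}. col m x j \<in> col_simplex m} x
          * (\<Prod>l\<in>{1..m}. emeasure lborel (?C l))"
    proof (cases "\<forall>j\<in>{1..n}. col m x j \<in> col_simplex m")
      case True
      have "Pair x -` {p \<in> space ?XY. ?P p} = Pi\<^sub>E {1..m} ?C"
      proof (rule set_eqI)
        fix y
        have "y \<in> Pair x -` {p \<in> space ?XY. ?P p} \<longleftrightarrow>
            y \<in> extensional {1..m} \<and> (\<forall>l\<in>{1..m}. row_avg m n x l \<le> y l \<and> y l \<le> 1) \<and> y i \<in> B"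
          using x True by (auto simp: space_pair_measure space_PiM PiE_iff col_simplex_def)
        also have "\<dots> \<longleftrightarrow> y \<in> Pi\<^sub>E {1..m} ?C" using i by (auto simp: PiE_iff)
        finally show "y \<in> Pair x -` {p \<in> space ?XY. ?P p} \<longleftrightarrow> y \<in> Pi\<^sub>E {1..m} ?C" .
      qed
      then have "emeasure (y_space m) (Pair x -` {p \<in> space ?XY. ?P p}) = (\<Prod>l\<in>{1..m}. emeasure lborel (?C l))"
        using B by (simp add: lborel_product.emeasure_PiM)
      then show ?thesis using True x by simp
    next
      case False
      then have e: "Pair x -` {p \<in> space ?XY. ?P p} = {}"
        by (auto simp: col_simplex_def col_in_space)
      show ?thesis unfolding e using False by simp
    qed
  qed
  finally show "emeasure (vol_measure m n) (weak_slab m n i B)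
      = (\<integral>\<^sup>+x. indicator {x \<in> space (x_space m n). \<forall>j\<in>{1..n}. col m x j \<in> col_simplex m} x
          * (\<Prod>l\<in>{1..m}. emeasure lborel ({row_avg m n x l..1} \<inter> (if l = i then B else UNIV))) \<partial>x_space m n)" .
qed

section \<open>Bounds for the strong relaxation\<close>

text \<open>A converse to \<open>1 - w \<le> exp (- w)\<close> at the price of the factor
  \<open>1 + 2 * d\<close>: it comes from \<open>ln (1 - w) \<ge> - w - 2 * w^2\<close> and
  \<open>w^2 \<le> d * w\<close>.\<close>

lemma exp_le_one_minus:
  fixes w d :: real
  assumes "0 \<le> w" "w \<le> d" "d \<le> 1 / 2"
  shows "exp (- ((1 + 2 * d) * w)) \<le> 1 - w"
proof -
  have "w * w \<le> d * w" using assms by (intro mult_right_mono) auto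
  then have "- ((1 + 2 * d) * w) \<le> - w - 2 * w\<^sup>2" by (simp add: power2_eq_square algebra_simps)
  also have "\<dots> \<le> ln (1 - w)" using assms by (intro ln_one_minus_pos_lower_bound) auto
  finally have "exp (- ((1 + 2 * d) * w)) \<le> exp (ln (1 - w))" by simp
  then show ?thesis using assms by simp
qed

text \<open>From \<open>ln (1 + s) \<ge> s - s^2\<close> and \<open>s^2 \<le> d * s\<close>; near 0
  the second moment bound thus costs only a factor \<open>1 - d\<close> in the exponent.\<close>

lemma inverse_one_plus_le_exp:
  fixes s d :: real
  assumes "0 \<le> s" "s \<le> d" "d \<le> 1"
  shows "1 / (1 + s) \<le> exp (- ((1 - d) * s))"
proof -
  have "s * s \<le> d * s" using assms by (intro mult_right_mono) auto
  then have "(1 - d) * s \<le> s - s\<^sup>2" by (simp add: power2_eq_square algebra_simps)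
  also have "\<dots> \<le> ln (1 + s)" using assms by (intro ln_one_plus_pos_lower_bound) auto
  finally have "exp (- ln (1 + s)) \<le> exp (- ((1 - d) * s))" by simp
  moreover have "exp (- ln (1 + s)) = 1 / (1 + s)" using assms by (simp add: exp_minus inverse_eq_divide)
  ultimately show ?thesis by simp
qed

lemma prod_one_minus_le_exp:
  assumes "finite A" "\<And>l. l \<in> A \<Longrightarrow> w l \<le> (1::real)"
  shows "(\<Prod>l\<in>A. 1 - w l) \<le> exp (- (\<Sum>l\<in>A. w l))"
proof -
  have "1 - x \<le> exp (- x)" for x :: real using exp_ge_add_one_self[of "- x"] by simp
  then have "(\<Prod>l\<in>A. 1 - w l) \<le> (\<Prod>l\<in>A. exp (- w l))"
    using assms by (intro prod_mono) auto
  then show ?thesis using assms by (simp add: exp_sum sum_negf[symmetric])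
qed

text \<open>The threshold \<open>d\<close> will be \<open>1 / sqrt n\<close>: where \<open>\<Sum>w \<le> d\<close> the factors \<open>1 - w\<close> are compared with
  exponentials, and where \<open>\<Sum>w > d\<close> both sides are negligible.\<close>

lemma power_le_prod_power:
  fixes w :: "'a \<Rightarrow> real"
  assumes "finite A" "\<And>l. l \<in> A \<Longrightarrow> 0 \<le> w l" "\<And>l. l \<in> A \<Longrightarrow> w l \<le> 1"
    and F: "0 \<le> F" "F \<le> 1 / (1 + (\<Sum>l\<in>A. w l))"
    and d: "0 < d" "d \<le> 1 / 3" and N: "real N \<le> (1 - 3 * d) * real n"
  shows "F ^ n \<le> (\<Prod>l\<in>A. (1 - w l) ^ N) + (1 / (1 + d)) ^ n"
proof -
  define s where "s = (\<Sum>l\<in>A. w l)"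
  have s0: "0 \<le> s" unfolding s_def using assms by (intro sum_nonneg) auto
  have P0: "0 \<le> (\<Prod>l\<in>A. (1 - w l) ^ N)" using assms by (intro prod_nonneg) auto
  show ?thesis
  proof (cases "s \<le> d")
    case True
    have "F \<le> exp (- ((1 - d) * s))"
      using F(2) inverse_one_plus_le_exp[OF s0 True] d unfolding s_def[symmetric] by simp
    then have "F ^ n \<le> exp (- ((1 - d) * s)) ^ n" using F by (intro power_mono) auto
    also have "\<dots> = exp (- (real n * (1 - d) * s))"
      by (simp add: exp_of_nat_mult[symmetric] algebra_simps)
    also have "\<dots> \<le> exp (- (real N * (1 + 2 * d) * s))"
    proof -
      \<comment> \<open>This fixes the constant 3:
        \<open>(1 - 3 * d) * (1 + 2 * d) = 1 - d - 6 * d^2\<close> stays below \<open>1 - d\<close>,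
        so the smaller exponent pays for the losses in both logarithmic bounds.\<close>
      have "real N * (1 + 2 * d) \<le> (1 - 3 * d) * real n * (1 + 2 * d)"
        using N d by (intro mult_right_mono) auto
      also have "\<dots> = real n * ((1 - d) - 6 * d\<^sup>2)" by (simp add: power2_eq_square algebra_simps)
      also have "\<dots> \<le> real n * (1 - d)" by (intro mult_left_mono) auto
      finally have "real N * (1 + 2 * d) * s \<le> real n * (1 - d) * s" using s0 by (intro mult_right_mono)
      then show ?thesis by simp
    qed
    also have "\<dots> = (\<Prod>l\<in>A. exp (- ((1 + 2 * d) * w l)) ^ N)"
    proof -
      have "(\<Prod>l\<in>A. exp (- ((1 + 2 * d) * w l)) ^ N) = exp (\<Sum>l\<in>A. real N * - ((1 + 2 * d) * w l))"
        using assms(1) by (simp only: exp_of_nat_mult exp_sum)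
      also have "(\<Sum>l\<in>A. real N * - ((1 + 2 * d) * w l)) = - (real N * (1 + 2 * d) * s)"
        unfolding s_def sum_distrib_left sum_negf[symmetric] by (simp add: mult.assoc)
      finally show ?thesis by simp
    qed
    also have "\<dots> \<le> (\<Prod>l\<in>A. (1 - w l) ^ N)"
    proof (intro prod_mono conjI power_mono)
      fix l assume l: "l \<in> A"
      have "w l \<le> s" unfolding s_def using assms l by (intro member_le_sum) auto
      then show "exp (- ((1 + 2 * d) * w l)) \<le> 1 - w l"
        using l True assms by (intro exp_le_one_minus) auto
    qed auto
    finally show ?thesis using d by (simp add: add_increasing2)
  next
    case False
    have "F \<le> 1 / (1 + s)" using F(2) by (simp add: s_def)
    also have "\<dots> \<le> 1 / (1 + d)" using False d by (intro divide_left_mono) auto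
    finally have "F ^ n \<le> (1 / (1 + d)) ^ n" using F by (intro power_mono) auto
    then show ?thesis using P0 by simp
  qed
qed

text \<open>An exponent \<open>N\<close> enlarged by the factor \<open>1 + 2 * d\<close> absorbs the
  loss in \<open>exp_le_one_minus\<close> while the sum of the \<open>w l\<close> is at most
  \<open>d\<close>; beyond \<open>d\<close> the product itself is at most
  \<open>exp (- (d * n))\<close>.\<close>

lemma prod_power_le_power:
  fixes w :: "'a \<Rightarrow> real"
  assumes "finite A" "\<And>l. l \<in> A \<Longrightarrow> 0 \<le> w l" "\<And>l. l \<in> A \<Longrightarrow> w l \<le> 1"
    and F: "0 \<le> F" "1 - (\<Sum>l\<in>A. w l) \<le> F"
    and d: "0 < d" "d \<le> 1 / 2" and N: "(1 + 2 * d) * real n \<le> real N"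
  shows "(\<Prod>l\<in>A. (1 - w l) ^ N) \<le> F ^ n + exp (- (d * real n))"
proof -
  define s where "s = (\<Sum>l\<in>A. w l)"
  have s0: "0 \<le> s" unfolding s_def using assms by (intro sum_nonneg) auto
  have "(\<Prod>l\<in>A. (1 - w l) ^ N) = (\<Prod>l\<in>A. 1 - w l) ^ N" by (simp add: prod_power_distrib)
  also have "\<dots> \<le> exp (- s) ^ N"
    unfolding s_def using assms by (intro power_mono prod_one_minus_le_exp prod_nonneg) auto
  also have "\<dots> = exp (- (real N * s))" by (simp add: exp_of_nat_mult[symmetric])
  also have "\<dots> \<le> exp (- ((1 + 2 * d) * real n * s))" using N s0 by (simp add: mult_right_mono)
  finally have P: "(\<Prod>l\<in>A. (1 - w l) ^ N) \<le> exp (- ((1 + 2 * d) * real n * s))" .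
  show ?thesis
  proof (cases "s \<le> d")
    case True
    have "exp (- ((1 + 2 * d) * s)) \<le> F"
      using exp_le_one_minus[OF s0 True] d F(2) unfolding s_def[symmetric] by simp
    then have "exp (- ((1 + 2 * d) * s)) ^ n \<le> F ^ n" by (intro power_mono) auto
    also have "exp (- ((1 + 2 * d) * s)) ^ n = exp (- ((1 + 2 * d) * real n * s))"
      by (simp add: exp_of_nat_mult[symmetric] algebra_simps)
    finally show ?thesis using P by (simp add: add_increasing2)
  next
    case False
    have "d * real n = 1 * d * real n" by simp
    also have "\<dots> \<le> (1 + 2 * d) * s * real n"
      using False d by (intro mult_right_mono mult_mono) auto
    finally have "exp (- ((1 + 2 * d) * real n * s)) \<le> exp (- (d * real n))" by (simp add: mult_ac)
    moreover have "0 \<le> F ^ n" using F by simp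
    ultimately show ?thesis using P by linarith
  qed
qed

section \<open>Integrals of the product kernel over the cube\<close>

lemma nn_integral_kernel_prod:
  assumes "k > 0" "i \<in> {1..m}" "B \<in> sets borel"
  shows "(\<integral>\<^sup>+y. (\<Prod>l\<in>{1..m}. indicator ({0..1} \<inter> (if l = i then B else UNIV)) (y l)
      * ennreal ((1 - (1 - y l) ^ k) ^ N)) \<partial>y_space m)
    = ennreal (kernel_int k N ^ (m - 1) * kernel_meas k N B)"
proof -
  have "(\<integral>\<^sup>+y. (\<Prod>l\<in>{1..m}. indicator ({0..1} \<inter> (if l = i then B else UNIV)) (y l)
      * ennreal ((1 - (1 - y l) ^ k) ^ N)) \<partial>y_space m)
    = (\<Prod>l\<in>{1..m}. ennreal (kernel_meas k N (if l = i then B else UNIV)))"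
    using assms(3)
    by (subst lborel_product.product_nn_integral_prod) (auto intro!: prod.cong nn_integral_kernel)
  also have "\<dots> = ennreal (\<Prod>l\<in>{1..m}. kernel_meas k N (if l = i then B else UNIV))"
    by (simp add: prod_ennreal kernel_meas_nonneg)
  also have "(\<Prod>l\<in>{1..m}. kernel_meas k N (if l = i then B else UNIV))
      = kernel_meas k N B * (\<Prod>l\<in>{1..m} - {i}. kernel_meas k N (if l = i then B else UNIV))"
    using assms by (subst prod.remove[of _ i]) auto
  also have "(\<Prod>l\<in>{1..m} - {i}. kernel_meas k N (if l = i then B else UNIV)) = kernel_int k N ^ (m - 1)"
  proof -
    have "(\<Prod>l\<in>{1..m} - {i}. kernel_meas k N (if l = i then B else UNIV)) = (\<Prod>l\<in>{1..m} - {i}. kernel_int k N)"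
      by (intro prod.cong) (auto simp: kernel_meas_UNIV[OF assms(1)])
    then show ?thesis using assms by simp
  qed
  finally show ?thesis by (simp add: mult.commute)
qed

lemma emeasure_y_cube: "emeasure (y_space m) (Pi\<^sub>E {1..m} (\<lambda>_. {0..1})) = 1"
  by (simp add: lborel_product.emeasure_PiM)

lemma prod_indicator_mult:
  assumes "finite A" "\<And>l. l \<in> A \<Longrightarrow> y l \<in> S l \<Longrightarrow> 0 \<le> f l"
  shows "(\<Prod>l\<in>A. indicator (S l) (y l) * ennreal (f l))
    = (if \<forall>l\<in>A. y l \<in> S l then ennreal (\<Prod>l\<in>A. f l) else 0)"
proof (cases "\<forall>l\<in>A. y l \<in> S l")
  case True
  then show ?thesis using assms by (simp add: prod_ennreal)
next
  case False
  then obtain l where "l \<in> A" "y l \<notin> S l" by blast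
  then have "(\<Prod>l\<in>A. indicator (S l) (y l) * ennreal (f l)) = 0"
    using assms(1) by (intro prod_zero bexI[of _ l]) auto
  then show ?thesis using False by (simp only: if_False)
qed

text \<open>On the cube \<open>box_prob_bounds\<close> and \<open>power_le_prod_power\<close>
  dominate the integrand by the product kernel plus a constant. The kernel factors over the
  coordinates, and the constant is integrated over the whole cube, of measure 1.\<close>

lemma strong_slab_upper:
  assumes m: "m \<ge> 2" and n: "n \<ge> 1" and i: "i \<in> {1..m}" and B: "B \<in> sets borel"
    and d: "0 < d" "d \<le> 1 / 3" and N: "real N \<le> (1 - 3 * d) * real n"
  shows "emeasure (vol_measure m n) (strong_slab m n i B)
    \<le> ennreal ((1 / fact (m - 1)) ^ n
        * (kernel_int (m - 1) N ^ (m - 1) * kernel_meas (m - 1) N B + (1 / (1 + d)) ^ n))"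
proof -
  define C where "C = (1 / fact (m - 1) :: real) ^ n"
  define e where "e = (1 / (1 + d)) ^ n"
  define P where "P = (\<lambda>y::nat \<Rightarrow> real. \<Prod>l\<in>{1..m}. (1 - (1 - y l) ^ (m - 1)) ^ N)"
  let ?S = "\<lambda>l. {0..1} \<inter> (if l = i then B else UNIV)"
  let ?K = "\<lambda>y. \<Prod>l\<in>{1..m}. indicator (?S l) (y l) * ennreal ((1 - (1 - y l) ^ (m - 1)) ^ N)"
  have C0: "0 \<le> C" and e0: "0 \<le> e" using d by (auto simp: C_def e_def)
  have "emeasure (vol_measure m n) (strong_slab m n i B)
    \<le> (\<integral>\<^sup>+y. ennreal C * (?K y + ennreal e * indicator (Pi\<^sub>E {1..m} (\<lambda>_. {0..1})) y) \<partial>y_space m)"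
    unfolding strong_slab_measure(2)[OF m n i B]
  proof (rule nn_integral_mono)
    fix y assume y: "y \<in> space (y_space m)"
    show "indicator {y \<in> space (y_space m). (\<forall>l\<in>{1..m}. y l \<in> {0..1}) \<and> y i \<in> B} y
          * ennreal (box_prob m y / fact (m - 1)) ^ n
        \<le> ennreal C * (?K y + ennreal e * indicator (Pi\<^sub>E {1..m} (\<lambda>_. {0..1})) y)"
    proof (cases "(\<forall>l\<in>{1..m}. y l \<in> {0..1}) \<and> y i \<in> B")
      case True
      then have cube: "y \<in> Pi\<^sub>E {1..m} (\<lambda>_. {0..1})" using y by (auto simp: space_PiM PiE_iff)
      have K: "?K y = ennreal (P y)"
        using True unfolding P_def by (subst prod_indicator_mult) (auto simp: power_le_one)
      have F0: "0 \<le> box_prob m y" by (simp add: box_prob_def)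
      have "box_prob m y ^ n \<le> P y + e"
        unfolding e_def P_def using box_prob_bounds(2)[OF m, of y] True d N F0
        by (intro power_le_prod_power) (auto simp: power_le_one)
      then have "C * box_prob m y ^ n \<le> C * (P y + e)"
        using C0 by (rule mult_left_mono)
      moreover have "0 \<le> P y"
        using True unfolding P_def by (intro prod_nonneg) (auto simp: power_le_one)
      ultimately show ?thesis
        using True y cube C0 e0 F0 unfolding K
        by (simp add: ennreal_power C_def power_divide ennreal_mult[symmetric] ennreal_plus[symmetric]
            del: ennreal_plus)
    next
      case False
      then show ?thesis by auto
    qed
  qed
  also have "\<dots> = ennreal C * ((\<integral>\<^sup>+y. ?K y \<partial>y_space m) + ennreal e)"
  proof -
    have [measurable]: "Pi\<^sub>E {1..m} (\<lambda>_. {0..1}) \<in> sets (y_space m)" by (intro sets_PiM_I_finite) auto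
    have [measurable]: "?K \<in> borel_measurable (y_space m)"
    proof (intro borel_measurable_prod_ennreal)
      fix l assume l: "l \<in> {1..m}"
      have "(\<lambda>t. indicator (?S l) t * ennreal ((1 - (1 - t) ^ (m - 1)) ^ N)) \<in> borel_measurable borel"
        using B by simp
      from measurable_compose[OF measurable_y[OF l] this]
      show "(\<lambda>y. indicator (?S l) (y l) * ennreal ((1 - (1 - y l) ^ (m - 1)) ^ N)) \<in> borel_measurable (y_space m)" .
    qed
    show ?thesis
      by (subst nn_integral_cmult, measurable, subst nn_integral_add)
         (simp_all add: nn_integral_cmult_indicator emeasure_y_cube del: One_nat_def)
  qed
  also have "\<dots> = ennreal (C * (kernel_int (m - 1) N ^ (m - 1) * kernel_meas (m - 1) N B + e))"
  proof -
    have K0: "0 \<le> kernel_int (m - 1) N ^ (m - 1) * kernel_meas (m - 1) N B"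
      using m kernel_int_pos[of "m - 1" N] by (simp add: kernel_meas_nonneg)
    show ?thesis
      unfolding ennreal_mult[OF C0 add_nonneg_nonneg[OF K0 e0]] ennreal_plus[OF K0 e0]
      using m by (subst nn_integral_kernel_prod[OF _ i B]) simp_all
  qed
  finally show ?thesis by (simp add: C_def e_def)
qed

text \<open>Mirror image of the upper bound, by \<open>prod_power_le_power\<close>. The error stands
  on the right because subtraction in \<open>ennreal\<close> would truncate.\<close>

lemma strong_slab_lower:
  assumes m: "m \<ge> 2" and n: "n \<ge> 1" and i: "i \<in> {1..m}"
    and d: "0 < d" "d \<le> 1 / 2" and N: "(1 + 2 * d) * real n \<le> real N"
  shows "ennreal ((1 / fact (m - 1)) ^ n * kernel_int (m - 1) N ^ m)
    \<le> emeasure (vol_measure m n) (strong_slab m n i UNIV) + ennreal ((1 / fact (m - 1)) ^ n * exp (- (d * real n)))"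
proof -
  define C where "C = (1 / fact (m - 1) :: real) ^ n"
  define e where "e = exp (- (d * real n))"
  define P where "P = (\<lambda>y::nat \<Rightarrow> real. \<Prod>l\<in>{1..m}. (1 - (1 - y l) ^ (m - 1)) ^ N)"
  let ?Q = "Pi\<^sub>E {1..m} (\<lambda>_. {0..1::real})"
  \<comment> \<open>The conditional with equal branches keeps the shape of
    \<open>nn_integral_kernel_prod\<close> at \<open>B = UNIV\<close>.\<close>
  let ?K = "\<lambda>y. \<Prod>l\<in>{1..m}. indicator ({0..1} \<inter> (if l = i then UNIV else UNIV)) (y l) * ennreal ((1 - (1 - y l) ^ (m - 1)) ^ N)"
  have C0: "0 \<le> C" and e0: "0 \<le> e" by (auto simp: C_def e_def)
  have [measurable]: "?Q \<in> sets (y_space m)" by (intro sets_PiM_I_finite) auto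
  have [measurable]: "P \<in> borel_measurable (y_space m)"
    unfolding P_def by (intro borel_measurable_prod borel_measurable_power borel_measurable_diff borel_measurable_const measurable_y)
  have K: "?K y = ennreal (P y) * indicator ?Q y" if "y \<in> space (y_space m)" for y
    using that unfolding P_def
    by (subst prod_indicator_mult) (auto simp: space_PiM PiE_iff power_le_one indicator_def)
  have "ennreal (C * kernel_int (m - 1) N ^ m) = ennreal C * (\<integral>\<^sup>+y. ?K y \<partial>y_space m)"
  proof -
    have "kernel_int (m - 1) N ^ m = kernel_int (m - 1) N ^ (m - 1) * kernel_int (m - 1) N"
      using m by (cases m) auto
    then show ?thesis
      using m C0 kernel_int_pos[of "m - 1" N]
      by (subst nn_integral_kernel_prod[OF _ i]) (auto simp: ennreal_mult less_imp_le kernel_meas_UNIV)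
  qed
  also have "\<dots> = (\<integral>\<^sup>+y. ennreal (C * P y) * indicator ?Q y \<partial>y_space m)"
  proof -
    have "(\<integral>\<^sup>+y. ?K y \<partial>y_space m) = (\<integral>\<^sup>+y. ennreal (P y) * indicator ?Q y \<partial>y_space m)"
      by (rule nn_integral_cong[OF K])
    moreover have "ennreal C * \<dots> = (\<integral>\<^sup>+y. ennreal C * (ennreal (P y) * indicator ?Q y) \<partial>y_space m)"
      by (rule nn_integral_cmult[symmetric]) measurable
    ultimately show ?thesis using C0 by (simp add: ennreal_mult' mult.assoc)
  qed
  \<comment> \<open>\<open>P y - e\<close> may be negative, where \<open>ennreal\<close> makes it 0;
    splitting off \<open>e\<close> is therefore only an inequality.\<close>
  also have "\<dots> \<le> (\<integral>\<^sup>+y. ennreal (C * (P y - e)) * indicator ?Q y + ennreal (C * e) * indicator ?Q y \<partial>y_space m)"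
  proof (rule nn_integral_mono)
    fix y
    have "ennreal (C * P y) = ennreal (C * (P y - e) + C * e)" by (simp add: algebra_simps)
    also have "\<dots> \<le> ennreal (C * (P y - e)) + ennreal (C * e)"
      using ennreal_plus[of "C * (P y - e)" "C * e"] C0 e0
      by (cases "0 \<le> C * (P y - e)") (auto simp: ennreal_neg intro!: ennreal_leI)
    finally show "ennreal (C * P y) * indicator ?Q y \<le> ennreal (C * (P y - e)) * indicator ?Q y + ennreal (C * e) * indicator ?Q y"
      by (auto simp: indicator_def)
  qed
  also have "\<dots> = (\<integral>\<^sup>+y. ennreal (C * (P y - e)) * indicator ?Q y \<partial>y_space m) + ennreal (C * e)"
    by (subst nn_integral_add) (simp_all add: emeasure_y_cube nn_integral_cmult_indicator del: One_nat_def)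
  also have "(\<integral>\<^sup>+y. ennreal (C * (P y - e)) * indicator ?Q y \<partial>y_space m)
    \<le> emeasure (vol_measure m n) (strong_slab m n i UNIV)"
    unfolding strong_slab_measure(2)[OF m n i sets.top[of borel, unfolded space_borel]]
  proof (rule nn_integral_mono)
    fix y assume y: "y \<in> space (y_space m)"
    show "ennreal (C * (P y - e)) * indicator ?Q y
      \<le> indicator {y \<in> space (y_space m). (\<forall>l\<in>{1..m}. y l \<in> {0..1}) \<and> y i \<in> UNIV} y
          * ennreal (box_prob m y / fact (m - 1)) ^ n"
    proof (cases "y \<in> ?Q")
      case True
      have F0: "0 \<le> box_prob m y" by (simp add: box_prob_def)
      have "P y \<le> box_prob m y ^ n + e"
        unfolding P_def e_def using box_prob_bounds(1)[OF m, of y] True d N F0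
        by (intro prod_power_le_power) (auto simp: power_le_one PiE_iff)
      then have "C * (P y - e) \<le> C * box_prob m y ^ n"
        using C0 by (intro mult_left_mono) auto
      then have "ennreal (C * (P y - e)) \<le> ennreal (C * box_prob m y ^ n)" by (rule ennreal_leI)
      also have "\<dots> = ennreal (box_prob m y / fact (m - 1)) ^ n"
        using F0 by (simp add: ennreal_power C_def power_divide)
      finally show ?thesis using True y by (auto simp: indicator_def PiE_iff)
    qed simp
  qed
  finally show ?thesis by (simp add: C_def e_def add_mono)
qed

section \<open>Bounds for the weak relaxation\<close>

abbreviation product_simplex :: "nat \<Rightarrow> nat \<Rightarrow> (nat \<times> nat \<Rightarrow> real) set" where
  "product_simplex m n \<equiv> {x \<in> space (x_space m n). \<forall>j\<in>{1..n}. col m x j \<in> col_simplex m}"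

text \<open>Exceptional columns: for \<open>e \<ge> 0\<close> the union bound gives them probability
  at most \<open>m * (max 0 (1 - e)) ^ (m - 1)\<close>.\<close>

definition large_coord :: "nat \<Rightarrow> real \<Rightarrow> (nat \<Rightarrow> real) set" where
  "large_coord m e = (\<Union>l\<in>{1..m}. {c \<in> col_simplex m. e < lift m c l})"

text \<open>Bounds every row average at once: entries of an ordinary column are at most
  \<open>e\<close>, those of an exceptional one at most 1.\<close>

definition row_bound :: "nat \<Rightarrow> nat \<Rightarrow> real \<Rightarrow> (nat \<times> nat \<Rightarrow> real) \<Rightarrow> real" where
  "row_bound m n e x = e + (\<Sum>j\<in>{1..n}. indicator (large_coord m e) (col m x j)) / real n"

text \<open>An upper bound, for \<open>e \<ge> 0\<close>, on the mean of \<open>row_bound\<close>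
  over independent uniform columns.\<close>

definition row_err :: "nat \<Rightarrow> real \<Rightarrow> real" where
  "row_err m e = e + real m * (max 0 (1 - e)) ^ (m - 1)"

lemma large_coord_measurable [measurable]: "large_coord m e \<in> sets (col_space m)"
  unfolding large_coord_def by (intro sets.finite_UN exceed_set_measurable) auto

lemma measure_large_coord:
  assumes "m \<ge> 2" "0 \<le> e"
  shows "measure (col_dist m) (large_coord m e) \<le> real m * (max 0 (1 - e)) ^ (m - 1)"
proof -
  interpret prob_space "col_dist m" by (rule prob_space_col_dist[OF assms(1)])
  have "prob (large_coord m e) \<le> (\<Sum>l\<in>{1..m}. prob {c \<in> col_simplex m. e < lift m c l})"
    unfolding large_coord_def by (intro finite_measure_subadditive_finite) auto
  also have "\<dots> = (\<Sum>l\<in>{1..m}. (max 0 (1 - e)) ^ (m - 1))"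
    using assms by (intro sum.cong refl prob_coord_gt) auto
  finally show ?thesis by simp
qed

lemma lift_le_1:
  assumes "c \<in> col_simplex m" "l \<in> {1..m}"
  shows "lift m c l \<le> 1"
  using member_le_sum[of l "{1..m}" "lift m c"] sum_lift[of m c] assms by (auto simp: col_simplex_def)

section \<open>Row averages of a fixed \<open>x\<close> in the product of simplices\<close>

context
  fixes m n :: nat and e :: real and x :: "nat \<times> nat \<Rightarrow> real"
  assumes m: "m \<ge> 2" and n: "n \<ge> 1" and e: "0 \<le> e" and x: "x \<in> product_simplex m n"
begin

lemma row_avg_nonneg: "l \<in> {1..m} \<Longrightarrow> 0 \<le> row_avg m n x l"
  using x unfolding row_avg_def by (auto intro!: divide_nonneg_nonneg sum_nonneg simp: col_simplex_def)

lemma sum_row_avg: "(\<Sum>l\<in>{1..m}. row_avg m n x l) = 1"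
proof -
  have "(\<Sum>l\<in>{1..m}. row_avg m n x l) = (\<Sum>j\<in>{1..n}. \<Sum>l\<in>{1..m}. lift m (col m x j) l) / real n"
    unfolding row_avg_def sum_divide_distrib[symmetric] by (subst sum.swap) simp
  also have "\<dots> = (\<Sum>j\<in>{1..n}. 1) / real n"
    using m by (intro arg_cong2[where f = "(/)"] sum.cong refl sum_lift) auto
  finally show ?thesis using n by simp
qed

lemma row_avg_le_1: "l \<in> {1..m} \<Longrightarrow> row_avg m n x l \<le> 1"
  using member_le_sum[of l "{1..m}" "row_avg m n x"] row_avg_nonneg sum_row_avg by auto

lemma row_avg_le_bound:
  assumes "l \<in> {1..m}"
  shows "row_avg m n x l \<le> row_bound m n e x"
proof -
  have "lift m (col m x j) l \<le> e + indicator (large_coord m e) (col m x j)" if "j \<in> {1..n}" for j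
  proof (cases "e < lift m (col m x j) l")
    case True
    have "col m x j \<in> col_simplex m" using x that by auto
    then have "col m x j \<in> large_coord m e" "lift m (col m x j) l \<le> 1"
      using True assms lift_le_1 by (auto simp: large_coord_def)
    then show ?thesis using e by simp
  qed (simp add: indicator_def)
  then have "(\<Sum>j\<in>{1..n}. lift m (col m x j) l) \<le> (\<Sum>j\<in>{1..n}. e + indicator (large_coord m e) (col m x j))"
    by (intro sum_mono) auto
  then have "row_avg m n x l \<le> (\<Sum>j\<in>{1..n}. e + indicator (large_coord m e) (col m x j)) / real n"
    unfolding row_avg_def by (intro divide_right_mono) auto
  also have "\<dots> = row_bound m n e x"
    using n by (simp add: row_bound_def sum.distrib add_divide_distrib)
  finally show ?thesis .
qed

text \<open>The averages add up to 1 and \<open>1 - s \<le> exp (- s)\<close>; this is the origin of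
  the factor \<open>1 / e\<close> in the weak volume.\<close>

lemma prod_row_avg_le: "(\<Prod>l\<in>{1..m}. 1 - row_avg m n x l) \<le> exp (-1)"
  using prod_one_minus_le_exp[of "{1..m}" "row_avg m n x"] row_avg_le_1 sum_row_avg by simp

text \<open>Multiplying the inequalities \<open>1 - s \<ge> exp (- s) * (1 - s^2)\<close> leaves
  \<open>exp (-1)\<close> times the product of the \<open>1 - s^2\<close>. That product is at least
  1 minus the sum of the squares, which is at most \<open>row_bound\<close> because the
  \<open>s\<close> add up to 1.\<close>

lemma prod_row_avg_ge: "exp (-1) * (1 - row_bound m n e x) \<le> (\<Prod>l\<in>{1..m}. 1 - row_avg m n x l)"
proof -
  let ?s = "row_avg m n x"
  have fac: "exp (- s) * (1 - s\<^sup>2) \<le> 1 - s" if "0 \<le> s" "s \<le> 1" for s :: real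
  proof -
    have "exp (- s) * (1 + s) \<le> 1"
      using exp_ge_add_one_self[of s] by (simp add: exp_minus field_simps)
    then have "exp (- s) * (1 + s) * (1 - s) \<le> 1 * (1 - s)" using that by (intro mult_right_mono) auto
    then show ?thesis by (simp add: power2_eq_square algebra_simps)
  qed
  have "(\<Sum>l\<in>{1..m}. (?s l)\<^sup>2) \<le> (\<Sum>l\<in>{1..m}. row_bound m n e x * ?s l)"
    unfolding power2_eq_square using row_avg_le_bound row_avg_nonneg by (intro sum_mono mult_right_mono) auto
  also have "\<dots> = row_bound m n e x" unfolding sum_distrib_left[symmetric] sum_row_avg by simp
  finally have sq: "1 - row_bound m n e x \<le> 1 - (\<Sum>l\<in>{1..m}. (?s l)\<^sup>2)" by simp
  also have "\<dots> \<le> (\<Prod>l\<in>{1..m}. 1 - (?s l)\<^sup>2)"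
    using row_avg_nonneg row_avg_le_1 by (intro Weierstrass_prod_ineq) (auto simp: power_le_one)
  finally have "exp (-1) * (1 - row_bound m n e x) \<le> exp (-1) * (\<Prod>l\<in>{1..m}. 1 - (?s l)\<^sup>2)" by simp
  also have "\<dots> = (\<Prod>l\<in>{1..m}. exp (- ?s l) * (1 - (?s l)\<^sup>2))"
  proof -
    have "exp (-1) = (\<Prod>l\<in>{1..m}. exp (- ?s l))"
      using sum_row_avg by (simp add: exp_sum[symmetric] sum_negf)
    then show ?thesis by (simp add: prod.distrib)
  qed
  also have "\<dots> \<le> (\<Prod>l\<in>{1..m}. 1 - ?s l)"
    using fac row_avg_nonneg row_avg_le_1
    by (intro prod_mono conjI mult_nonneg_nonneg) (auto simp: power_le_one)
  finally show ?thesis .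
qed

text \<open>With \<open>s = row_avg m n x i\<close>, the averages of the other rows add up to
  \<open>1 - s\<close>, so the bound \<open>exp (-1)\<close> worsens by
  \<open>exp s \<le> 1 + 2 * s\<close>.\<close>

lemma prod_row_avg_remove_le:
  assumes i: "i \<in> {1..m}"
  shows "(\<Prod>l\<in>{1..m} - {i}. 1 - row_avg m n x l) \<le> exp (-1) * (1 + 2 * row_bound m n e x)"
proof -
  let ?s = "row_avg m n x"
  have "(\<Sum>l\<in>{1..m} - {i}. ?s l) = 1 - ?s i"
    using sum.remove[of "{1..m}" i ?s] i sum_row_avg by simp
  then have "(\<Prod>l\<in>{1..m} - {i}. 1 - ?s l) \<le> exp (- (1 - ?s i))"
    using prod_one_minus_le_exp[of "{1..m} - {i}" ?s] row_avg_le_1 by simp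
  also have "\<dots> = exp (-1) * exp (?s i)" by (simp add: exp_add[symmetric])
  also have "\<dots> \<le> exp (-1) * (1 + 2 * row_bound m n e x)"
  proof (intro mult_left_mono)
    have s: "0 \<le> ?s i" "?s i \<le> 1" using i row_avg_nonneg row_avg_le_1 by auto
    have "exp (?s i) \<le> 1 + ?s i + (?s i)\<^sup>2" by (rule exp_bound[OF s])
    also have "\<dots> \<le> 1 + 2 * ?s i" using s by (simp add: power2_eq_square mult_left_le)
    finally show "exp (?s i) \<le> 1 + 2 * row_bound m n e x" using row_avg_le_bound[OF i] by simp
  qed simp
  finally show ?thesis .
qed

end

lemma emeasure_product_simplex:
  assumes "m \<ge> 2"
  shows "emeasure (x_space m n) (product_simplex m n) = ennreal ((1 / fact (m - 1)) ^ n)"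
  using emeasure_columns[of n "\<lambda>_. col_simplex m" m] by (simp add: emeasure_col_simplex[OF assms] ennreal_power)

text \<open>By linearity it suffices that one given column is exceptional. That event constrains
  each column separately, so \<open>emeasure_columns\<close> applies.\<close>

lemma nn_integral_row_bound:
  assumes m: "m \<ge> 2" and n: "n \<ge> 1" and e: "0 \<le> e"
  shows "(\<integral>\<^sup>+x. indicator (product_simplex m n) x * ennreal (row_bound m n e x) \<partial>x_space m n)
    \<le> ennreal ((1 / fact (m - 1)) ^ n * row_err m e)"
proof -
  define C where "C = (1 / fact (m - 1) :: real) ^ n"
  define p where "p = measure (col_dist m) (large_coord m e)"
  let ?D = "product_simplex m n"
  let ?S = "\<lambda>j j'. if j' = j then large_coord m e else col_simplex m"
  let ?B = "\<lambda>j. {x \<in> space (x_space m n). \<forall>j'\<in>{1..n}. col m x j' \<in> ?S j j'}"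
  have C0: "0 \<le> C" and p0: "0 \<le> p" by (auto simp: C_def p_def)
  have sub: "large_coord m e \<subseteq> col_simplex m" by (auto simp: large_coord_def)
  have D: "?D \<in> sets (x_space m n)" by (rule columns_set_measurable) simp
  have B: "?B j \<in> sets (x_space m n)" for j by (rule columns_set_measurable) simp
  have EB: "emeasure (x_space m n) (?B j) = ennreal (C * p)" if j: "j \<in> {1..n}" for j
  proof -
    have "emeasure (x_space m n) (?B j) = (\<Prod>j'\<in>{1..n}. emeasure (col_space m) (?S j j'))"
      by (rule emeasure_columns) simp
    also have "\<dots> = emeasure (col_space m) (large_coord m e) * (\<Prod>j'\<in>{1..n} - {j}. emeasure (col_space m) (?S j j'))"
      using j by (subst prod.remove[of _ j]) auto
    also have "(\<Prod>j'\<in>{1..n} - {j}. emeasure (col_space m) (?S j j')) = (\<Prod>j'\<in>{1..n} - {j}. ennreal (1 / fact (m - 1)))"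
      by (intro prod.cong) (auto simp: emeasure_col_simplex[OF m])
    also have "\<dots> = ennreal ((1 / fact (m - 1)) ^ (n - 1))" using j by (simp add: ennreal_power)
    also have "emeasure (col_space m) (large_coord m e) = ennreal (p / fact (m - 1))"
      unfolding p_def by (rule emeasure_col_space_eq[OF m large_coord_measurable sub])
    also have "ennreal (p / fact (m - 1)) * ennreal ((1 / fact (m - 1)) ^ (n - 1)) = ennreal (C * p)"
    proof -
      have "C = (1 / fact (m - 1)) * (1 / fact (m - 1)) ^ (n - 1)"
        unfolding C_def using n by (metis Suc_diff_1 less_eq_Suc_le One_nat_def power_Suc)
      then show ?thesis using p0 by (simp add: ennreal_mult[symmetric])
    qed
    finally show ?thesis .
  qed
  have "(\<integral>\<^sup>+x. indicator ?D x * ennreal (row_bound m n e x) \<partial>x_space m n)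
    = (\<integral>\<^sup>+x. ennreal e * indicator ?D x + ennreal (1 / real n) * (\<Sum>j\<in>{1..n}. indicator (?B j) x) \<partial>x_space m n)"
  proof (rule nn_integral_cong)
    fix x assume x: "x \<in> space (x_space m n)"
    show "indicator ?D x * ennreal (row_bound m n e x)
      = ennreal e * indicator ?D x + ennreal (1 / real n) * (\<Sum>j\<in>{1..n}. indicator (?B j) x)"
    proof (cases "x \<in> ?D")
      case True
      have ind: "indicator (?B j) x = ennreal (indicator (large_coord m e) (col m x j))" if "j \<in> {1..n}" for j
        using True that by (auto simp: indicator_def)
      have "(\<Sum>j\<in>{1..n}. indicator (?B j) x) = ennreal (\<Sum>j\<in>{1..n}. indicator (large_coord m e) (col m x j))"
      proof -
        have "(\<Sum>j\<in>{1..n}. indicator (?B j) x) = (\<Sum>j\<in>{1..n}. ennreal (indicator (large_coord m e) (col m x j)))"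
          by (intro sum.cong refl ind)
        also have "\<dots> = ennreal (\<Sum>j\<in>{1..n}. indicator (large_coord m e) (col m x j))"
          by (rule sum_ennreal) simp
        finally show ?thesis .
      qed
      then show ?thesis using True e n
        by (simp add: row_bound_def ennreal_plus ennreal_mult[symmetric] sum_nonneg)
    next
      case False
      have "x \<notin> ?B j" if "j \<in> {1..n}" for j
        using False sub that x by (auto split: if_splits)
      then have "(\<Sum>j\<in>{1..n}. indicator (?B j) x) = (0 :: ennreal)" by (intro sum.neutral) auto
      then show ?thesis using False by simp
    qed
  qed
  also have "\<dots> = ennreal e * ennreal C + ennreal (1 / real n) * (\<Sum>j\<in>{1..n}. ennreal (C * p))"
  proof -
    have "(\<integral>\<^sup>+x. ennreal e * indicator ?D x + ennreal (1 / real n) * (\<Sum>j\<in>{1..n}. indicator (?B j) x) \<partial>x_space m n)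
      = (\<integral>\<^sup>+x. ennreal e * indicator ?D x \<partial>x_space m n)
        + (\<integral>\<^sup>+x. ennreal (1 / real n) * (\<Sum>j\<in>{1..n}. indicator (?B j) x) \<partial>x_space m n)"
      using D B by (intro nn_integral_add borel_measurable_times_ennreal borel_measurable_sum borel_measurable_indicator borel_measurable_const)
    also have "(\<integral>\<^sup>+x. ennreal e * indicator ?D x \<partial>x_space m n) = ennreal e * ennreal C"
      using D by (simp only: nn_integral_cmult_indicator emeasure_product_simplex[OF m] C_def)
    also have "(\<integral>\<^sup>+x. ennreal (1 / real n) * (\<Sum>j\<in>{1..n}. indicator (?B j) x) \<partial>x_space m n)
      = ennreal (1 / real n) * (\<integral>\<^sup>+x. (\<Sum>j\<in>{1..n}. indicator (?B j) x) \<partial>x_space m n)"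
      using B by (intro nn_integral_cmult borel_measurable_sum borel_measurable_indicator)
    also have "(\<integral>\<^sup>+x. (\<Sum>j\<in>{1..n}. indicator (?B j) x) \<partial>x_space m n)
      = (\<Sum>j\<in>{1..n}. \<integral>\<^sup>+x. indicator (?B j) x \<partial>x_space m n)"
      using B by (intro nn_integral_sum borel_measurable_indicator)
    also have "\<dots> = (\<Sum>j\<in>{1..n}. ennreal (C * p))"
      using B by (intro sum.cong refl) (simp only: nn_integral_indicator EB)
    finally show ?thesis .
  qed
  also have "\<dots> = ennreal (C * (e + p))"
    using n e C0 p0
    by (subst sum_ennreal) (auto simp: ennreal_mult[symmetric] ennreal_plus[symmetric] algebra_simps simp del: ennreal_plus)
  also have "\<dots> \<le> ennreal (C * row_err m e)"
    unfolding row_err_def p_def using measure_large_coord[OF m e] C0 by (intro ennreal_leI mult_left_mono) auto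
  finally show ?thesis unfolding C_def .
qed

text \<open>A uniform point of \<open>[s, 1]\<close> is stochastically larger than one of
  \<open>[0, 1]\<close>, which bounds the share below \<open>t\<close>; above \<open>t\<close> there
  is no more room than in \<open>[0, 1]\<close>. Clamping \<open>t\<close> to \<open>[0, 1]\<close>
  covers all real \<open>t\<close>.\<close>

lemma emeasure_lborel_slab_le:
  fixes s t :: real
  assumes "0 \<le> s" "s \<le> 1"
  shows "emeasure lborel ({s..1} \<inter> {..t}) \<le> ennreal (min 1 (max 0 t)) * emeasure lborel {s..1}"
    and "emeasure lborel ({s..1} \<inter> {t<..}) \<le> ennreal (1 - min 1 (max 0 t))"
proof -
  have eq: "{s..1} \<inter> {..t} = {s..min 1 t}" by auto
  have *: "min 1 t - s \<le> min 1 (max 0 t) * (1 - s)"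
  proof -
    have "s * min 1 (max 0 t) \<le> s" using assms by (intro mult_left_le) auto
    then show ?thesis by (simp add: algebra_simps min_def max_def split: if_splits)
  qed
  have "emeasure lborel {s..min 1 t} \<le> ennreal (min 1 (max 0 t) * (1 - s))"
    using * assms by (cases "s \<le> min 1 t") (auto intro!: ennreal_leI)
  then show "emeasure lborel ({s..1} \<inter> {..t}) \<le> ennreal (min 1 (max 0 t)) * emeasure lborel {s..1}"
    unfolding eq using assms by (simp add: ennreal_mult)
  have "{s..1} \<inter> {t<..} \<subseteq> {min 1 (max 0 t)..1}" using assms by auto
  then have "emeasure lborel ({s..1} \<inter> {t<..}) \<le> emeasure lborel {min 1 (max 0 t)..1}"
    by (intro emeasure_mono) auto
  then show "emeasure lborel ({s..1} \<inter> {t<..}) \<le> ennreal (1 - min 1 (max 0 t))" by simp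
qed

lemma row_bound_nonneg: "0 \<le> e \<Longrightarrow> 0 \<le> row_bound m n e x"
  by (simp add: row_bound_def sum_nonneg)

lemma measurable_row_bound: "(\<lambda>x. row_bound m n e x) \<in> borel_measurable (x_space m n)"
proof -
  have "(\<lambda>x. indicator (large_coord m e) (col m x j) :: real) \<in> borel_measurable (x_space m n)" if "j \<in> {1..n}" for j
    by (rule measurable_compose[OF measurable_col[OF that] borel_measurable_indicator[OF large_coord_measurable]])
  then show ?thesis
    unfolding row_bound_def
    by (intro borel_measurable_add borel_measurable_const borel_measurable_divide borel_measurable_sum)
qed

section \<open>Volumes of weak slabs\<close>

context
  fixes m n i :: nat
  assumes m: "m \<ge> 2" and n: "n \<ge> 1" and i: "i \<in> {1..m}"
begin

lemma weak_slab_UNIV: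
  "emeasure (vol_measure m n) (weak_slab m n i UNIV)
    = (\<integral>\<^sup>+x. indicator (product_simplex m n) x * ennreal (\<Prod>l\<in>{1..m}. 1 - row_avg m n x l) \<partial>x_space m n)"
  unfolding weak_slab_measure(2)[OF m n i sets.top[of borel, unfolded space_borel]]
proof (rule nn_integral_cong)
  fix x
  show "indicator (product_simplex m n) x * (\<Prod>l\<in>{1..m}. emeasure lborel ({row_avg m n x l..1} \<inter> (if l = i then UNIV else UNIV)))
    = indicator (product_simplex m n) x * ennreal (\<Prod>l\<in>{1..m}. 1 - row_avg m n x l)"
  proof (cases "x \<in> product_simplex m n")
    case True
    have "(\<Prod>l\<in>{1..m}. emeasure lborel ({row_avg m n x l..1} \<inter> (if l = i then UNIV else UNIV)))
      = (\<Prod>l\<in>{1..m}. ennreal (1 - row_avg m n x l))"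
      using row_avg_le_1[OF m n order_refl True] by (intro prod.cong) auto
    also have "\<dots> = ennreal (\<Prod>l\<in>{1..m}. 1 - row_avg m n x l)"
      using row_avg_le_1[OF m n order_refl True] by (intro prod_ennreal) auto
    finally show ?thesis by simp
  next
    case False
      have z: "indicator (product_simplex m n) x = (0 :: ennreal)" using False by (rule indicator_simps(2))
      show ?thesis unfolding z by simp
  qed
qed

lemma product_simplex_measurable: "product_simplex m n \<in> sets (x_space m n)"
  by (rule columns_set_measurable) simp

lemma weak_slab_UNIV_le:
  "emeasure (vol_measure m n) (weak_slab m n i UNIV) \<le> ennreal ((1 / fact (m - 1)) ^ n * exp (-1))"
proof -
  have "emeasure (vol_measure m n) (weak_slab m n i UNIV)
    \<le> (\<integral>\<^sup>+x. ennreal (exp (-1)) * indicator (product_simplex m n) x \<partial>x_space m n)"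
    unfolding weak_slab_UNIV
  proof (rule nn_integral_mono)
    fix x
    show "indicator (product_simplex m n) x * ennreal (\<Prod>l\<in>{1..m}. 1 - row_avg m n x l)
      \<le> ennreal (exp (-1)) * indicator (product_simplex m n) x"
    proof (cases "x \<in> product_simplex m n")
      case True
      then show ?thesis
        using ennreal_leI[OF prod_row_avg_le[OF m n order_refl True]]
        by (simp only: indicator_simps mult_1 mult_1_right)
    next
      case False
      have z: "indicator (product_simplex m n) x = (0 :: ennreal)" using False by (rule indicator_simps(2))
      show ?thesis unfolding z by simp
    qed
  qed
  also have "\<dots> = ennreal (exp (-1)) * ennreal ((1 / fact (m - 1)) ^ n)"
    using product_simplex_measurable by (simp only: nn_integral_cmult_indicator emeasure_product_simplex[OF m])
  finally show ?thesis by (simp add: ennreal_mult[symmetric] mult.commute)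
qed

text \<open>Integrates \<open>prod_row_avg_ge\<close> over the product of simplices, with the error
  on the right so that no subtraction in \<open>ennreal\<close> occurs;
  \<open>nn_integral_row_bound\<close> turns \<open>row_bound\<close> into
  \<open>row_err\<close>.\<close>

lemma weak_slab_UNIV_ge:
  assumes e: "0 \<le> e"
  shows "ennreal ((1 / fact (m - 1)) ^ n * exp (-1))
    \<le> emeasure (vol_measure m n) (weak_slab m n i UNIV) + ennreal ((1 / fact (m - 1)) ^ n * exp (-1) * row_err m e)"
proof -
  let ?D = "product_simplex m n"
  have rb: "0 \<le> row_bound m n e x" for x by (rule row_bound_nonneg[OF e])
  note [measurable] = product_simplex_measurable measurable_row_bound
  have "ennreal ((1 / fact (m - 1)) ^ n * exp (-1)) = ennreal (exp (-1)) * emeasure (x_space m n) ?D"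
    by (simp only: emeasure_product_simplex[OF m]) (simp add: ennreal_mult[symmetric] mult.commute)
  also have "\<dots> = (\<integral>\<^sup>+x. ennreal (exp (-1)) * indicator ?D x \<partial>x_space m n)"
    by (rule nn_integral_cmult_indicator[symmetric, OF product_simplex_measurable])
  also have "\<dots> \<le> (\<integral>\<^sup>+x. indicator ?D x * ennreal (\<Prod>l\<in>{1..m}. 1 - row_avg m n x l)
      + ennreal (exp (-1)) * (indicator ?D x * ennreal (row_bound m n e x)) \<partial>x_space m n)"
  proof (rule nn_integral_mono)
    fix x
    show "ennreal (exp (-1)) * indicator ?D x \<le> indicator ?D x * ennreal (\<Prod>l\<in>{1..m}. 1 - row_avg m n x l)
      + ennreal (exp (-1)) * (indicator ?D x * ennreal (row_bound m n e x))"
    proof (cases "x \<in> ?D")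
      case True
      have "0 \<le> (\<Prod>l\<in>{1..m}. 1 - row_avg m n x l)"
        using row_avg_le_1[OF m n order_refl True] by (intro prod_nonneg) auto
      then have "ennreal (\<Prod>l\<in>{1..m}. 1 - row_avg m n x l) + ennreal (exp (-1)) * ennreal (row_bound m n e x)
        = ennreal ((\<Prod>l\<in>{1..m}. 1 - row_avg m n x l) + exp (-1) * row_bound m n e x)"
        using rb[of x] by (simp only: ennreal_mult[symmetric] ennreal_plus exp_ge_zero mult_nonneg_nonneg)
      moreover have "exp (-1) \<le> (\<Prod>l\<in>{1..m}. 1 - row_avg m n x l) + exp (-1) * row_bound m n e x"
        using prod_row_avg_ge[OF m n e True] by (simp add: algebra_simps)
      ultimately show ?thesis
        using True by (simp only: indicator_simps mult_1 mult_1_right ennreal_leI)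
    next
      case False
      have z: "indicator (product_simplex m n) x = (0 :: ennreal)" using False by (rule indicator_simps(2))
      show ?thesis unfolding z by simp
    qed
  qed
  also have "\<dots> = emeasure (vol_measure m n) (weak_slab m n i UNIV)
      + ennreal (exp (-1)) * (\<integral>\<^sup>+x. indicator ?D x * ennreal (row_bound m n e x) \<partial>x_space m n)"
    unfolding weak_slab_UNIV
    by (subst nn_integral_add, measurable, subst nn_integral_cmult, measurable)
  also have "\<dots> \<le> emeasure (vol_measure m n) (weak_slab m n i UNIV)
      + ennreal (exp (-1)) * ennreal ((1 / fact (m - 1)) ^ n * row_err m e)"
    by (intro add_left_mono mult_left_mono nn_integral_row_bound[OF m n e]) auto
  finally show ?thesis
    by (simp add: ennreal_mult'[symmetric] mult_ac)
qed

lemma slab_prod_remove: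
  assumes "x \<in> product_simplex m n"
  shows "(\<Prod>l\<in>{1..m}. emeasure lborel ({row_avg m n x l..1} \<inter> (if l = i then B else UNIV)))
    = emeasure lborel ({row_avg m n x i..1} \<inter> B) * ennreal (\<Prod>l\<in>{1..m} - {i}. 1 - row_avg m n x l)"
proof -
  have "(\<Prod>l\<in>{1..m} - {i}. emeasure lborel ({row_avg m n x l..1} \<inter> (if l = i then B else UNIV)))
    = (\<Prod>l\<in>{1..m} - {i}. ennreal (1 - row_avg m n x l))"
    using row_avg_le_1[OF m n order_refl assms] by (intro prod.cong) auto
  also have "\<dots> = ennreal (\<Prod>l\<in>{1..m} - {i}. 1 - row_avg m n x l)"
    using row_avg_le_1[OF m n order_refl assms] by (intro prod_ennreal) auto
  finally show ?thesis
    using i by (subst prod.remove[of _ i]) auto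
qed

text \<open>The first bound of \<open>emeasure_lborel_slab_le\<close> holds for each
  \<open>x\<close> and keeps the factor of row \<open>i\<close> intact, so it integrates without an
  error term.\<close>

lemma weak_slab_atMost_le:
  "emeasure (vol_measure m n) (weak_slab m n i {..t})
    \<le> ennreal (min 1 (max 0 t)) * emeasure (vol_measure m n) (weak_slab m n i UNIV)"
proof -
  let ?D = "product_simplex m n" and ?P = "\<lambda>x. \<Prod>l\<in>{1..m}. 1 - row_avg m n x l"
  note [measurable] = product_simplex_measurable
  have B: "{..t} \<in> sets borel" by simp
  have "emeasure (vol_measure m n) (weak_slab m n i {..t})
    \<le> (\<integral>\<^sup>+x. ennreal (min 1 (max 0 t)) * (indicator ?D x * ennreal (?P x)) \<partial>x_space m n)"
    unfolding weak_slab_measure(2)[OF m n i B]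
  proof (rule nn_integral_mono)
    fix x
    show "indicator ?D x * (\<Prod>l\<in>{1..m}. emeasure lborel ({row_avg m n x l..1} \<inter> (if l = i then {..t} else UNIV)))
      \<le> ennreal (min 1 (max 0 t)) * (indicator ?D x * ennreal (?P x))"
    proof (cases "x \<in> ?D")
      case True
      let ?R = "\<Prod>l\<in>{1..m} - {i}. 1 - row_avg m n x l"
      have R0: "0 \<le> ?R" using row_avg_le_1[OF m n order_refl True] by (intro prod_nonneg) auto
      have s: "0 \<le> row_avg m n x i" "row_avg m n x i \<le> 1"
        using row_avg_nonneg[OF m n order_refl True i] row_avg_le_1[OF m n order_refl True i] by auto
      have P: "?P x = (1 - row_avg m n x i) * ?R" using i by (subst prod.remove[of _ i]) auto
      have "emeasure lborel ({row_avg m n x i..1} \<inter> {..t}) * ennreal ?R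
        \<le> ennreal (min 1 (max 0 t)) * emeasure lborel {row_avg m n x i..1} * ennreal ?R"
        by (intro mult_right_mono emeasure_lborel_slab_le(1) s) simp
      also have "\<dots> = ennreal (min 1 (max 0 t)) * ennreal (?P x)"
        unfolding P using s R0 by (simp add: ennreal_mult mult.assoc)
      finally show ?thesis unfolding slab_prod_remove[OF True] using True by (simp only: indicator_simps mult_1)
    next
      case False
      have z: "indicator (product_simplex m n) x = (0 :: ennreal)" using False by (rule indicator_simps(2))
      show ?thesis unfolding z by simp
    qed
  qed
  also have "\<dots> = ennreal (min 1 (max 0 t)) * emeasure (vol_measure m n) (weak_slab m n i UNIV)"
    unfolding weak_slab_UNIV by (rule nn_integral_cmult) measurable
  finally show ?thesis .
qed

text \<open>Bounding the interval for \<open>y i\<close> by the part of \<open>[0, 1]\<close> above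
  \<open>t\<close> loses the factor \<open>1 - row_avg m n x i\<close>. The product over the other
  rows is controlled by \<open>prod_row_avg_remove_le\<close>, hence the factor
  \<open>1 + 2 * row_err m e\<close>.\<close>

lemma weak_slab_greaterThan_le:
  assumes e: "0 \<le> e"
  shows "emeasure (vol_measure m n) (weak_slab m n i {t<..})
    \<le> ennreal ((1 - min 1 (max 0 t)) * ((1 / fact (m - 1)) ^ n * exp (-1) * (1 + 2 * row_err m e)))"
proof -
  let ?D = "product_simplex m n" and ?t = "1 - min 1 (max 0 t)"
  note [measurable] = product_simplex_measurable measurable_row_bound
  define C where "C = (1 / fact (m - 1) :: real) ^ n"
  have C0: "0 \<le> C" and err0: "0 \<le> row_err m e" using e by (auto simp: C_def row_err_def)
  have t0: "0 \<le> ?t" by simp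
  have B: "{t<..} \<in> sets borel" by simp
  have "emeasure (vol_measure m n) (weak_slab m n i {t<..})
    \<le> (\<integral>\<^sup>+x. ennreal (?t * exp (-1)) * (indicator ?D x + 2 * (indicator ?D x * ennreal (row_bound m n e x))) \<partial>x_space m n)"
    unfolding weak_slab_measure(2)[OF m n i B]
  proof (rule nn_integral_mono)
    fix x
    show "indicator ?D x * (\<Prod>l\<in>{1..m}. emeasure lborel ({row_avg m n x l..1} \<inter> (if l = i then {t<..} else UNIV)))
      \<le> ennreal (?t * exp (-1)) * (indicator ?D x + 2 * (indicator ?D x * ennreal (row_bound m n e x)))"
    proof (cases "x \<in> ?D")
      case True
      let ?R = "\<Prod>l\<in>{1..m} - {i}. 1 - row_avg m n x l"
      have s: "0 \<le> row_avg m n x i" "row_avg m n x i \<le> 1"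
        using row_avg_nonneg[OF m n order_refl True i] row_avg_le_1[OF m n order_refl True i] by auto
      have "emeasure lborel ({row_avg m n x i..1} \<inter> {t<..}) * ennreal ?R
        \<le> ennreal ?t * ennreal (exp (-1) * (1 + 2 * row_bound m n e x))"
        by (intro mult_mono emeasure_lborel_slab_le(2) s ennreal_leI prod_row_avg_remove_le[OF m n e True i]) auto
      also have "\<dots> = ennreal (?t * exp (-1)) * (1 + 2 * ennreal (row_bound m n e x))"
        using t0 row_bound_nonneg[OF e, of m n x]
        by (simp add: ennreal_mult ennreal_plus mult.assoc)
      finally show ?thesis unfolding slab_prod_remove[OF True] using True by (simp only: indicator_simps mult_1)
    next
      case False
      have z: "indicator (product_simplex m n) x = (0 :: ennreal)" using False by (rule indicator_simps(2))
      show ?thesis unfolding z by simp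
    qed
  qed
  also have "\<dots> = ennreal (?t * exp (-1)) * (emeasure (x_space m n) ?D
      + 2 * (\<integral>\<^sup>+x. indicator ?D x * ennreal (row_bound m n e x) \<partial>x_space m n))"
    by (subst nn_integral_cmult, measurable, subst nn_integral_add, measurable, subst nn_integral_cmult, measurable)
       (simp only: nn_integral_indicator product_simplex_measurable)
  also have "\<dots> \<le> ennreal (?t * exp (-1)) * (ennreal C + 2 * ennreal (C * row_err m e))"
    unfolding emeasure_product_simplex[OF m] C_def
    by (intro add_left_mono mult_left_mono nn_integral_row_bound[OF m n e]) auto
  also have "\<dots> = ennreal (?t * exp (-1) * (C + 2 * (C * row_err m e)))"
    using t0 C0 err0 by (simp add: ennreal_mult ennreal_plus)
  finally show ?thesis by (simp add: C_def algebra_simps)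
qed

end

section \<open>Asymptotics\<close>

text \<open>The exponent for \<open>power_le_prod_power\<close> at \<open>d = 1 / sqrt n\<close>.
  This \<open>d\<close> tends to 0, so the exponent is asymptotic to \<open>n\<close>, while
  \<open>d * n\<close> is \<open>sqrt n\<close> and the errors are exponentially small in
  it.\<close>

definition lower_exponent :: "nat \<Rightarrow> nat" where
  "lower_exponent n = nat \<lfloor>(1 - 3 / sqrt (real n)) * real n\<rfloor>"

text \<open>The exponent for \<open>prod_power_le_power\<close> at the same
  \<open>d\<close>.\<close>

definition upper_exponent :: "nat \<Rightarrow> nat" where
  "upper_exponent n = nat \<lceil>(1 + 2 / sqrt (real n)) * real n\<rceil>"

text \<open>From \<open>n = 9\<close> on \<open>3 / sqrt n\<close> is at most 1, so the number under
  the floor is nonnegative and \<open>nat\<close> does not raise it.\<close>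

lemma lower_exponent_le:
  assumes "n \<ge> 9"
  shows "real (lower_exponent n) \<le> (1 - 3 * (1 / sqrt (real n))) * real n"
proof -
  have "3 \<le> sqrt (real n)" using assms by (intro real_le_rsqrt) auto
  then have "0 \<le> (1 - 3 / sqrt (real n)) * real n" using assms by (intro mult_nonneg_nonneg) (auto simp: divide_le_eq)
  then show ?thesis unfolding lower_exponent_def by simp
qed

lemma upper_exponent_ge: "(1 + 2 * (1 / sqrt (real n))) * real n \<le> real (upper_exponent n)"
  unfolding upper_exponent_def by (simp add: real_nat_ceiling_ge)

lemma lower_exponent_ratio: "(\<lambda>n. real (lower_exponent n) / real n) \<longlonglongrightarrow> 1"
proof -
  have ge: "(1 - 3 / sqrt (real n)) * real n - 1 \<le> real (lower_exponent n)" for n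
    unfolding lower_exponent_def by linarith
  show ?thesis
  proof (rule tendsto_sandwich)
    show "\<forall>\<^sub>F n in sequentially. ((1 - 3 / sqrt (real n)) * real n - 1) / real n \<le> real (lower_exponent n) / real n"
      by (intro always_eventually allI divide_right_mono ge) auto
    show "\<forall>\<^sub>F n in sequentially. real (lower_exponent n) / real n \<le> ((1 - 3 * (1 / sqrt (real n))) * real n) / real n"
      using eventually_ge_at_top[of 9] by eventually_elim (intro divide_right_mono lower_exponent_le, auto)
    show "(\<lambda>n. ((1 - 3 / sqrt (real n)) * real n - 1) / real n) \<longlonglongrightarrow> 1" by real_asymp
    show "(\<lambda>n. ((1 - 3 * (1 / sqrt (real n))) * real n) / real n) \<longlonglongrightarrow> 1" by real_asymp
  qed
qed

lemma upper_exponent_ratio: "(\<lambda>n. real (upper_exponent n) / real n) \<longlonglongrightarrow> 1"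
proof -
  have le: "real (upper_exponent n) \<le> (1 + 2 / sqrt (real n)) * real n + 1" for n
  proof -
    have "0 \<le> (1 + 2 / sqrt (real n)) * real n" by simp
    then show ?thesis unfolding upper_exponent_def by linarith
  qed
  show ?thesis
  proof (rule tendsto_sandwich)
    show "\<forall>\<^sub>F n in sequentially. real (upper_exponent n) / real n \<le> ((1 + 2 / sqrt (real n)) * real n + 1) / real n"
      by (intro always_eventually allI divide_right_mono le) auto
    show "\<forall>\<^sub>F n in sequentially. ((1 + 2 * (1 / sqrt (real n))) * real n) / real n \<le> real (upper_exponent n) / real n"
      by (intro always_eventually allI divide_right_mono upper_exponent_ge) auto
    show "(\<lambda>n. ((1 + 2 / sqrt (real n)) * real n + 1) / real n) \<longlonglongrightarrow> 1" by real_asymp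
    show "(\<lambda>n. ((1 + 2 * (1 / sqrt (real n))) * real n) / real n) \<longlonglongrightarrow> 1" by real_asymp
  qed
qed

text \<open>The difference is \<open>- (harm N - ln N) - ln (N / n)\<close>. The bracket tends to
  Euler's constant, since \<open>N\<close> tends to infinity with \<open>n\<close>, and the last
  term to 0.\<close>

lemma harm_asymp:
  fixes N n :: "nat \<Rightarrow> nat"
  assumes n: "filterlim n at_top sequentially" and r: "(\<lambda>k. real (N k) / real (n k)) \<longlonglongrightarrow> 1"
  shows "(\<lambda>k. ln (real (n k)) - harm (N k)) \<longlonglongrightarrow> - euler_mascheroni"
proof -
  have nr: "filterlim (\<lambda>k. real (n k)) at_top sequentially"
    by (rule filterlim_compose[OF filterlim_real_sequentially n])
  have n0: "\<forall>\<^sub>F k in sequentially. 0 < n k"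
    by (rule eventually_compose_filterlim[OF eventually_gt_at_top n])
  have "filterlim (\<lambda>k. (real (N k) / real (n k)) * real (n k)) at_top sequentially"
    by (rule filterlim_tendsto_pos_mult_at_top[OF r _ nr]) simp
  then have "filterlim (\<lambda>k. real (N k)) at_top sequentially"
    by (rule filterlim_mono_eventually[OF _ order_refl order_refl])
       (use n0 in eventually_elim, auto)
  then have N: "filterlim N at_top sequentially"
    by (simp add: filterlim_sequentially_iff_filterlim_real)
  have N0: "\<forall>\<^sub>F k in sequentially. 0 < N k"
    by (rule eventually_compose_filterlim[OF eventually_gt_at_top N])
  have "(\<lambda>k. harm (N k) - ln (real (N k)) :: real) \<longlonglongrightarrow> euler_mascheroni"
    by (rule filterlim_compose[OF euler_mascheroni_LIMSEQ N])
  moreover have "(\<lambda>k. ln (real (N k) / real (n k))) \<longlonglongrightarrow> ln 1"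
    by (intro tendsto_ln r) simp
  ultimately have "(\<lambda>k. - (harm (N k) - ln (real (N k))) - ln (real (N k) / real (n k))) \<longlonglongrightarrow> - euler_mascheroni - ln 1"
    by (intro tendsto_diff tendsto_minus)
  moreover have "\<forall>\<^sub>F k in sequentially. - (harm (N k) - ln (real (N k))) - ln (real (N k) / real (n k))
      = ln (real (n k)) - harm (N k)"
    using n0 N0 by eventually_elim (simp add: ln_div)
  ultimately have "(\<lambda>k. ln (real (n k)) - harm (N k)) \<longlonglongrightarrow> - euler_mascheroni - ln 1"
    by (rule Lim_transform_eventually)
  then show ?thesis by simp
qed

section \<open>Kernel integrals along a sequence of pairs\<close>

locale regime =
  fixes m n :: "nat \<Rightarrow> nat"
  assumes m2: "\<And>k. m k \<ge> 2" and n1: "\<And>k. n k \<ge> 1"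
    and m_lim: "filterlim m at_top sequentially" and n_lim: "filterlim n at_top sequentially"
begin

text \<open>The limit of \<open>a k * ln (real (n k))\<close> is \<tau>.\<close>

definition a :: "nat \<Rightarrow> real" where "a k = 1 / (real (m k) - 1)"

text \<open>This is \<open>n\<close> to the power \<open>1 + 1 / (m - 1)\<close>, the reciprocal of
  the order of the strong volume relative to the product of simplices.\<close>

definition weight :: "nat \<Rightarrow> real" where "weight k = real (n k) * exp (a k * ln (real (n k)))"

lemma a_eq: "a k = 1 / real (m k - 1)"
  using m2[of k] by (simp add: a_def)

lemma m_pred_pos: "m k - 1 > 0"
  using m2[of k] by simp

lemma a_lim: "a \<longlonglongrightarrow> 0"
proof -
  have "(\<lambda>j::nat. 1 / (real j - 1)) \<longlonglongrightarrow> 0" by real_asymp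
  from filterlim_compose[OF this m_lim] show ?thesis by (simp add: a_def[abs_def])
qed

lemma weight_eq: "weight k = exp ((1 + a k) * ln (real (n k)))"
  using n1[of k] by (simp add: weight_def exp_add distrib_right)

lemma weight_pos: "0 < weight k"
  by (simp add: weight_eq)

lemma weight_le: "weight k \<le> real (n k) ^ 2"
proof -
  have "a k \<le> 1" using m2[of k] by (simp add: a_def)
  then have "(1 + a k) * ln (real (n k)) \<le> 2 * ln (real (n k))"
    using n1[of k] by (intro mult_right_mono) auto
  then have "weight k \<le> exp (2 * ln (real (n k)))" by (simp add: weight_eq)
  also have "\<dots> = real (n k) ^ 2" using n1[of k] by (simp add: exp_double)
  finally show ?thesis .
qed

text \<open>\<open>weight k\<close> is at most \<open>n^2\<close> whatever \<open>m\<close> is, so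
  an error that beats \<open>n^2\<close> as a function of \<open>n\<close> alone vanishes along
  every sequence of pairs.\<close>

lemma weight_small:
  assumes "(\<lambda>j::nat. real j ^ 2 * f j) \<longlonglongrightarrow> 0" and "\<And>j. 0 \<le> f j"
  shows "(\<lambda>k. weight k * f (n k)) \<longlonglongrightarrow> 0"
proof (rule tendsto_sandwich)
  show "\<forall>\<^sub>F k in sequentially. 0 \<le> weight k * f (n k)"
    using assms(2) weight_pos by (simp add: less_imp_le)
  show "\<forall>\<^sub>F k in sequentially. weight k * f (n k) \<le> real (n k) ^ 2 * f (n k)"
    using assms(2) weight_le by (intro always_eventually allI mult_right_mono)
  show "(\<lambda>k. real (n k) ^ 2 * f (n k)) \<longlonglongrightarrow> 0" by (rule filterlim_compose[OF assms(1) n_lim])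
qed simp

lemma err_upper: "(\<lambda>k. weight k * (1 / (1 + 1 / sqrt (real (n k)))) ^ n k) \<longlonglongrightarrow> 0"
proof (rule weight_small)
  show "(\<lambda>j::nat. real j ^ 2 * (1 / (1 + 1 / sqrt (real j))) ^ j) \<longlonglongrightarrow> 0" by real_asymp
qed simp

lemma err_lower: "(\<lambda>k. weight k * exp (- (1 / sqrt (real (n k)) * real (n k)))) \<longlonglongrightarrow> 0"
proof (rule weight_small)
  show "(\<lambda>j::nat. real j ^ 2 * exp (- (1 / sqrt (real j) * real j))) \<longlonglongrightarrow> 0" by real_asymp
qed simp

context
  fixes N :: "nat \<Rightarrow> nat"
  assumes ratio: "(\<lambda>k. real (N k) / real (n k)) \<longlonglongrightarrow> 1"
begin

lemma kernel_exponents: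
  "- harm (N k) / real (m k - 1) = - (a k * harm (N k))" "2 / (real (m k - 1))\<^sup>2 = 2 * a k * a k"
  by (simp_all add: a_eq power2_eq_square)

text \<open>\<open>kernel_int_bounds\<close> encloses the product between exponentials of
  \<open>a * (ln n - harm N)\<close> and of the same plus \<open>2 * a^2\<close>; the bracket
  converges and \<open>a\<close> tends to 0.\<close>

lemma kernel_int_scaled: "(\<lambda>k. kernel_int (m k - 1) (N k) * exp (a k * ln (real (n k)))) \<longlonglongrightarrow> 1"
proof (rule tendsto_sandwich)
  let ?u = "\<lambda>k. a k * (ln (real (n k)) - harm (N k))"
  have u: "?u \<longlonglongrightarrow> 0"
    using tendsto_mult[OF a_lim harm_asymp[OF n_lim ratio]] by simp
  show "(\<lambda>k. exp (?u k)) \<longlonglongrightarrow> 1" using tendsto_exp[OF u] by simp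
  have "(\<lambda>k. ?u k + 2 * (a k)\<^sup>2) \<longlonglongrightarrow> 0 + 2 * 0\<^sup>2" by (intro tendsto_intros u a_lim)
  then show "(\<lambda>k. exp (?u k + 2 * (a k)\<^sup>2)) \<longlonglongrightarrow> 1" using tendsto_exp by fastforce
  have "exp (?u k) \<le> kernel_int (m k - 1) (N k) * exp (a k * ln (real (n k)))" for k
  proof -
    have "exp (?u k) = exp (- harm (N k) / real (m k - 1)) * exp (a k * ln (real (n k)))"
      unfolding kernel_exponents by (simp add: exp_add[symmetric] algebra_simps)
    also have "\<dots> \<le> kernel_int (m k - 1) (N k) * exp (a k * ln (real (n k)))"
      by (intro mult_right_mono kernel_int_bounds m_pred_pos) auto
    finally show ?thesis .
  qed
  then show "\<forall>\<^sub>F k in sequentially. exp (?u k) \<le> kernel_int (m k - 1) (N k) * exp (a k * ln (real (n k)))" by simp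
  have "kernel_int (m k - 1) (N k) * exp (a k * ln (real (n k))) \<le> exp (?u k + 2 * (a k)\<^sup>2)" for k
  proof -
    have "kernel_int (m k - 1) (N k) * exp (a k * ln (real (n k)))
      \<le> exp (- harm (N k) / real (m k - 1) + 2 / (real (m k - 1))\<^sup>2) * exp (a k * ln (real (n k)))"
      by (intro mult_right_mono kernel_int_bounds m_pred_pos) auto
    also have "\<dots> = exp (?u k + 2 * (a k)\<^sup>2)"
      unfolding kernel_exponents by (simp add: exp_add[symmetric] algebra_simps power2_eq_square)
    finally show ?thesis .
  qed
  then show "\<forall>\<^sub>F k in sequentially. kernel_int (m k - 1) (N k) * exp (a k * ln (real (n k))) \<le> exp (?u k + 2 * (a k)\<^sup>2)" by simp
qed

text \<open>Since \<open>m * a = 1 + a\<close>, the exponent becomes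
  \<open>(1 + a) * (ln n - harm N)\<close>, whose limit is \<open>- euler_mascheroni\<close>. The
  correction \<open>2 * a^2\<close> grows to \<open>2 * a * (1 + a)\<close> and still
  vanishes.\<close>

lemma kernel_int_power_scaled: "(\<lambda>k. weight k * kernel_int (m k - 1) (N k) ^ m k) \<longlonglongrightarrow> exp (- euler_mascheroni)"
proof (rule tendsto_sandwich)
  let ?u = "\<lambda>k. (1 + a k) * (ln (real (n k)) - harm (N k))"
  have "?u \<longlonglongrightarrow> (1 + 0) * (- euler_mascheroni)"
    by (intro tendsto_mult tendsto_add tendsto_const a_lim harm_asymp[OF n_lim ratio])
  then have u: "?u \<longlonglongrightarrow> - euler_mascheroni" by simp
  show "(\<lambda>k. exp (?u k)) \<longlonglongrightarrow> exp (- euler_mascheroni)" by (rule tendsto_exp[OF u])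
  have "(\<lambda>k. ?u k + 2 * a k * (1 + a k)) \<longlonglongrightarrow> - euler_mascheroni + 2 * 0 * (1 + 0)"
    by (intro tendsto_intros u a_lim)
  then have "(\<lambda>k. ?u k + 2 * a k * (1 + a k)) \<longlonglongrightarrow> - euler_mascheroni" by simp
  then show "(\<lambda>k. exp (?u k + 2 * a k * (1 + a k))) \<longlonglongrightarrow> exp (- euler_mascheroni)" by (rule tendsto_exp)
  have ma: "real (m k) * a k = 1 + a k" for k using m2[of k] by (simp add: a_def field_simps)
  have "exp (?u k) \<le> weight k * kernel_int (m k - 1) (N k) ^ m k" for k
  proof -
    have "exp (?u k) = weight k * exp (- ((1 + a k) * harm (N k)))"
      by (simp add: weight_eq exp_add[symmetric] algebra_simps)
    also have "\<dots> = weight k * exp (- (real (m k) * a k * harm (N k)))" by (simp only: ma)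
    also have "\<dots> = weight k * exp (- (a k * harm (N k))) ^ m k"
      by (simp add: exp_of_nat_mult[symmetric] mult_ac)
    also have "\<dots> \<le> weight k * kernel_int (m k - 1) (N k) ^ m k"
      using kernel_int_bounds(1)[OF m_pred_pos[of k], of "N k"] weight_pos[of k] unfolding kernel_exponents
      by (intro mult_left_mono power_mono) auto
    finally show ?thesis .
  qed
  then show "\<forall>\<^sub>F k in sequentially. exp (?u k) \<le> weight k * kernel_int (m k - 1) (N k) ^ m k" by simp
  have "weight k * kernel_int (m k - 1) (N k) ^ m k \<le> exp (?u k + 2 * a k * (1 + a k))" for k
  proof -
    have "weight k * kernel_int (m k - 1) (N k) ^ m k \<le> weight k * exp (- (a k * harm (N k)) + 2 * a k * a k) ^ m k"
      using kernel_int_bounds(2)[OF m_pred_pos[of k], of "N k"] weight_pos[of k] kernel_int_pos[OF m_pred_pos[of k], of "N k"]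
      unfolding kernel_exponents by (intro mult_left_mono power_mono) auto
    also have "\<dots> = weight k * exp (- (real (m k) * a k * harm (N k)) + 2 * (real (m k) * a k) * a k)"
      by (simp add: exp_of_nat_mult[symmetric] algebra_simps)
    also have "\<dots> = exp (?u k + 2 * a k * (1 + a k))"
      unfolding ma by (simp add: weight_eq exp_add[symmetric] algebra_simps)
    finally show ?thesis .
  qed
  then show "\<forall>\<^sub>F k in sequentially. weight k * kernel_int (m k - 1) (N k) ^ m k \<le> exp (?u k + 2 * a k * (1 + a k))" by simp
qed

text \<open>In the limit the kernel acts like the indicator of an interval of length
  \<open>I\<close> ending at 1, so for \<open>t \<le> 1\<close> the share of \<open>{t<..}\<close>
  is the smaller of 1 and \<open>(1 - t) / I\<close>. The lower bound applies
  \<open>kernel_meas_greater_ge\<close> to a slightly shorter interval.\<close>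

lemma kernel_meas_asymp:
  defines "I \<equiv> \<lambda>k. kernel_int (m k - 1) (N k)"
  assumes lim: "(\<lambda>k. min 1 (max 0 (1 - t) / I k)) \<longlonglongrightarrow> J"
  shows "(\<lambda>k. kernel_meas (m k - 1) (N k) {t<..} / I k) \<longlonglongrightarrow> J"
proof -
  define c where "c = max 0 (1 - t)"
  \<comment> \<open>Below \<open>r I\<close> the kernel is close to 1, because \<open>N I\<^sup>k \<le> e\<^sup>2\<close> and \<open>r\<^sup>k \<rightarrow> 0\<close>, yet \<open>r \<rightarrow> 1\<close>.\<close>
  define r where "r = (\<lambda>k. 1 - 1 / sqrt (real (m k - 1)))"
  have I0: "0 < I k" for k unfolding I_def by (rule kernel_int_pos[OF m_pred_pos])
  have I1: "I k \<le> 1" for k unfolding I_def by (rule kernel_int_le_1[OF m_pred_pos])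
  have r01: "0 \<le> r k" "r k \<le> 1" for k
    using m_pred_pos[of k] by (auto simp: r_def)
  have up: "kernel_meas (m k - 1) (N k) {t<..} / I k \<le> min 1 (c / I k)" for k
  proof -
    have "kernel_meas (m k - 1) (N k) {t<..} \<le> I k"
      using kernel_meas_split[of "m k - 1" "N k" t] kernel_meas_nonneg[of "m k - 1" "N k" "{..t}"]
        kernel_meas_UNIV[OF m_pred_pos[of k], of "N k"]
      by (simp add: I_def)
    moreover have "kernel_meas (m k - 1) (N k) {t<..} \<le> c" unfolding c_def by (rule kernel_meas_greater_le)
    ultimately show ?thesis using I0[of k] by (simp add: divide_right_mono)
  qed
  have lo: "(min 1 (c / I k) - (1 - r k)) * (1 - exp 2 * r k ^ (m k - 1)) \<le> kernel_meas (m k - 1) (N k) {t<..} / I k"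
    if pos: "0 \<le> 1 - exp 2 * r k ^ (m k - 1)" for k
  proof -
    \<comment> \<open>The length handed to \<open>kernel_meas_greater_ge\<close>: it fits above
      \<open>t\<close> and is short enough for \<open>N * c' ^ (m - 1)\<close> to vanish in the
      limit.\<close>
    define c' where "c' = min c (r k * I k)"
    have rI: "r k * I k \<le> I k" using r01(2)[of k] I0[of k] by (intro mult_left_le_one_le) (auto simp: less_imp_le r01)
    have c': "0 \<le> c'" "c' \<le> 1" "c' \<le> c"
    proof -
      have "0 \<le> c" by (simp add: c_def)
      moreover have "0 \<le> r k * I k" using r01(1)[of k] I0[of k] by simp
      ultimately show "0 \<le> c'" by (simp add: c'_def)
      show "c' \<le> 1" using rI I1[of k] by (simp add: c'_def)
      show "c' \<le> c" by (simp add: c'_def)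
    qed
    have "real (N k) * c' ^ (m k - 1) \<le> real (N k) * (r k * I k) ^ (m k - 1)"
      using c' by (intro mult_left_mono power_mono) (auto simp: c'_def)
    also have "\<dots> = (real (N k) * I k ^ (m k - 1)) * r k ^ (m k - 1)" by (simp add: power_mult_distrib)
    also have "\<dots> \<le> exp 2 * r k ^ (m k - 1)"
      unfolding I_def using r01 by (intro mult_right_mono kernel_int_power_le m_pred_pos) auto
    finally have Nc: "real (N k) * c' ^ (m k - 1) \<le> exp 2 * r k ^ (m k - 1)" .
    have "min 1 (c / I k) - (1 - r k) \<le> c' / I k"
    proof -
      have "c' / I k = min (c / I k) (r k)"
        unfolding c'_def using I0[of k] by (simp add: min_divide_distrib_right)
      then show ?thesis using r01(2)[of k] by linarith
    qed
    then have "(min 1 (c / I k) - (1 - r k)) * (1 - exp 2 * r k ^ (m k - 1)) \<le> c' / I k * (1 - exp 2 * r k ^ (m k - 1))"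
      using pos by (rule mult_right_mono)
    also have "\<dots> \<le> c' / I k * (1 - real (N k) * c' ^ (m k - 1))"
      using Nc c' I0[of k] by (intro mult_left_mono) auto
    also have "\<dots> \<le> kernel_meas (m k - 1) (N k) {t<..} / I k"
      using kernel_meas_greater_ge[of c' t "N k" "m k - 1"] c' I0[of k] unfolding c_def
      by (simp add: divide_right_mono)
    finally show ?thesis .
  qed
  have "(\<lambda>j::nat. 1 - 1 / sqrt (real (j - 1))) \<longlonglongrightarrow> 1" by real_asymp
  from filterlim_compose[OF this m_lim] have r_lim: "r \<longlonglongrightarrow> 1" by (simp add: r_def)
  have "(\<lambda>j::nat. (1 - 1 / sqrt (real j)) ^ j) \<longlonglongrightarrow> 0" by real_asymp
  moreover have "filterlim (\<lambda>k. m k - 1) at_top sequentially"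
    using filterlim_compose[OF filterlim_minus_const_nat_at_top m_lim] .
  ultimately have "(\<lambda>k. (1 - 1 / sqrt (real (m k - 1))) ^ (m k - 1)) \<longlonglongrightarrow> 0" by (rule filterlim_compose)
  then have rp: "(\<lambda>k. 1 - exp 2 * r k ^ (m k - 1)) \<longlonglongrightarrow> 1 - exp 2 * 0"
    unfolding r_def by (intro tendsto_intros)
  have ev: "\<forall>\<^sub>F k in sequentially. 0 < 1 - exp 2 * r k ^ (m k - 1)"
    by (rule order_tendstoD(1)[OF rp]) simp
  show ?thesis
  proof (rule tendsto_sandwich)
    show "\<forall>\<^sub>F k in sequentially. (min 1 (c / I k) - (1 - r k)) * (1 - exp 2 * r k ^ (m k - 1))
        \<le> kernel_meas (m k - 1) (N k) {t<..} / I k"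
      using ev by eventually_elim (rule lo, simp)
    show "\<forall>\<^sub>F k in sequentially. kernel_meas (m k - 1) (N k) {t<..} / I k \<le> min 1 (c / I k)" using up by simp
    show "(\<lambda>k. min 1 (c / I k)) \<longlonglongrightarrow> J" using lim by (simp add: c_def)
    have "(\<lambda>k. (min 1 (c / I k) - (1 - r k)) * (1 - exp 2 * r k ^ (m k - 1))) \<longlonglongrightarrow> (J - (1 - 1)) * (1 - exp 2 * 0)"
      using lim unfolding c_def by (intro tendsto_mult tendsto_diff tendsto_const r_lim rp)
    then show "(\<lambda>k. (min 1 (c / I k) - (1 - r k)) * (1 - exp 2 * r k ^ (m k - 1))) \<longlonglongrightarrow> J" by simp
  qed
qed

end

end

section \<open>Slab volumes as real numbers\<close>

lemma measure_le_of_emeasure_le: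
  assumes "emeasure M A \<le> ennreal r" "0 \<le> r"
  shows "measure M A \<le> r"
  using assms by (metis enn2real_ennreal enn2real_mono ennreal_less_top measure_def)

lemma ennreal_measure_eq:
  assumes "emeasure M A \<le> ennreal r"
  shows "emeasure M A = ennreal (measure M A)"
  using assms by (intro emeasure_eq_ennreal_measure) (auto simp: top_unique)

text \<open>Divides by the volume of the product of simplices, a factor common to both bodies that
  cancels in all ratios.\<close>

definition scaled_vol :: "nat \<Rightarrow> nat \<Rightarrow> point set \<Rightarrow> real" where
  "scaled_vol m n K = fact (m - 1) ^ n * Vol m n K"

context
  fixes m n i :: nat
  assumes m: "m \<ge> 2" and n: "n \<ge> 1" and i: "i \<in> {1..m}"
begin

lemma y_slab_measurable:
  assumes "B \<in> sets borel"
  shows "demand m n \<inter> {(x, y). y i \<in> B} \<in> sets (vol_measure m n)"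
proof -
  have meas: "{p \<in> space (x_space m n \<Otimes>\<^sub>M y_space m). snd p i \<in> B} \<in> sets (x_space m n \<Otimes>\<^sub>M y_space m)"
    using measurable_sets[OF measurable_snd_y[OF i, of n] assms]
    by (simp add: vimage_def Int_def conj_commute)
  have "{(x, y). y i \<in> B} \<inter> demand m n \<in> sets (vol_measure m n)"
    using m by (intro emeasure_vol(1)[OF _ _ meas]) (auto simp: proj_def)
  then show ?thesis by (simp add: Int_commute)
qed

lemma cdf_uniform_law:
  assumes K: "K \<subseteq> demand m n" "0 < scaled_vol m n K"
  shows "cdf (uniform_law_y m n K i) t = scaled_vol m n (K \<inter> {(x, y). y i \<in> {..t}}) / scaled_vol m n K"
proof -
  let ?M = "vol_measure m n" and ?f = "\<lambda>(x, y). y i :: real"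
  have sp: "space ?M = demand m n" using m by (intro space_vol_measure) auto
  have f: "?f \<in> borel_measurable ?M"
  proof (rule measurableI)
    fix B :: "real set" assume "B \<in> sets borel"
    from y_slab_measurable[OF this] show "?f -` B \<inter> space ?M \<in> sets ?M"
      unfolding sp by (simp add: vimage_def case_prod_beta' Int_commute)
  qed simp
  have V: "Vol m n K > 0" using K(2) by (simp add: scaled_vol_def zero_less_mult_iff)
  \<comment> \<open>\<open>measure\<close> vanishes on sets of infinite measure too, so positive
    volume rules out both degenerate cases of \<open>uniform_measure\<close>.\<close>
  then have fin: "emeasure ?M K \<noteq> 0" "emeasure ?M K \<noteq> \<infinity>"
    by (auto simp: Vol_def measure_def)
  have pre: "?f -` {..t} \<inter> space ?M \<in> sets ?M" using f by (rule measurable_sets) simp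
  have "cdf (uniform_law_y m n K i) t = measure (uniform_measure ?M K) (?f -` {..t} \<inter> space ?M)"
    unfolding cdf_def uniform_law_y_def using f by (subst measure_distr) auto
  also have "\<dots> = measure ?M (K \<inter> (?f -` {..t} \<inter> space ?M)) / measure ?M K"
    by (rule measure_uniform_measure[OF fin pre])
  also have "K \<inter> (?f -` {..t} \<inter> space ?M) = K \<inter> {(x, y). y i \<in> {..t}}"
    unfolding sp using K(1) by auto
  finally show ?thesis by (simp add: scaled_vol_def Vol_def)
qed

text \<open>Lets an upper bound on one side of \<open>t\<close> act as a lower bound on the
  other.\<close>

lemma scaled_vol_split:
  assumes fin: "emeasure (vol_measure m n) (K \<inter> {(x, y). y i \<in> UNIV}) \<noteq> \<infinity>"
    and K: "\<And>B. B \<in> sets borel \<Longrightarrow> K \<inter> {(x, y). y i \<in> B} \<in> sets (vol_measure m n)"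
  shows "scaled_vol m n K = scaled_vol m n (K \<inter> {(x, y). y i \<in> {..t}}) + scaled_vol m n (K \<inter> {(x, y). y i \<in> {t<..}})"
proof -
  let ?M = "vol_measure m n" and ?S = "\<lambda>B. K \<inter> {(x, y). y i \<in> B}"
  have fin': "emeasure ?M (?S B) \<noteq> \<infinity>" if "B \<in> sets borel" for B
    using emeasure_mono[of "?S B" "?S UNIV" ?M] K[of UNIV] fin by (auto simp: top_unique)
  have un: "?S {..t} \<union> ?S {t<..} = K" by auto
  have "measure ?M (?S {..t} \<union> ?S {t<..}) = measure ?M (?S {..t}) + measure ?M (?S {t<..})"
    by (intro measure_Union fin' K) auto
  then show ?thesis unfolding un by (simp add: scaled_vol_def Vol_def distrib_left)
qed

lemma strong_scaled_vol_le:
  assumes B: "B \<in> sets borel" and d: "0 < d" "d \<le> 1 / 3" and N: "real N \<le> (1 - 3 * d) * real n"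
  shows "scaled_vol m n (strong_slab m n i B)
    \<le> kernel_int (m - 1) N ^ (m - 1) * kernel_meas (m - 1) N B + (1 / (1 + d)) ^ n"
proof -
  let ?X = "kernel_int (m - 1) N ^ (m - 1) * kernel_meas (m - 1) N B + (1 / (1 + d)) ^ n"
  have X0: "0 \<le> ?X"
    using m d kernel_int_pos[of "m - 1" N] by (auto intro!: add_nonneg_nonneg mult_nonneg_nonneg kernel_meas_nonneg)
  have "measure (vol_measure m n) (strong_slab m n i B) \<le> (1 / fact (m - 1)) ^ n * ?X"
    by (intro measure_le_of_emeasure_le strong_slab_upper[OF m n i B d N] mult_nonneg_nonneg X0) simp
  then show ?thesis by (simp add: scaled_vol_def Vol_def power_divide field_simps)
qed

lemma strong_slab_finite:
  assumes B: "B \<in> sets borel"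
  shows "emeasure (vol_measure m n) (strong_slab m n i B) = ennreal (Vol m n (strong_slab m n i B))"
proof -
  \<comment> \<open>Any admissible parameters give a finite bound; \<open>d = 1 / 3\<close> with
    \<open>N = 0\<close> is admissible for every \<open>n\<close>.\<close>
  have "real 0 \<le> (1 - 3 * (1 / 3)) * real n" by simp
  from strong_slab_upper[OF m n i B _ _ this] show ?thesis
    unfolding Vol_def by (intro ennreal_measure_eq) auto
qed

lemma strong_scaled_vol_ge:
  assumes d: "0 < d" "d \<le> 1 / 2" and N: "(1 + 2 * d) * real n \<le> real N"
  shows "kernel_int (m - 1) N ^ m - exp (- (d * real n)) \<le> scaled_vol m n (strong_slab m n i UNIV)"
proof -
  let ?C = "(1 / fact (m - 1) :: real) ^ n"
  have "ennreal (?C * kernel_int (m - 1) N ^ m)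
    \<le> ennreal (Vol m n (strong_slab m n i UNIV) + ?C * exp (- (d * real n)))"
    using strong_slab_lower[OF m n i d N] by (simp add: strong_slab_finite Vol_def)
  then have "?C * kernel_int (m - 1) N ^ m \<le> Vol m n (strong_slab m n i UNIV) + ?C * exp (- (d * real n))"
    by (subst (asm) ennreal_le_iff) (auto simp: Vol_def intro!: add_nonneg_nonneg)
  then show ?thesis by (simp add: scaled_vol_def power_divide field_simps)
qed

lemma weak_slab_finite:
  assumes B: "B \<in> sets borel"
  shows "emeasure (vol_measure m n) (weak_slab m n i B) = ennreal (Vol m n (weak_slab m n i B))"
proof -
  have "weak_slab m n i B \<subseteq> weak_slab m n i UNIV" by (auto simp: weak_slab_def)
  from order_trans[OF emeasure_mono[OF this weak_slab_measure(1)[OF m n i]] weak_slab_UNIV_le[OF m n i]]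
  show ?thesis unfolding Vol_def by (intro ennreal_measure_eq) auto
qed

lemma weak_scaled_vol_le: "scaled_vol m n (weak_slab m n i UNIV) \<le> exp (-1)"
proof -
  have "measure (vol_measure m n) (weak_slab m n i UNIV) \<le> (1 / fact (m - 1)) ^ n * exp (-1)"
    by (intro measure_le_of_emeasure_le weak_slab_UNIV_le[OF m n i]) simp
  then show ?thesis by (simp add: scaled_vol_def Vol_def power_divide field_simps)
qed

lemma weak_scaled_vol_ge:
  assumes e: "0 \<le> e"
  shows "exp (-1) * (1 - row_err m e) \<le> scaled_vol m n (weak_slab m n i UNIV)"
proof -
  let ?C = "(1 / fact (m - 1) :: real) ^ n"
  have r: "0 \<le> row_err m e" using e by (simp add: row_err_def)
  have "ennreal (?C * exp (-1)) \<le> ennreal (Vol m n (weak_slab m n i UNIV) + ?C * exp (-1) * row_err m e)"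
    using weak_slab_UNIV_ge[OF m n i e] r by (simp add: weak_slab_finite Vol_def)
  then have "?C * exp (-1) \<le> Vol m n (weak_slab m n i UNIV) + ?C * exp (-1) * row_err m e"
    using r by (subst (asm) ennreal_le_iff) (auto simp: Vol_def intro!: add_nonneg_nonneg)
  then show ?thesis by (simp add: scaled_vol_def power_divide field_simps)
qed

lemma weak_scaled_vol_atMost_le:
  "scaled_vol m n (weak_slab m n i {..t}) \<le> min 1 (max 0 t) * scaled_vol m n (weak_slab m n i UNIV)"
proof -
  have "measure (vol_measure m n) (weak_slab m n i {..t}) \<le> min 1 (max 0 t) * Vol m n (weak_slab m n i UNIV)"
    using weak_slab_atMost_le[OF m n i, of t]
    by (intro measure_le_of_emeasure_le) (auto simp: weak_slab_finite ennreal_mult Vol_def)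
  then show ?thesis
    by (simp add: scaled_vol_def Vol_def mult_left_mono mult.left_commute[of "min 1 (max 0 t)"])
qed

lemma weak_scaled_vol_greaterThan_le:
  assumes e: "0 \<le> e"
  shows "scaled_vol m n (weak_slab m n i {t<..}) \<le> (1 - min 1 (max 0 t)) * (exp (-1) * (1 + 2 * row_err m e))"
proof -
  have r: "0 \<le> row_err m e" using e by (simp add: row_err_def)
  have "measure (vol_measure m n) (weak_slab m n i {t<..})
    \<le> (1 - min 1 (max 0 t)) * ((1 / fact (m - 1)) ^ n * exp (-1) * (1 + 2 * row_err m e))"
    using r by (intro measure_le_of_emeasure_le weak_slab_greaterThan_le[OF m n i e] mult_nonneg_nonneg) auto
  then have "scaled_vol m n (weak_slab m n i {t<..})
    \<le> fact (m - 1) ^ n * ((1 - min 1 (max 0 t)) * ((1 / fact (m - 1)) ^ n * exp (-1) * (1 + 2 * row_err m e)))"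
    unfolding scaled_vol_def Vol_def by (intro mult_left_mono) auto
  then show ?thesis by (simp add: power_divide)
qed

end

lemma strong_slab_eq: "strong_slab m n i B = (strong_relaxation m n \<inter> demand m n) \<inter> {(x, y). y i \<in> B}"
  by (simp add: strong_slab_def)

lemma weak_slab_eq: "weak_slab m n i B = (weak_relaxation m n \<inter> demand m n) \<inter> {(x, y). y i \<in> B}"
  by (simp add: weak_slab_def)

lemma cdf_uniform_Icc:
  assumes "a < b"
  shows "cdf (uniform_Icc a b) t = max 0 (min b t - a) / (b - a)"
proof -
  have "cdf (uniform_Icc a b) t = measure lborel ({a..b} \<inter> {..t}) / measure lborel {a..b}"
    unfolding cdf_def uniform_Icc_def using assms by (simp add: measure_uniform_measure)
  also have "{a..b} \<inter> {..t} = {a..min b t}" by auto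
  finally show ?thesis using assms by (simp add: max_def)
qed

section \<open>Limits of the volumes and of the laws of \<open>y i\<close>\<close>

context regime
begin

text \<open>Product kernels with \<open>upper_exponent\<close> and \<open>lower_exponent\<close>
  enclose the volume up to the errors in \<open>err_lower\<close> and \<open>err_upper\<close>; by
  \<open>kernel_int_power_scaled\<close> both weighted kernels have the same limit.\<close>

lemma strong_total:
  assumes i: "\<forall>\<^sub>F k in sequentially. i k \<in> {1..m k}"
  shows "(\<lambda>k. weight k * scaled_vol (m k) (n k) (strong_slab (m k) (n k) (i k) UNIV)) \<longlonglongrightarrow> exp (- euler_mascheroni)"
proof (rule tendsto_sandwich)
  let ?S = "\<lambda>k. scaled_vol (m k) (n k) (strong_slab (m k) (n k) (i k) UNIV)"
  let ?l = "\<lambda>k. weight k * kernel_int (m k - 1) (upper_exponent (n k)) ^ m k - weight k * exp (- (1 / sqrt (real (n k)) * real (n k)))"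
  let ?u = "\<lambda>k. weight k * kernel_int (m k - 1) (lower_exponent (n k)) ^ m k + weight k * (1 / (1 + 1 / sqrt (real (n k)))) ^ n k"
  have n9: "\<forall>\<^sub>F k in sequentially. 9 \<le> n k"
    by (rule eventually_compose_filterlim[OF eventually_ge_at_top n_lim])
  have d: "0 < 1 / sqrt (real j)" "1 / sqrt (real j) \<le> 1 / 3" if "9 \<le> j" for j :: nat
  proof -
    have "3 \<le> sqrt (real j)" using that by (intro real_le_rsqrt) auto
    then show "0 < 1 / sqrt (real j)" "1 / sqrt (real j) \<le> 1 / 3" using that by (auto simp: divide_simps)
  qed
  show "\<forall>\<^sub>F k in sequentially. ?l k \<le> weight k * ?S k"
    using i n9
  proof eventually_elim
    case (elim k)
    have "kernel_int (m k - 1) (upper_exponent (n k)) ^ m k - exp (- (1 / sqrt (real (n k)) * real (n k))) \<le> ?S k"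
      using d[OF elim(2)] by (intro strong_scaled_vol_ge m2 n1 elim(1) upper_exponent_ge) auto
    then show ?case
      using mult_left_mono[OF _ less_imp_le[OF weight_pos[of k]]] by (fastforce simp: right_diff_distrib)
  qed
  show "\<forall>\<^sub>F k in sequentially. weight k * ?S k \<le> ?u k"
    using i n9
  proof eventually_elim
    case (elim k)
    have "?S k \<le> kernel_int (m k - 1) (lower_exponent (n k)) ^ (m k - 1) * kernel_meas (m k - 1) (lower_exponent (n k)) UNIV
        + (1 / (1 + 1 / sqrt (real (n k)))) ^ n k"
      using d[OF elim(2)] by (intro strong_scaled_vol_le m2 n1 elim(1) lower_exponent_le elim(2)) auto
    also have "kernel_int (m k - 1) (lower_exponent (n k)) ^ (m k - 1) * kernel_meas (m k - 1) (lower_exponent (n k)) UNIV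
      = kernel_int (m k - 1) (lower_exponent (n k)) ^ m k"
      using m2[of k] by (cases "m k") (auto simp: kernel_meas_UNIV)
    finally show ?case
      using mult_left_mono[OF _ less_imp_le[OF weight_pos[of k]]] by (fastforce simp: distrib_left)
  qed
  have "?l \<longlonglongrightarrow> exp (- euler_mascheroni) - 0"
    by (intro tendsto_diff kernel_int_power_scaled err_lower filterlim_compose[OF upper_exponent_ratio n_lim])
  then show "?l \<longlonglongrightarrow> exp (- euler_mascheroni)" by simp
  have "?u \<longlonglongrightarrow> exp (- euler_mascheroni) + 0"
    by (intro tendsto_add kernel_int_power_scaled err_upper filterlim_compose[OF lower_exponent_ratio n_lim])
  then show "?u \<longlonglongrightarrow> exp (- euler_mascheroni)" by simp
qed

text \<open>Slabs are bounded individually only from above. The lower bound for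
  \<open>{t<..}\<close> is the total minus the upper bound for \<open>{..t}\<close>, and it is sharp
  because the two kernel shares add up to 1.\<close>

lemma strong_tail:
  assumes i: "\<forall>\<^sub>F k in sequentially. i k \<in> {1..m k}"
    and J: "(\<lambda>k. min 1 (max 0 (1 - t) / kernel_int (m k - 1) (lower_exponent (n k)))) \<longlonglongrightarrow> J"
  shows "(\<lambda>k. weight k * scaled_vol (m k) (n k) (strong_slab (m k) (n k) (i k) {t<..})) \<longlonglongrightarrow> exp (- euler_mascheroni) * J"
proof (rule tendsto_sandwich)
  let ?S = "\<lambda>B k. scaled_vol (m k) (n k) (strong_slab (m k) (n k) (i k) B)"
  let ?N = "\<lambda>k. lower_exponent (n k)"
  let ?I = "\<lambda>k. kernel_int (m k - 1) (?N k)"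
  let ?J = "\<lambda>k. kernel_meas (m k - 1) (?N k) {t<..} / ?I k"
  let ?e = "\<lambda>k. (1 / (1 + 1 / sqrt (real (n k)))) ^ n k"
  have ratio: "(\<lambda>k. real (?N k) / real (n k)) \<longlonglongrightarrow> 1"
    by (rule filterlim_compose[OF lower_exponent_ratio n_lim])
  have Jlim: "?J \<longlonglongrightarrow> J" by (rule kernel_meas_asymp[OF ratio J])
  have n9: "\<forall>\<^sub>F k in sequentially. 9 \<le> n k"
    by (rule eventually_compose_filterlim[OF eventually_ge_at_top n_lim])
  have le: "weight k * ?S B k \<le> weight k * ?I k ^ m k * (kernel_meas (m k - 1) (?N k) B / ?I k) + weight k * ?e k"
    if k: "i k \<in> {1..m k}" "9 \<le> n k" and B: "B \<in> sets borel" for k B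
  proof -
    have "3 \<le> sqrt (real (n k))" using k by (intro real_le_rsqrt) auto
    then have d: "0 < 1 / sqrt (real (n k))" "1 / sqrt (real (n k)) \<le> 1 / 3" using k by (auto simp: divide_simps)
    have "?S B k \<le> ?I k ^ (m k - 1) * kernel_meas (m k - 1) (?N k) B + ?e k"
      by (intro strong_scaled_vol_le m2 n1 k B d lower_exponent_le)
    also have "?I k ^ (m k - 1) = ?I k ^ m k / ?I k"
      using m2[of k] kernel_int_pos[OF m_pred_pos[of k], of "?N k"] by (cases "m k") auto
    finally have "weight k * ?S B k \<le> weight k * (?I k ^ m k / ?I k * kernel_meas (m k - 1) (?N k) B + ?e k)"
      using weight_pos[of k] by (intro mult_left_mono) auto
    then show ?thesis by (simp add: distrib_left)
  qed
  show "\<forall>\<^sub>F k in sequentially. weight k * ?S {t<..} k \<le> weight k * ?I k ^ m k * ?J k + weight k * ?e k"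
    using i n9 by eventually_elim (rule le, auto)
  show "\<forall>\<^sub>F k in sequentially. weight k * ?S UNIV k - (weight k * ?I k ^ m k * (1 - ?J k) + weight k * ?e k) \<le> weight k * ?S {t<..} k"
    using i n9
  proof eventually_elim
    case (elim k)
    have "?S UNIV k = ?S {..t} k + ?S {t<..} k"
    proof -
      have "?S UNIV k = scaled_vol (m k) (n k) (strong_relaxation (m k) (n k) \<inter> demand (m k) (n k))"
        by (simp add: strong_slab_eq)
      also have "\<dots> = ?S {..t} k + ?S {t<..} k"
        unfolding strong_slab_eq
        by (rule scaled_vol_split[OF m2 n1 elim(1)], unfold strong_slab_eq[symmetric])
           (simp_all add: strong_slab_finite[OF m2 n1 elim(1)] strong_slab_measure(1)[OF m2 n1 elim(1)])
      finally show ?thesis .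
    qed
    moreover have "kernel_meas (m k - 1) (?N k) {..t} / ?I k = 1 - ?J k"
      using kernel_meas_split[of "m k - 1" "?N k" t] kernel_int_pos[OF m_pred_pos[of k], of "?N k"]
        kernel_meas_UNIV[OF m_pred_pos[of k], of "?N k"]
      by (simp add: field_simps)
    ultimately show ?case
      using le[OF elim, of "{..t}"] by (simp add: distrib_left)
  qed
  have "(\<lambda>k. weight k * ?I k ^ m k * ?J k + weight k * ?e k) \<longlonglongrightarrow> exp (- euler_mascheroni) * J + 0"
    by (intro tendsto_add tendsto_mult kernel_int_power_scaled err_upper Jlim ratio)
  then show "(\<lambda>k. weight k * ?I k ^ m k * ?J k + weight k * ?e k) \<longlonglongrightarrow> exp (- euler_mascheroni) * J" by simp
  have "(\<lambda>k. weight k * ?S UNIV k - (weight k * ?I k ^ m k * (1 - ?J k) + weight k * ?e k))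
      \<longlonglongrightarrow> exp (- euler_mascheroni) - (exp (- euler_mascheroni) * (1 - J) + 0)"
    by (intro tendsto_diff tendsto_add tendsto_mult tendsto_const kernel_int_power_scaled err_upper Jlim ratio strong_total i)
  then show "(\<lambda>k. weight k * ?S UNIV k - (weight k * ?I k ^ m k * (1 - ?J k) + weight k * ?e k)) \<longlonglongrightarrow> exp (- euler_mascheroni) * J"
    by (simp add: algebra_simps)
qed

abbreviation strong_law :: "(nat \<Rightarrow> nat) \<Rightarrow> nat \<Rightarrow> real measure" where
  "strong_law i k \<equiv> uniform_law_y (m k) (n k) (strong_relaxation (m k) (n k) \<inter> demand (m k) (n k)) (i k)"

abbreviation weak_law :: "(nat \<Rightarrow> nat) \<Rightarrow> nat \<Rightarrow> real measure" where
  "weak_law i k \<equiv> uniform_law_y (m k) (n k) (weak_relaxation (m k) (n k) \<inter> demand (m k) (n k)) (i k)"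

text \<open>The distribution function is 1 minus tail over total, and \<open>weight\<close> and
  \<open>exp (- euler_mascheroni)\<close> cancel in that quotient.\<close>

lemma strong_cdf_limit:
  assumes i: "\<forall>\<^sub>F k in sequentially. i k \<in> {1..m k}"
    and J: "(\<lambda>k. min 1 (max 0 (1 - t) / kernel_int (m k - 1) (lower_exponent (n k)))) \<longlonglongrightarrow> J"
  shows "(\<lambda>k. cdf (strong_law i k) t) \<longlonglongrightarrow> 1 - J"
proof -
  let ?S = "\<lambda>B k. scaled_vol (m k) (n k) (strong_slab (m k) (n k) (i k) B)"
  have lim: "(\<lambda>k. 1 - (weight k * ?S {t<..} k) / (weight k * ?S UNIV k)) \<longlonglongrightarrow> 1 - (exp (- euler_mascheroni) * J) / exp (- euler_mascheroni)"
    by (intro tendsto_diff tendsto_const tendsto_divide strong_total strong_tail i J) simp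
  have "\<forall>\<^sub>F k in sequentially. 0 < weight k * ?S UNIV k"
    by (rule order_tendstoD(1)[OF strong_total[OF i]]) simp
  with i have "\<forall>\<^sub>F k in sequentially. 1 - (weight k * ?S {t<..} k) / (weight k * ?S UNIV k) = cdf (strong_law i k) t"
  proof eventually_elim
    case (elim k)
    let ?K = "strong_relaxation (m k) (n k) \<inter> demand (m k) (n k)"
    have U: "?S UNIV k = scaled_vol (m k) (n k) ?K" by (simp add: strong_slab_eq)
    have pos: "0 < scaled_vol (m k) (n k) ?K" using elim(2) weight_pos[of k] by (simp add: U zero_less_mult_iff)
    have "scaled_vol (m k) (n k) ?K = ?S {..t} k + ?S {t<..} k"
      unfolding strong_slab_eq
      by (rule scaled_vol_split[OF m2 n1 elim(1)], unfold strong_slab_eq[symmetric])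
         (simp_all add: strong_slab_finite[OF m2 n1 elim(1)] strong_slab_measure(1)[OF m2 n1 elim(1)])
    moreover have "cdf (strong_law i k) t = ?S {..t} k / scaled_vol (m k) (n k) ?K"
      unfolding strong_slab_eq by (rule cdf_uniform_law[OF m2 n1 elim(1) _ pos]) auto
    moreover have "weight k * ?S {t<..} k / (weight k * scaled_vol (m k) (n k) ?K) = ?S {t<..} k / scaled_vol (m k) (n k) ?K"
      using weight_pos[of k] by simp
    moreover have "?S {..t} k / scaled_vol (m k) (n k) ?K = 1 - ?S {t<..} k / scaled_vol (m k) (n k) ?K"
      if "scaled_vol (m k) (n k) ?K = ?S {..t} k + ?S {t<..} k"
      using pos that by (simp add: field_simps)
    ultimately show ?case unfolding U by (simp only:)
  qed
  from Lim_transform_eventually[OF lim this] show ?thesis by simp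
qed

text \<open>The threshold \<open>1 / sqrt m\<close> tends to 0, while
  \<open>m * (1 - 1 / sqrt m) ^ (m - 1)\<close> still decays like \<open>exp (- sqrt m)\<close> up
  to a polynomial factor.\<close>

lemma row_err_lim: "(\<lambda>k. row_err (m k) (1 / sqrt (real (m k)))) \<longlonglongrightarrow> 0"
proof -
  have "(\<lambda>j::nat. 1 / sqrt (real j) + real j * (max 0 (1 - 1 / sqrt (real j))) ^ (j - 1)) \<longlonglongrightarrow> 0"
    by real_asymp
  from filterlim_compose[OF this m_lim] show ?thesis by (simp add: row_err_def)
qed

lemma weak_total:
  assumes i: "\<forall>\<^sub>F k in sequentially. i k \<in> {1..m k}"
  shows "(\<lambda>k. scaled_vol (m k) (n k) (weak_slab (m k) (n k) (i k) UNIV)) \<longlonglongrightarrow> exp (-1)"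
proof (rule tendsto_sandwich)
  let ?S = "\<lambda>k. scaled_vol (m k) (n k) (weak_slab (m k) (n k) (i k) UNIV)"
  show "\<forall>\<^sub>F k in sequentially. exp (-1) * (1 - row_err (m k) (1 / sqrt (real (m k)))) \<le> ?S k"
    using i by eventually_elim (intro weak_scaled_vol_ge m2 n1, auto)
  show "\<forall>\<^sub>F k in sequentially. ?S k \<le> exp (-1)"
    using i by eventually_elim (intro weak_scaled_vol_le m2 n1)
  have "(\<lambda>k. exp (-1) * (1 - row_err (m k) (1 / sqrt (real (m k))))) \<longlonglongrightarrow> exp (-1) * (1 - 0)"
    by (intro tendsto_mult tendsto_diff tendsto_const row_err_lim)
  then show "(\<lambda>k. exp (-1) * (1 - row_err (m k) (1 / sqrt (real (m k))))) \<longlonglongrightarrow> exp (-1)" by simp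
qed simp

text \<open>The upper bound holds without error once \<open>i k\<close> is a row and the volume is
  positive; the lower bound passes through the tail, whose error vanishes with
  \<open>row_err\<close>.\<close>

lemma weak_cdf_limit:
  assumes i: "\<forall>\<^sub>F k in sequentially. i k \<in> {1..m k}"
  shows "(\<lambda>k. cdf (weak_law i k) t) \<longlonglongrightarrow> min 1 (max 0 t)"
proof (rule tendsto_sandwich)
  let ?S = "\<lambda>B k. scaled_vol (m k) (n k) (weak_slab (m k) (n k) (i k) B)"
  let ?t = "min 1 (max 0 t)"
  let ?g = "\<lambda>k. (1 - ?t) * (exp (-1) * (1 + 2 * row_err (m k) (1 / sqrt (real (m k)))))"
  have pos: "\<forall>\<^sub>F k in sequentially. 0 < ?S UNIV k"
    by (rule order_tendstoD(1)[OF weak_total[OF i]]) simp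
  have cdf: "cdf (weak_law i k) t = ?S {..t} k / ?S UNIV k" and split: "?S UNIV k = ?S {..t} k + ?S {t<..} k"
    if k: "i k \<in> {1..m k}" "0 < ?S UNIV k" for k
  proof -
    let ?K = "weak_relaxation (m k) (n k) \<inter> demand (m k) (n k)"
    have U: "?S UNIV k = scaled_vol (m k) (n k) ?K" by (simp add: weak_slab_eq)
    show "?S UNIV k = ?S {..t} k + ?S {t<..} k"
      unfolding U unfolding weak_slab_eq
      by (rule scaled_vol_split[OF m2 n1 k(1)], unfold weak_slab_eq[symmetric])
         (simp_all add: weak_slab_finite[OF m2 n1 k(1)] weak_slab_measure(1)[OF m2 n1 k(1)])
    show "cdf (weak_law i k) t = ?S {..t} k / ?S UNIV k"
      unfolding U unfolding weak_slab_eq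
      using k(2) unfolding U by (intro cdf_uniform_law[OF m2 n1 k(1)]) auto
  qed
  show "\<forall>\<^sub>F k in sequentially. cdf (weak_law i k) t \<le> ?t"
    using i pos
  proof eventually_elim
    case (elim k)
    then show ?case
      using weak_scaled_vol_atMost_le[OF m2 n1[of k] elim(1), where t = t]
      unfolding cdf[OF elim] pos_divide_le_eq[OF elim(2)] by simp
  qed
  show "\<forall>\<^sub>F k in sequentially. 1 - ?g k / ?S UNIV k \<le> cdf (weak_law i k) t"
    using i pos
  proof eventually_elim
    case (elim k)
    have "?S {t<..} k \<le> ?g k" by (intro weak_scaled_vol_greaterThan_le m2 n1 elim(1)) auto
    then have "?S {t<..} k / ?S UNIV k \<le> ?g k / ?S UNIV k" using elim(2) by (intro divide_right_mono) auto
    moreover have "?S {..t} k / ?S UNIV k = 1 - ?S {t<..} k / ?S UNIV k"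
      using split[OF elim] elim(2) by (simp add: field_simps)
    ultimately show ?case unfolding cdf[OF elim] by linarith
  qed
  have "(\<lambda>k. 1 - ?g k / ?S UNIV k) \<longlonglongrightarrow> 1 - (1 - ?t) * (exp (-1) * (1 + 2 * 0)) / exp (-1)"
    by (intro tendsto_diff tendsto_const tendsto_divide tendsto_mult tendsto_add row_err_lim weak_total i) simp
  then show "(\<lambda>k. 1 - ?g k / ?S UNIV k) \<longlonglongrightarrow> ?t" by simp
qed simp

text \<open>\<open>weight\<close> is \<open>n\<close> times \<open>exp (a * ln n)\<close>, so
  dividing by \<open>n\<close> leaves that exponential, the only factor that carries \<tau> into the
  limit.\<close>

lemma ratio_eq:
  "volume_ratio (m k) (n k) / real (n k)
    = scaled_vol (m k) (n k) (weak_slab (m k) (n k) 1 UNIV) * exp (a k * ln (real (n k)))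
      / (weight k * scaled_vol (m k) (n k) (strong_slab (m k) (n k) 1 UNIV))"
  using n1[of k]
  by (simp add: volume_ratio_def scaled_vol_def weight_def strong_slab_eq weak_slab_eq)

lemma one_in_rows: "\<forall>\<^sub>F k in sequentially. 1 \<in> {1..m k}"
  using m2 by (intro always_eventually allI) (auto intro: order_trans[of _ 2])

lemma ratio_scaled_lim:
  "(\<lambda>k. scaled_vol (m k) (n k) (weak_slab (m k) (n k) 1 UNIV)
      / (weight k * scaled_vol (m k) (n k) (strong_slab (m k) (n k) 1 UNIV))) \<longlonglongrightarrow> exp (euler_mascheroni - 1)"
proof -
  have "(\<lambda>k. scaled_vol (m k) (n k) (weak_slab (m k) (n k) 1 UNIV)
      / (weight k * scaled_vol (m k) (n k) (strong_slab (m k) (n k) 1 UNIV))) \<longlonglongrightarrow> exp (-1) / exp (- euler_mascheroni)"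
    by (intro tendsto_divide weak_total[OF one_in_rows] strong_total[OF one_in_rows]) simp
  then show ?thesis by (simp add: exp_diff[symmetric])
qed

text \<open>Isolates the factor \<open>exp (a * ln n)\<close>: for \<open>N\<close> asymptotic to
  \<open>n\<close> the new denominator tends to 1 by \<open>kernel_int_scaled\<close>.\<close>

lemma inverse_kernel_int:
  "c / kernel_int (m k - 1) N = c * exp (a k * ln (real (n k))) / (kernel_int (m k - 1) N * exp (a k * ln (real (n k))))"
  by simp

lemma kernel_int_lower_lim:
  "(\<lambda>k. kernel_int (m k - 1) (lower_exponent (n k)) * exp (a k * ln (real (n k)))) \<longlonglongrightarrow> 1"
  by (rule kernel_int_scaled[OF filterlim_compose[OF lower_exponent_ratio n_lim]])

text \<open>Here \<open>1 / kernel_int\<close> tends to \<open>exp r\<close>, which determines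
  \<open>J\<close> in \<open>strong_cdf_limit\<close>; the volume ratio picks up the same factor
  \<open>exp r\<close> on top of \<open>ratio_scaled_lim\<close>.\<close>

lemma finite_regime:
  assumes tau: "(\<lambda>k. a k * ln (real (n k))) \<longlonglongrightarrow> r"
  shows "(\<lambda>k. volume_ratio (m k) (n k) / real (n k)) \<longlonglongrightarrow> exp (euler_mascheroni - 1 + r)"
    and "\<forall>\<^sub>F k in sequentially. i k \<in> {1..m k} \<Longrightarrow>
      (\<lambda>k. cdf (strong_law i k) t) \<longlonglongrightarrow> 1 - min 1 (max 0 (1 - t) * exp r)"
proof -
  note e = tendsto_exp[OF tau]
  show "(\<lambda>k. volume_ratio (m k) (n k) / real (n k)) \<longlonglongrightarrow> exp (euler_mascheroni - 1 + r)"
    using tendsto_mult[OF ratio_scaled_lim e] by (simp add: ratio_eq exp_add)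
  show "(\<lambda>k. cdf (strong_law i k) t) \<longlonglongrightarrow> 1 - min 1 (max 0 (1 - t) * exp r)"
    if "\<forall>\<^sub>F k in sequentially. i k \<in> {1..m k}"
  proof (rule strong_cdf_limit[OF that])
    have "(\<lambda>k. min 1 (max 0 (1 - t) / kernel_int (m k - 1) (lower_exponent (n k)))) \<longlonglongrightarrow> min 1 (max 0 (1 - t) * exp r / 1)"
      unfolding inverse_kernel_int
      by (intro tendsto_min tendsto_const tendsto_divide tendsto_mult e kernel_int_lower_lim) simp
    then show "(\<lambda>k. min 1 (max 0 (1 - t) / kernel_int (m k - 1) (lower_exponent (n k)))) \<longlonglongrightarrow> min 1 (max 0 (1 - t) * exp r)"
      by simp
  qed
qed

text \<open>Now \<open>kernel_int\<close> tends to 0. For \<open>t < 1\<close> the quotient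
  \<open>(1 - t) / kernel_int\<close> eventually exceeds 1, so \<open>J = 1\<close>; for
  \<open>t \<ge> 1\<close> the numerator \<open>max 0 (1 - t)\<close> is 0, so
  \<open>J = 0\<close>.\<close>

lemma infinite_regime:
  assumes tau: "filterlim (\<lambda>k. a k * ln (real (n k))) at_top sequentially"
  shows "filterlim (\<lambda>k. volume_ratio (m k) (n k) / real (n k)) at_top sequentially"
    and "\<forall>\<^sub>F k in sequentially. i k \<in> {1..m k} \<Longrightarrow>
      (\<lambda>k. cdf (strong_law i k) t) \<longlonglongrightarrow> (if 1 \<le> t then 1 else 0)"
proof -
  have e: "filterlim (\<lambda>k. exp (a k * ln (real (n k)))) at_top sequentially"
    by (rule filterlim_compose[OF exp_at_top tau])
  show "filterlim (\<lambda>k. volume_ratio (m k) (n k) / real (n k)) at_top sequentially"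
    using filterlim_tendsto_pos_mult_at_top[OF ratio_scaled_lim _ e] by (simp add: ratio_eq)
  show "(\<lambda>k. cdf (strong_law i k) t) \<longlonglongrightarrow> (if 1 \<le> t then 1 else 0)"
    if i: "\<forall>\<^sub>F k in sequentially. i k \<in> {1..m k}"
  proof (cases "1 \<le> t")
    case True
    have "(\<lambda>k. cdf (strong_law i k) t) \<longlonglongrightarrow> 1 - 0"
      by (rule strong_cdf_limit[OF i]) (use True in simp)
    then show ?thesis using True by simp
  next
    case False
    have "filterlim (\<lambda>k. (1 - t) / (kernel_int (m k - 1) (lower_exponent (n k)) * exp (a k * ln (real (n k))))
        * exp (a k * ln (real (n k)))) at_top sequentially"
    proof (rule filterlim_tendsto_pos_mult_at_top[OF _ _ e])
      show "(\<lambda>k. (1 - t) / (kernel_int (m k - 1) (lower_exponent (n k)) * exp (a k * ln (real (n k))))) \<longlonglongrightarrow> (1 - t) / 1"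
        by (intro tendsto_divide tendsto_const kernel_int_lower_lim) simp
    qed (use False in simp)
    then have "\<forall>\<^sub>F k in sequentially. 1 \<le> (1 - t) / (kernel_int (m k - 1) (lower_exponent (n k)) * exp (a k * ln (real (n k))))
        * exp (a k * ln (real (n k)))"
      by (simp add: filterlim_at_top)
    then have "\<forall>\<^sub>F k in sequentially. min 1 (max 0 (1 - t) / kernel_int (m k - 1) (lower_exponent (n k))) = 1"
      by eventually_elim (use False in simp)
    from tendsto_eventually[OF this] have "(\<lambda>k. cdf (strong_law i k) t) \<longlonglongrightarrow> 1 - 1"
      by (rule strong_cdf_limit[OF i])
    then show ?thesis using False by simp
  qed
qed

lemma critical_scaling:
  assumes "\<beta> > 0"
  shows "(\<lambda>k. real (m k)) \<sim>[sequentially] (\<lambda>k. \<beta> * ln (real (n k)))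
    \<longleftrightarrow> (\<lambda>k. a k * ln (real (n k))) \<longlonglongrightarrow> 1 / \<beta>"
proof -
  have "filterlim (\<lambda>k. ln (real (n k))) at_top sequentially"
    by (intro filterlim_compose[OF ln_at_top] filterlim_compose[OF filterlim_real_sequentially] n_lim)
  then have ln0: "\<forall>\<^sub>F k in sequentially. 0 < ln (real (n k))" by (simp add: filterlim_at_top_dense)
  \<comment> \<open>This limit mediates between \<open>m\<close> in the asymptotic relation and
    \<open>m - 1\<close> in the definition of \<open>a\<close>.\<close>
  have "(\<lambda>j::nat. real j / (real j - 1)) \<longlonglongrightarrow> 1" by real_asymp
  from filterlim_compose[OF this m_lim] have q: "(\<lambda>k. real (m k) / (real (m k) - 1)) \<longlonglongrightarrow> 1" .
  \<comment> \<open>The definition of asymptotic equivalence reads \<open>0 / 0\<close> as 1;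
    \<open>m k \<noteq> 0\<close> removes that case.\<close>
  have nz: "(real (m k) = 0) = False" for k using m2[of k] by simp
  have "(\<lambda>k. real (m k)) \<sim>[sequentially] (\<lambda>k. \<beta> * ln (real (n k)))
    \<longleftrightarrow> (\<lambda>k. real (m k) / (\<beta> * ln (real (n k)))) \<longlonglongrightarrow> 1"
    unfolding asymp_equiv_def nz by simp
  also have "\<dots> \<longleftrightarrow> (\<lambda>k. a k * ln (real (n k))) \<longlonglongrightarrow> 1 / \<beta>"
  proof
    assume L: "(\<lambda>k. real (m k) / (\<beta> * ln (real (n k)))) \<longlonglongrightarrow> 1"
    have "(\<lambda>k. real (m k) / (real (m k) - 1) / (real (m k) / (\<beta> * ln (real (n k)))) / \<beta>) \<longlonglongrightarrow> 1 / 1 / \<beta>"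
      using assms by (intro tendsto_divide q L tendsto_const) auto
    moreover have "\<forall>\<^sub>F k in sequentially.
        real (m k) / (real (m k) - 1) / (real (m k) / (\<beta> * ln (real (n k)))) / \<beta> = a k * ln (real (n k))"
      using ln0
    proof eventually_elim
      case (elim k)
      then show ?case using assms m2[of k] by (simp add: a_def field_simps)
    qed
    ultimately have "(\<lambda>k. a k * ln (real (n k))) \<longlonglongrightarrow> 1 / 1 / \<beta>" by (rule Lim_transform_eventually)
    then show "(\<lambda>k. a k * ln (real (n k))) \<longlonglongrightarrow> 1 / \<beta>" by simp
  next
    assume L: "(\<lambda>k. a k * ln (real (n k))) \<longlonglongrightarrow> 1 / \<beta>"
    have "(\<lambda>k. real (m k) / (real (m k) - 1) / (\<beta> * (a k * ln (real (n k))))) \<longlonglongrightarrow> 1 / (\<beta> * (1 / \<beta>))"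
      using assms by (intro tendsto_divide tendsto_mult q L tendsto_const) auto
    moreover have "real (m k) / (real (m k) - 1) / (\<beta> * (a k * ln (real (n k)))) = real (m k) / (\<beta> * ln (real (n k)))" for k
      using m2[of k] by (simp add: a_def)
    ultimately have "(\<lambda>k. real (m k) / (\<beta> * ln (real (n k)))) \<longlonglongrightarrow> 1 / (\<beta> * (1 / \<beta>))"
      by (simp only:)
    then show "(\<lambda>k. real (m k) / (\<beta> * ln (real (n k)))) \<longlonglongrightarrow> 1" using assms by simp
  qed
  finally show ?thesis .
qed

end

theorem theorem14:
  fixes m n :: "nat \<Rightarrow> nat"
  assumes "\<And>k. m k \<ge> 2" and "\<And>k. n k \<ge> 1"
    and "filterlim m at_top sequentially" and "filterlim n at_top sequentially"
  shows
    "(\<forall>\<tau>::ereal. 0 \<le> \<tau> \<longrightarrow> (\<lambda>k. ereal (ln (real (n k)) / (real (m k) - 1))) \<longlonglongrightarrow> \<tau> \<longrightarrow>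
        (\<lambda>k. ereal (volume_ratio (m k) (n k) / real (n k)))
          \<longlonglongrightarrow> eexp (ereal (euler_mascheroni - 1) + \<tau>)
      \<and> (\<forall>i. (\<forall>\<^sub>F k in sequentially. i k \<in> {1..m k}) \<longrightarrow>
           weak_conv_m
             (\<lambda>k. uniform_law_y (m k) (n k)
                    (strong_relaxation (m k) (n k) \<inter> demand (m k) (n k)) (i k))
             (uniform_Icc (1 - real_of_ereal (eexp (- \<tau>))) 1))
      \<and> (\<forall>i. (\<forall>\<^sub>F k in sequentially. i k \<in> {1..m k}) \<longrightarrow>
           weak_conv_m
             (\<lambda>k. uniform_law_y (m k) (n k)
                    (weak_relaxation (m k) (n k) \<inter> demand (m k) (n k)) (i k))
             (uniform_Icc 0 1)))
   \<and> (\<forall>\<beta>::real. \<beta> > 0 \<longrightarrow>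
        (((\<lambda>k. real (m k)) \<sim>[sequentially] (\<lambda>k. \<beta> * ln (real (n k)))) \<longleftrightarrow>
         (\<lambda>k. ereal (ln (real (n k)) / (real (m k) - 1))) \<longlonglongrightarrow> ereal (1 / \<beta>)))"
proof -
  interpret regime m n by unfold_locales (use assms in auto)
  have a_ln: "ln (real (n k)) / (real (m k) - 1) = a k * ln (real (n k))" for k by (simp add: a_def)
  \<comment> \<open>The weak relaxation has the same limit law in every regime, so it is treated
    before the case distinction on \<tau>.\<close>
  have weak: "weak_conv_m (weak_law i) (uniform_Icc 0 1)"
    if "\<forall>\<^sub>F k in sequentially. i k \<in> {1..m k}" for i
    unfolding weak_conv_m_def weak_conv_def
  proof (intro allI impI)
    fix t
    have "cdf (uniform_Icc 0 1) t = min 1 (max 0 t)" by (simp add: cdf_uniform_Icc min_def max_def)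
    then show "(\<lambda>k. cdf (weak_law i k) t) \<longlonglongrightarrow> cdf (uniform_Icc 0 1) t"
      using weak_cdf_limit[OF that] by simp
  qed
  \<comment> \<open>Weak convergence is checked through distribution functions at every real
    \<open>t\<close>. Finite and infinite \<tau> are separate cases because the limit law
    degenerates to a point mass in the latter.\<close>
  have main: "(\<lambda>k. ereal (volume_ratio (m k) (n k) / real (n k))) \<longlonglongrightarrow> eexp (ereal (euler_mascheroni - 1) + \<tau>)
      \<and> (\<forall>i. (\<forall>\<^sub>F k in sequentially. i k \<in> {1..m k}) \<longrightarrow>
          weak_conv_m (strong_law i) (uniform_Icc (1 - real_of_ereal (eexp (- \<tau>))) 1))"
    if \<tau>: "0 \<le> \<tau>" "(\<lambda>k. ereal (a k * ln (real (n k)))) \<longlonglongrightarrow> \<tau>" for \<tau>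
  proof (cases \<tau>)
    case (real r)
    then have lim: "(\<lambda>k. a k * ln (real (n k))) \<longlonglongrightarrow> r" using \<tau>(2) by simp
    have "weak_conv_m (strong_law i) (uniform_Icc (1 - exp (- r)) 1)"
      if i: "\<forall>\<^sub>F k in sequentially. i k \<in> {1..m k}" for i
      unfolding weak_conv_m_def weak_conv_def
    proof (intro allI impI)
      fix t
      have "cdf (uniform_Icc (1 - exp (- r)) 1) t = max 0 (exp (- r) - max 0 (1 - t)) / exp (- r)"
        by (simp add: cdf_uniform_Icc min_def max_def)
      \<comment> \<open>Dividing by the interval length \<open>exp (- r)\<close> multiplies by
        \<open>exp r\<close>, which gives the form in \<open>finite_regime\<close>.\<close>
      also have "\<dots> = 1 - min 1 (max 0 (1 - t) * exp r)"
        by (simp add: exp_minus min_def max_def field_simps)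
      finally show "(\<lambda>k. cdf (strong_law i k) t) \<longlonglongrightarrow> cdf (uniform_Icc (1 - exp (- r)) 1) t"
        using finite_regime(2)[OF lim i] by simp
    qed
    then show ?thesis using finite_regime(1)[OF lim] real by (simp add: eexp_def)
  next
    case PInf
    then have lim: "filterlim (\<lambda>k. a k * ln (real (n k))) at_top sequentially"
      using \<tau>(2) by (simp add: tendsto_PInfty_eq_at_top)
    have "weak_conv_m (strong_law i) (uniform_Icc 1 1)"
      if i: "\<forall>\<^sub>F k in sequentially. i k \<in> {1..m k}" for i
      unfolding weak_conv_m_def weak_conv_def
    proof (intro allI impI)
      fix t
      have "cdf (uniform_Icc 1 1) t = (if 1 \<le> t then 1 else 0)"
        by (simp add: cdf_def uniform_Icc_def measure_return indicator_def)
      then show "(\<lambda>k. cdf (strong_law i k) t) \<longlonglongrightarrow> cdf (uniform_Icc 1 1) t"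
        using infinite_regime(2)[OF lim i, of t] by simp
    qed
    then show ?thesis
      using infinite_regime(1)[OF lim] PInf by (simp add: eexp_def tendsto_PInfty_eq_at_top)
  next
    case MInf
    then show ?thesis using \<tau>(1) by simp
  qed
  show ?thesis
    unfolding a_ln using main weak critical_scaling by simp
qed

end
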